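(* Let $F$ be a totally real number field of degree $n$, $B$ a totally indefinite quaternion division algebra over $F$ with reduced trace $\mathrm{tr}$ and reduced norm $\mathrm{n}$, and $\mathcal{O}$ a hereditary order of $B$. Let $A$ be a complex abelian variety with quaternionic multiplication by $\mathcal{O}$, written as $A(\mathbb{C})=V/\Lambda$ with $\Lambda=\mathcal{I}\cdot v_0$ as in the context. Then the map sending a line bundle class $\mathcal{L}\in\mathrm{NS}(A)$ to the unique $\mu=\mu(\mathcal{L})\in B$ with $E(\beta v_0,v_0)=\mathrm{tr}_{B/\mathbb{Q}}(\mu\beta)$ for all $\beta\in B$, where $E=c_1(\mathcal{L})$ is the Riemann form of $\mathcal{L}$, is a group isomorphism $$\mathrm{NS}(A)\xrightarrow{\ \sim\ }\mathcal{N}(\mathcal{I})_0^{\sharp}.$$ Moreover, for $\mathcal{L}_1,\mathcal{L}_2\in\mathrm{NS}(A)$, one has $\mathcal{L}_1\simeq\mathcal{L}_2$ if and only if there exists $\alpha\in\mathcal{O}^*$ with $\mu(\mathcal{L}_1)=\bar\alpha\,\mu(\mathcal{L}_2)\,\alpha$.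
   Context: $B$ totally indefinite means $B\otimes_{F,\sigma}\mathbb{R}\cong M_2(\mathbb{R})$ for every real embedding $\sigma$ of $F$; $\beta\mapsto\bar\beta$ is the canonical involution of $B$. A hereditary order is one all of whose one-sided ideals are projective. $A$ has quaternionic multiplication by $\mathcal{O}$ if $\dim A=2n$ and $\mathrm{End}(A)\cong\mathcal{O}$; we identify $\mathrm{End}(A)=\mathcal{O}$. Fix an isomorphism $B\otimes_{\mathbb{Q}}\mathbb{R}\cong\bigoplus_\sigma M_2(\mathbb{R})$, $\beta\mapsto(\beta^\sigma)_\sigma$ ($\sigma$ running over the $n$ real embeddings $\sigma_1,\dots,\sigma_n$ of $F$). Then $A(\mathbb{C})=V/\Lambda$ with $V=\mathbb{C}^{2n}$, $B$ acting on $V$ by $\beta\mapsto\mathrm{diag}(\beta^{\sigma_1},\dots,\beta^{\sigma_n})$, $v_0=(\tau_1,1,\dots,\tau_n,1)^t$ with $\mathrm{Im}\,\tau_i\neq0$, and $\Lambda=\mathcal{I}\cdot v_0$ for a left $\mathcal{O}$-ideal $\mathcal{I}\subset B$. Notation: for a left ideal $J$, $J^\sharp=\{\beta\in B:\mathrm{tr}_{B/\mathbb{Q}}(J\beta)\subseteq\mathbb{Z}\}$; $B_0=\{\beta\in B:\mathrm{tr}(\beta)=0\}$; $J_0^\sharp=J^\sharp\cap B_0$; $\mathcal{N}(J)=\mathrm{n}(J)\mathcal{O}$ is the two-sided ideal generated by the ideal $\mathrm{n}(J)$ of $F$ of reduced norms of elements of $J$. $\mathrm{NS}(A)$ is the Néron–Severi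 group; two classes $\mathcal{L}_1,\mathcal{L}_2$ are isomorphic, $\mathcal{L}_1\simeq\mathcal{L}_2$, if $\mathcal{L}_1=\alpha^*\mathcal{L}_2$ for some $\alpha\in\mathrm{Aut}(A)=\mathcal{O}^*$. The Riemann form $c_1(\mathcal{L})$ is the alternating $\mathbb{R}$-bilinear form on $V$ given by the first Chern class (Appell–Humbert). *)

theory Defs
  imports
    "HOL-Analysis.Analysis"
    "HOL-Computational_Algebra.Polynomial"
    "HOL-Algebra.Coset"
begin

section \<open>Number fields\<close>

definition unital_ring_hom :: "('a::ring_1 \<Rightarrow> 'b::ring_1) \<Rightarrow> bool" where
  "unital_ring_hom h \<longleftrightarrow>
     h 1 = 1 \<and> (\<forall>x y. h (x + y) = h x + h y) \<and> (\<forall>x y. h (x * y) = h x * h y)"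

definition rat_scale :: "rat \<Rightarrow> 'f::field_char_0 \<Rightarrow> 'f" where
  "rat_scale q x = of_rat q * x"

definition number_field :: "'f::field_char_0 itself \<Rightarrow> bool" where
  "number_field _ \<longleftrightarrow> (\<exists>S :: 'f set. finite S \<and> module.span rat_scale S = UNIV)"

definition field_degree :: "'f::field_char_0 itself \<Rightarrow> nat" where
  "field_degree _ = vector_space.dim rat_scale (UNIV :: 'f set)"

definition totally_real :: "'f::field_char_0 itself \<Rightarrow> bool" where
  "totally_real _ \<longleftrightarrow> (\<forall>s :: 'f \<Rightarrow> complex. unital_ring_hom s \<longrightarrow> range s \<subseteq> \<real>)"

definition real_embeddings :: "('f::field_char_0 \<Rightarrow> real) set" where
  "real_embeddings = {s. unital_ring_hom s}"

definition ring_of_integers :: "'f::field_char_0 set" where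
  "ring_of_integers = {x. algebraic_int x}"

text \<open>The trace of the number field over the rationals: the trace of the rational-linear
  endomorphism \<open>y \<mapsto> x * y\<close>, read off from an (arbitrary) basis.\<close>

definition field_trace :: "'f::field_char_0 \<Rightarrow> rat" where
  "field_trace x =
     (let Bs = vector_space.extend_basis rat_scale {}
      in \<Sum>b\<in>Bs. module.representation rat_scale Bs (x * b) b)"

definition int_span :: "'a::ring_1 set \<Rightarrow> 'a set" where
  "int_span S = module.span (\<lambda>(k::int) x. of_int k * x) S"


section \<open>Quaternion algebras\<close>

text \<open>An algebra over the field \<open>'f\<close> is a ring \<open>'b\<close> with a central embedding
  \<open>\<iota>\<close> of \<open>'f\<close>.\<close>

definition alg_scale :: "('f::field_char_0 \<Rightarrow> 'b::ring_1) \<Rightarrow> 'f \<Rightarrow> 'b \<Rightarrow> 'b" where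
  "alg_scale \<iota> a x = \<iota> a * x"

definition quaternion_algebra :: "('f::field_char_0 \<Rightarrow> 'b::ring_1) \<Rightarrow> bool" where
  "quaternion_algebra \<iota> \<longleftrightarrow>
     unital_ring_hom \<iota> \<and> (\<forall>a x. \<iota> a * x = x * \<iota> a) \<and>
     (\<exists>i j a b. a \<noteq> 0 \<and> b \<noteq> 0 \<and> i * i = \<iota> a \<and> j * j = \<iota> b \<and> j * i = - (i * j) \<and>
        (\<forall>x. \<exists>!(p, q, r, s). x = \<iota> p + \<iota> q * i + \<iota> r * j + \<iota> s * (i * j)))"

text \<open>The canonical involution is the only standard involution of a quaternion algebra.\<close>

definition standard_involution :: "('f::field_char_0 \<Rightarrow> 'b::ring_1) \<Rightarrow> ('b \<Rightarrow> 'b) \<Rightarrow> bool" where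
  "standard_involution \<iota> c \<longleftrightarrow>
     (\<forall>x y. c (x + y) = c x + c y) \<and> (\<forall>x y. c (x * y) = c y * c x) \<and>
     (\<forall>x. c (c x) = x) \<and> (\<forall>a. c (\<iota> a) = \<iota> a) \<and>
     (\<forall>x. x + c x \<in> range \<iota>) \<and> (\<forall>x. x * c x \<in> range \<iota>)"

definition quat_conj :: "('f::field_char_0 \<Rightarrow> 'b::ring_1) \<Rightarrow> 'b \<Rightarrow> 'b" where
  "quat_conj \<iota> = (THE c. standard_involution \<iota> c)"

definition trd :: "('f::field_char_0 \<Rightarrow> 'b::ring_1) \<Rightarrow> 'b \<Rightarrow> 'f" where
  "trd \<iota> x = the_inv \<iota> (x + quat_conj \<iota> x)"

definition nrd :: "('f::field_char_0 \<Rightarrow> 'b::ring_1) \<Rightarrow> 'b \<Rightarrow> 'f" where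
  "nrd \<iota> x = the_inv \<iota> (x * quat_conj \<iota> x)"

definition tr_BQ :: "('f::field_char_0 \<Rightarrow> 'b::ring_1) \<Rightarrow> 'b \<Rightarrow> rat" where
  "tr_BQ \<iota> x = field_trace (trd \<iota> x)"

text \<open>\<open>splitting \<iota> s \<phi>\<close>: the map \<open>\<phi>\<close> is the restriction to \<open>B\<close> of an
  isomorphism of real algebras from the scalar extension of \<open>B\<close> along the real embedding
  \<open>s\<close> onto the 2 by 2 matrices. The last two conditions are injectivity and surjectivity of
  the real-linear extension of \<open>\<phi>\<close>.\<close>

definition splitting ::
  "('f::field_char_0 \<Rightarrow> 'b::ring_1) \<Rightarrow> ('f \<Rightarrow> real) \<Rightarrow> ('b \<Rightarrow> real^2^2) \<Rightarrow> bool" where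
  "splitting \<iota> s \<phi> \<longleftrightarrow>
     (\<forall>x y. \<phi> (x + y) = \<phi> x + \<phi> y) \<and> (\<forall>x y. \<phi> (x * y) = \<phi> x ** \<phi> y) \<and>
     (\<forall>a. \<phi> (\<iota> a) = mat (s a)) \<and>
     (\<forall>S. \<not> module.dependent (alg_scale \<iota>) S \<longrightarrow> inj_on \<phi> S \<and> independent (\<phi> ` S)) \<and>
     span (range \<phi>) = UNIV"


section \<open>Orders and ideals\<close>

definition lattice_in :: "('f::field_char_0 \<Rightarrow> 'b::ring_1) \<Rightarrow> 'b set \<Rightarrow> bool" where
  "lattice_in \<iota> L \<longleftrightarrow>
     (\<exists>S. finite S \<and> L = int_span {\<iota> r * x | r x. r \<in> ring_of_integers \<and> x \<in> S}) \<and>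
     module.span (alg_scale \<iota>) L = UNIV"

definition quat_order :: "('f::field_char_0 \<Rightarrow> 'b::ring_1) \<Rightarrow> 'b set \<Rightarrow> bool" where
  "quat_order \<iota> \<O> \<longleftrightarrow>
     lattice_in \<iota> \<O> \<and> 1 \<in> \<O> \<and> (\<forall>x\<in>\<O>. \<forall>y\<in>\<O>. x * y \<in> \<O>)"

text \<open>Left and right \<open>\<O>\<close>-modules inside \<open>B\<close> are treated uniformly: \<open>act r x\<close> is
  \<open>r * x\<close> in the left case and \<open>x * r\<close> in the right case. A module is projective if it
  is a direct summand (retract) of a free module. Every module \<open>J\<close> in \<open>B\<close> is a
  quotient of the free module on the set \<open>J\<close>, so index sets \<open>X\<close> of type
  \<open>'b set\<close> suffice.\<close>

definition free_module :: "'b::ring_1 set \<Rightarrow> 'b set \<Rightarrow> ('b \<Rightarrow> 'b) set" where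
  "free_module \<O> X = {c. (\<forall>x. c x \<in> \<O>) \<and> (\<forall>x. x \<notin> X \<longrightarrow> c x = 0) \<and> finite {x. c x \<noteq> 0}}"

definition projective_module ::
  "('b::ring_1 \<Rightarrow> 'b \<Rightarrow> 'b) \<Rightarrow> 'b set \<Rightarrow> 'b set \<Rightarrow> bool" where
  "projective_module act \<O> J \<longleftrightarrow>
     (\<exists>X s p.
        (\<forall>x\<in>J. s x \<in> free_module \<O> X) \<and>
        (\<forall>x\<in>J. \<forall>y\<in>J. s (x + y) = (\<lambda>t. s x t + s y t)) \<and>
        (\<forall>r\<in>\<O>. \<forall>x\<in>J. s (act r x) = (\<lambda>t. act r (s x t))) \<and>
        (\<forall>c\<in>free_module \<O> X. p c \<in> J) \<and>
        (\<forall>c\<in>free_module \<O> X. \<forall>d\<in>free_module \<O> X. p (\<lambda>t. c t + d t) = p c + p d) \<and>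
        (\<forall>r\<in>\<O>. \<forall>c\<in>free_module \<O> X. p (\<lambda>t. act r (c t)) = act r (p c)) \<and>
        (\<forall>x\<in>J. p (s x) = x))"

definition one_sided_ideal ::
  "('b::ring_1 \<Rightarrow> 'b \<Rightarrow> 'b) \<Rightarrow> 'b set \<Rightarrow> 'b set \<Rightarrow> bool" where
  "one_sided_ideal act \<O> J \<longleftrightarrow>
     J \<subseteq> \<O> \<and> 0 \<in> J \<and> (\<forall>x\<in>J. \<forall>y\<in>J. x - y \<in> J) \<and> (\<forall>r\<in>\<O>. \<forall>x\<in>J. act r x \<in> J)"

definition hereditary_order :: "('f::field_char_0 \<Rightarrow> 'b::ring_1) \<Rightarrow> 'b set \<Rightarrow> bool" where
  "hereditary_order \<iota> \<O> \<longleftrightarrow>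
     quat_order \<iota> \<O> \<and>
     (\<forall>J. one_sided_ideal (\<lambda>r x. r * x) \<O> J \<longrightarrow> projective_module (\<lambda>r x. r * x) \<O> J) \<and>
     (\<forall>J. one_sided_ideal (\<lambda>r x. x * r) \<O> J \<longrightarrow> projective_module (\<lambda>r x. x * r) \<O> J)"

definition order_units :: "'b::ring_1 set \<Rightarrow> 'b set" where
  "order_units \<O> = {\<alpha>\<in>\<O>. \<exists>\<beta>\<in>\<O>. \<alpha> * \<beta> = 1 \<and> \<beta> * \<alpha> = 1}"

text \<open>Left \<open>\<O>\<close>-ideals of \<open>B\<close> are fractional: full lattices stable under \<open>\<O>\<close>.\<close>

definition left_ideal :: "('f::field_char_0 \<Rightarrow> 'b::ring_1) \<Rightarrow> 'b set \<Rightarrow> 'b set \<Rightarrow> bool" where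
  "left_ideal \<iota> \<O> J \<longleftrightarrow> lattice_in \<iota> J \<and> (\<forall>r\<in>\<O>. \<forall>x\<in>J. r * x \<in> J)"

definition norm_ideal :: "('f::field_char_0 \<Rightarrow> 'b::ring_1) \<Rightarrow> 'b set \<Rightarrow> 'f set" where
  "norm_ideal \<iota> J = int_span {r * nrd \<iota> x | r x. r \<in> ring_of_integers \<and> x \<in> J}"

definition norm_two_sided ::
  "('f::field_char_0 \<Rightarrow> 'b::ring_1) \<Rightarrow> 'b set \<Rightarrow> 'b set \<Rightarrow> 'b set" where
  "norm_two_sided \<iota> \<O> J = int_span {\<iota> a * x | a x. a \<in> norm_ideal \<iota> J \<and> x \<in> \<O>}"

definition dual_ideal :: "('f::field_char_0 \<Rightarrow> 'b::ring_1) \<Rightarrow> 'b set \<Rightarrow> 'b set" where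
  "dual_ideal \<iota> J = {\<beta>. \<forall>x\<in>J. tr_BQ \<iota> (x * \<beta>) \<in> \<int>}"

definition pure_quaternions :: "('f::field_char_0 \<Rightarrow> 'b::ring_1) \<Rightarrow> 'b set" where
  "pure_quaternions \<iota> = {\<beta>. trd \<iota> \<beta> = 0}"

definition pure_dual_ideal :: "('f::field_char_0 \<Rightarrow> 'b::ring_1) \<Rightarrow> 'b set \<Rightarrow> 'b set" where
  "pure_dual_ideal \<iota> J = dual_ideal \<iota> J \<inter> pure_quaternions \<iota>"

definition additive_group :: "'a::ab_group_add set \<Rightarrow> 'a monoid" where
  "additive_group S = \<lparr>carrier = S, mult = (+), one = 0\<rparr>"


section \<open>Line bundles on complex tori\<close>

text \<open>A complex torus is \<open>V / \<Lambda>\<close> with \<open>V = complex ^ 'm\<close>. Since every holomorphic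
  line bundle on \<open>V\<close> is trivial, a line bundle on \<open>V / \<Lambda>\<close> is the quotient of
  \<open>V \<times> \<complex>\<close> by an action \<open>l \<cdot> (v, t) = (v + l, e l v * t)\<close> of \<open>\<Lambda>\<close>,
  where \<open>e\<close> is a factor of automorphy, i.e. a 1-cocycle of \<open>\<Lambda>\<close> with values in the
  nowhere vanishing holomorphic functions on \<open>V\<close>. Isomorphism of line bundles is cohomology of
  cocycles and tensor product is multiplication.\<close>

definition entire :: "(complex^'m::finite \<Rightarrow> complex) \<Rightarrow> bool" where
  "entire f \<longleftrightarrow>
     (\<forall>v. \<exists>D. (f has_derivative D) (at v) \<and> (\<forall>c w. D (c *s w) = c * D w))"

text \<open>Factors of automorphy are made constant outside \<open>\<Lambda>\<close>, so that equality of
  functions is equality of cocycles.\<close>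

definition automorphy_factors ::
  "(complex^'m::finite) set \<Rightarrow> (complex^'m \<Rightarrow> complex^'m \<Rightarrow> complex) monoid" where
  "automorphy_factors \<Lambda> =
     \<lparr>carrier = {e. (\<forall>l\<in>\<Lambda>. entire (e l) \<and> (\<forall>v. e l v \<noteq> 0)) \<and>
                    (\<forall>l\<in>\<Lambda>. \<forall>m\<in>\<Lambda>. \<forall>v. e (l + m) v = e l (v + m) * e m v) \<and>
                    (\<forall>l. l \<notin> \<Lambda> \<longrightarrow> e l = (\<lambda>v. 1))},
      mult = (\<lambda>e e' l v. e l v * e' l v),
      one = (\<lambda>l v. 1)\<rparr>"

definition coboundaries ::
  "(complex^'m::finite) set \<Rightarrow> (complex^'m \<Rightarrow> complex^'m \<Rightarrow> complex) set" where
  "coboundaries \<Lambda> =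
     {(\<lambda>l v. if l \<in> \<Lambda> then h (v + l) / h v else 1) | h. entire h \<and> (\<forall>v. h v \<noteq> 0)}"

definition Pic ::
  "(complex^'m::finite) set \<Rightarrow> (complex^'m \<Rightarrow> complex^'m \<Rightarrow> complex) set monoid" where
  "Pic \<Lambda> = automorphy_factors \<Lambda> Mod coboundaries \<Lambda>"

text \<open>The first Chern class of \<open>e = exp (2 \<pi> \<i> g)\<close> is the connecting homomorphism of the
  exponential sequence: the class in the second cohomology of \<open>\<Lambda>\<close> of the integral 2-cocycle
  obtained from \<open>g\<close>, viewed as an alternating form on \<open>\<Lambda>\<close> by antisymmetrising and
  extended real-bilinearly to \<open>V\<close>.\<close>

definition is_chern_form ::
  "(complex^'m::finite) set \<Rightarrow> (complex^'m \<Rightarrow> complex^'m \<Rightarrow> complex) \<Rightarrow>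
   (complex^'m \<Rightarrow> complex^'m \<Rightarrow> real) \<Rightarrow> bool" where
  "is_chern_form \<Lambda> e E \<longleftrightarrow>
     bilinear E \<and> (\<forall>v. E v v = 0) \<and>
     (\<exists>g. (\<forall>l\<in>\<Lambda>. entire (g l) \<and> (\<forall>v. e l v = exp (2 * of_real pi * \<i> * g l v))) \<and>
          (\<forall>l\<in>\<Lambda>. \<forall>m\<in>\<Lambda>. \<forall>v.
             complex_of_real (E l m) = g m (v + l) + g l v - g l (v + m) - g m v))"

definition c1 ::
  "(complex^'m::finite) set \<Rightarrow> (complex^'m \<Rightarrow> complex^'m \<Rightarrow> complex) \<Rightarrow>
   complex^'m \<Rightarrow> complex^'m \<Rightarrow> real" where
  "c1 \<Lambda> e = (THE E. is_chern_form \<Lambda> e E)"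

text \<open>\<open>the_elem\<close> below evaluates \<open>c1\<close> on a class; it is constant on classes.\<close>

definition c1_Pic ::
  "(complex^'m::finite) set \<Rightarrow> (complex^'m \<Rightarrow> complex^'m \<Rightarrow> complex) set \<Rightarrow>
   complex^'m \<Rightarrow> complex^'m \<Rightarrow> real" where
  "c1_Pic \<Lambda> P = the_elem (c1 \<Lambda> ` P)"

definition Pic0 ::
  "(complex^'m::finite) set \<Rightarrow> (complex^'m \<Rightarrow> complex^'m \<Rightarrow> complex) set set" where
  "Pic0 \<Lambda> = {P \<in> carrier (Pic \<Lambda>). c1_Pic \<Lambda> P = (\<lambda>u v. 0)}"

definition NS ::
  "(complex^'m::finite) set \<Rightarrow> (complex^'m \<Rightarrow> complex^'m \<Rightarrow> complex) set set monoid" where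
  "NS \<Lambda> = Pic \<Lambda> Mod Pic0 \<Lambda>"

definition c1_NS ::
  "(complex^'m::finite) set \<Rightarrow> (complex^'m \<Rightarrow> complex^'m \<Rightarrow> complex) set set \<Rightarrow>
   complex^'m \<Rightarrow> complex^'m \<Rightarrow> real" where
  "c1_NS \<Lambda> L = the_elem (c1_Pic \<Lambda> ` L)"

text \<open>A complex torus is an abelian variety if it carries a positive definite Riemann form.\<close>

definition polarizable :: "(complex^'m::finite) set \<Rightarrow> bool" where
  "polarizable \<Lambda> \<longleftrightarrow>
     (\<exists>E :: complex^'m \<Rightarrow> complex^'m \<Rightarrow> real.
        bilinear E \<and> (\<forall>v. E v v = 0) \<and>
        (\<forall>l\<in>\<Lambda>. \<forall>m\<in>\<Lambda>. E l m \<in> \<int>) \<and>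
        (\<forall>u v. E (\<i> *s u) (\<i> *s v) = E u v) \<and>
        (\<forall>v. v \<noteq> 0 \<longrightarrow> E (\<i> *s v) v > 0))"

text \<open>Endomorphisms are given by their analytic representation, a complex matrix.\<close>

definition End_torus :: "(complex^'m::finite) set \<Rightarrow> (complex^'m^'m) set" where
  "End_torus \<Lambda> = {M. \<forall>l\<in>\<Lambda>. M *v l \<in> \<Lambda>}"

definition Aut_torus :: "(complex^'m::finite) set \<Rightarrow> (complex^'m^'m) set" where
  "Aut_torus \<Lambda> =
     {M \<in> End_torus \<Lambda>. \<exists>N \<in> End_torus \<Lambda>. M ** N = mat 1 \<and> N ** M = mat 1}"

text \<open>For an automorphism \<open>M\<close>, pulling back factors of automorphy is an automorphism of the
  group of factors preserving the coboundaries, so the pullback of a class is its image.\<close>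

definition pullback_factor ::
  "complex^'m^'m \<Rightarrow> (complex^'m \<Rightarrow> complex^'m \<Rightarrow> complex) \<Rightarrow>
   complex^'m::finite \<Rightarrow> complex^'m \<Rightarrow> complex" where
  "pullback_factor M e = (\<lambda>l v. e (M *v l) (M *v v))"

definition pullback_NS ::
  "complex^'m^'m \<Rightarrow> (complex^'m::finite \<Rightarrow> complex^'m \<Rightarrow> complex) set set \<Rightarrow>
   (complex^'m \<Rightarrow> complex^'m \<Rightarrow> complex) set set" where
  "pullback_NS M L = (\<lambda>P. pullback_factor M ` P) ` L"

definition NS_isomorphic ::
  "(complex^'m::finite) set \<Rightarrow> (complex^'m \<Rightarrow> complex^'m \<Rightarrow> complex) set set \<Rightarrow>
   (complex^'m \<Rightarrow> complex^'m \<Rightarrow> complex) set set \<Rightarrow> bool" where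
  "NS_isomorphic \<Lambda> L1 L2 \<longleftrightarrow> (\<exists>M \<in> Aut_torus \<Lambda>. L1 = pullback_NS M L2)"


section \<open>Tori with quaternionic multiplication\<close>

text \<open>The finite type \<open>'n\<close> indexes the real embeddings of \<open>F\<close>; the coordinates of
  \<open>V\<close> are indexed by \<open>'n \<times> 2\<close>, the \<open>k\<close>-th block consisting of the coordinates
  \<open>(k, 1)\<close> and \<open>(k, 2)\<close>.\<close>

definition quat_matrix ::
  "('n::finite \<Rightarrow> 'b \<Rightarrow> real^2^2) \<Rightarrow> 'b \<Rightarrow> complex^('n \<times> 2)^('n \<times> 2)" where
  "quat_matrix \<phi> \<beta> =
     (\<chi> p q. if fst p = fst q then complex_of_real (\<phi> (fst p) \<beta> $ snd p $ snd q) else 0)"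

definition base_vector :: "('n::finite \<Rightarrow> complex) \<Rightarrow> complex^('n \<times> 2)" where
  "base_vector \<tau> = (\<chi> p. if snd p = 1 then \<tau> (fst p) else 1)"

definition QM_lattice ::
  "('n::finite \<Rightarrow> 'b \<Rightarrow> real^2^2) \<Rightarrow> ('n \<Rightarrow> complex) \<Rightarrow> 'b set \<Rightarrow> (complex^('n \<times> 2)) set" where
  "QM_lattice \<phi> \<tau> I = {quat_matrix \<phi> \<beta> *v base_vector \<tau> | \<beta>. \<beta> \<in> I}"

definition represents ::
  "('f::field_char_0 \<Rightarrow> 'b::ring_1) \<Rightarrow> ('n::finite \<Rightarrow> 'b \<Rightarrow> real^2^2) \<Rightarrow> ('n \<Rightarrow> complex) \<Rightarrow>
   (complex^('n \<times> 2) \<Rightarrow> complex^('n \<times> 2) \<Rightarrow> real) \<Rightarrow> 'b \<Rightarrow> bool" where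
  "represents \<iota> \<phi> \<tau> E \<mu> \<longleftrightarrow>
     (\<forall>\<beta>. E (quat_matrix \<phi> \<beta> *v base_vector \<tau>) (base_vector \<tau>) = of_rat (tr_BQ \<iota> (\<mu> * \<beta>)))"

definition mu ::
  "('f::field_char_0 \<Rightarrow> 'b::ring_1) \<Rightarrow> ('n::finite \<Rightarrow> 'b \<Rightarrow> real^2^2) \<Rightarrow> ('n \<Rightarrow> complex) \<Rightarrow> 'b set \<Rightarrow>
   (complex^('n \<times> 2) \<Rightarrow> complex^('n \<times> 2) \<Rightarrow> complex) set set \<Rightarrow> 'b" where
  "mu \<iota> \<phi> \<tau> I L = (THE \<mu>. represents \<iota> \<phi> \<tau> (c1_NS (QM_lattice \<phi> \<tau> I) L) \<mu>)"

end

theory Submission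
  imports Defs "HOL-Complex_Analysis.Cauchy_Integral_Formula"
begin

text \<open>
  Fix a pure quaternion \<open>\<nu> \<noteq> 0\<close>. The form \<open>E\<^sub>\<nu>(\<beta> v\<^sub>0, \<gamma> v\<^sub>0) = tr(\<nu> \<beta> \<gamma>\<^sup>*)\<close>, with \<open>*\<close> the canonical
  involution, extends to a nondegenerate real form of type (1,1). Hence every Riemann form \<open>E\<close> is
  \<open>E\<^sub>\<nu>(M u, w)\<close> for a complex linear \<open>M\<close>, some multiple of \<open>M\<close> is an endomorphism of the torus, so \<open>M\<close>
  lies in \<open>B\<close> and \<open>E = E\<^sub>\<mu>\<close> with \<open>\<mu> = \<nu> M\<close>; that \<open>E\<close> alternates means that \<open>\<mu>\<close> is pure.

  The form \<open>E\<^sub>\<mu>\<close> is integral on \<open>I v\<^sub>0\<close> iff \<open>\<mu>\<close> is dual to \<open>K = I I\<^sup>*\<close>, so it remains to see that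
  \<open>K = n(I) \<O>\<close>. Since \<open>\<O>\<close> is hereditary and is the full left order of \<open>I\<close>, both \<open>I\<close> and \<open>K\<close> are
  invertible. Modulo \<open>n(I)\<close>, a product \<open>x\<^sub>1 x\<^sub>2\<^sup>* x\<^sub>3 x\<^sub>4\<^sup>* \<dots>\<close> with factors in \<open>I\<close> changes sign when two
  neighbouring \<open>x\<^sub>i\<close> are exchanged, because \<open>x y\<^sup>* + y x\<^sup>*\<close> is a combination of norms; as \<open>I\<close> is finitely
  generated, this gives \<open>K\<^sup>m\<^sup>+\<^sup>1 \<subseteq> n(I) K\<^sup>m\<close> for large \<open>m\<close>, and \<open>K\<close> can be cancelled.

  Line bundles correspond to Riemann forms by the theorem of Appell and Humbert. That a Chern form has
  type (1,1) is obtained by averaging the cocycle relation along the lattice directions.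
\<close>

text \<open>The hypothesis End(A) = \<O> acts in three places: it puts the complex linear map M into
  B, it turns automorphisms into units, and it shows that every d with d I \<subseteq> I lies in
  \<O>. Projectivity alone gives 1 in I^{-1} I; cancelling K also needs 1 in I I^{-1}, and there the
  third use enters. \<open>lattice_in\<close> supplies generators over the ring of integers, whereas
  integrality of reduced traces, and a real basis of V generating the lattice, rest on finitely many
  generators over Z. These come from the polarization: its integer values on a real basis inside the
  lattice confine the lattice to a finitely generated group, and subgroups need no more generators
  than the group. Reduced trace, involution and tr_{B/Q} are computed in the real matrices \<phi> k,
  where conjugation is the adjugate; a single \<phi> k is already injective and carries identities
  back to B. The trace form is nondegenerate because B is a division ring and tr 1 = 2n; this turns
  Q-linear functionals into elements of B and makes \<mu> unique.\<close>

section \<open>Subgroups of abelian groups and their generators\<close>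

definition add_subgroup :: "'a::ab_group_add set \<Rightarrow> bool" where
  "add_subgroup T \<longleftrightarrow> 0 \<in> T \<and> (\<forall>x\<in>T. \<forall>y\<in>T. x - y \<in> T)"

text \<open>Closure under differences alone leaves a single binary case in inductions. Any abelian
  group is allowed, so F, B and the lattice in V share one notion.\<close>

inductive_set zspan :: "'a::ab_group_add set \<Rightarrow> 'a set" for S where
  zspan_0: "0 \<in> zspan S"
| zspan_base: "x \<in> S \<Longrightarrow> x \<in> zspan S"
| zspan_diff: "x \<in> zspan S \<Longrightarrow> y \<in> zspan S \<Longrightarrow> x - y \<in> zspan S"

lemma add_subgroup_0: "add_subgroup T \<Longrightarrow> 0 \<in> T"
  and add_subgroup_diff: "add_subgroup T \<Longrightarrow> x \<in> T \<Longrightarrow> y \<in> T \<Longrightarrow> x - y \<in> T"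
  by (auto simp: add_subgroup_def)

lemma add_subgroup_uminus: "add_subgroup T \<Longrightarrow> x \<in> T \<Longrightarrow> - x \<in> T"
  using add_subgroup_diff[of T 0 x] add_subgroup_0[of T] by simp

lemma add_subgroup_add: "add_subgroup T \<Longrightarrow> x \<in> T \<Longrightarrow> y \<in> T \<Longrightarrow> x + y \<in> T"
  using add_subgroup_diff[of T x "- y"] add_subgroup_uminus[of T y] by simp

lemma add_subgroup_sum: "add_subgroup T \<Longrightarrow> (\<And>i. i \<in> A \<Longrightarrow> f i \<in> T) \<Longrightarrow> sum f A \<in> T"
  by (induction A rule: infinite_finite_induct) (auto simp: add_subgroup_0 add_subgroup_add)

lemma add_subgroup_zspan [simp]: "add_subgroup (zspan S)"
  by (auto simp: add_subgroup_def intro: zspan.intros)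

lemma add_subgroup_Int: "add_subgroup S \<Longrightarrow> add_subgroup T \<Longrightarrow> add_subgroup (S \<inter> T)"
  by (auto simp: add_subgroup_def)

lemma zspan_minimal: "S \<subseteq> T \<Longrightarrow> add_subgroup T \<Longrightarrow> zspan S \<subseteq> T"
proof
  fix x assume "S \<subseteq> T" "add_subgroup T" "x \<in> zspan S"
  from this(3,1,2) show "x \<in> T"
    by (induction rule: zspan.induct) (auto simp: add_subgroup_def)
qed

lemma zspan_mono: "S \<subseteq> T \<Longrightarrow> zspan S \<subseteq> zspan T"
  by (rule zspan_minimal) (auto intro: zspan_base)

lemmas zspan_add = add_subgroup_add[OF add_subgroup_zspan]
lemmas zspan_sum = add_subgroup_sum[OF add_subgroup_zspan]
lemmas zspan_uminus = add_subgroup_uminus[OF add_subgroup_zspan]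

lemma zspan_additive_image:
  assumes "\<And>x y. f (x - y) = f x - f y" "x \<in> zspan S" "add_subgroup T" "\<And>s. s \<in> S \<Longrightarrow> f s \<in> T"
  shows "f x \<in> T"
  using assms(2)
proof (induction rule: zspan.induct)
  case zspan_0
  have "f 0 = 0" using assms(1)[of 0 0] by simp
  then show ?case using assms(3) by (simp add: add_subgroup_0)
qed (use assms in \<open>auto simp: add_subgroup_diff\<close>)

lemma additive_image_zspan:
  assumes "\<And>x y. f (x - y) = f x - f y"
  shows "f ` zspan S = zspan (f ` S)"
proof
  show "f ` zspan S \<subseteq> zspan (f ` S)"
    using zspan_additive_image[of f _ S "zspan (f ` S)"] assms by (auto intro: zspan_base)
  have "f 0 = 0" using assms[of 0 0] by simp
  have "f x - f y \<in> f ` zspan S" if "x \<in> zspan S" "y \<in> zspan S" for x y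
    using zspan_diff[OF that] by (rule rev_image_eqI) (simp add: assms)
  moreover have "0 \<in> f ` zspan S" using zspan_0[of S] \<open>f 0 = 0\<close> by (rule rev_image_eqI[OF _ sym])
  ultimately have "add_subgroup (f ` zspan S)"
    unfolding add_subgroup_def by blast
  then show "zspan (f ` S) \<subseteq> f ` zspan S" by (intro zspan_minimal) (blast intro: zspan_base)+
qed

text \<open>Iterated addition, since \<open>ab_group_add\<close> has no integer scalars; it becomes
  multiplication by \<open>of_int\<close> in rings and \<open>scaleR\<close> in real vector
  spaces.\<close>

definition zmul :: "int \<Rightarrow> 'a::ab_group_add \<Rightarrow> 'a" where
  "zmul k x = (if 0 \<le> k then ((+) x ^^ nat k) 0 else - (((+) x ^^ nat (- k)) 0))"

lemma zmul_0 [simp]: "zmul 0 x = 0"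
  by (simp add: zmul_def)

lemma zmul_add_1: "zmul (k + 1) x = zmul k x + x"
proof (cases "0 \<le> k")
  case True
  then have "nat (k + 1) = Suc (nat k)" by simp
  then show ?thesis using True by (simp add: zmul_def)
next
  case False
  then have *: "nat (- k) = Suc (nat (- (k + 1)))" by simp
  have "((+) x ^^ nat (- k)) 0 = x + ((+) x ^^ nat (- (k + 1))) 0"
    unfolding * by simp
  then show ?thesis using False by (cases "k = -1") (auto simp: zmul_def)
qed

lemma zmul_1 [simp]: "zmul 1 x = x"
  using zmul_add_1[of 0 x] by simp

lemma zmul_diff_1: "zmul (k - 1) x = zmul k x - x"
  using zmul_add_1[of "k - 1" x] by simp

lemma zmul_add: "zmul (k + l) x = zmul k x + zmul l x"
proof (induction l rule: int_induct[where k = 0])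
  case (step1 i)
  then show ?case using zmul_add_1[of "k + i" x] zmul_add_1[of i x] by (simp add: add.assoc)
next
  case (step2 i)
  have "zmul (k + (i - 1)) x = zmul (k + i) x - x"
    using zmul_diff_1[of "k + i" x] by (simp add: add_diff_eq)
  then show ?case using step2 by (simp add: zmul_diff_1)
qed simp

lemma zmul_minus: "zmul (- k) x = - zmul k x"
  using zmul_add[of "- k" k x] by (simp add: eq_neg_iff_add_eq_0)

lemma zmul_diff: "zmul (k - l) x = zmul k x - zmul l x"
  using zmul_add[of k "- l" x] by (simp add: zmul_minus)

lemma zmul_mult: "zmul (k * l) x = zmul k (zmul l x)"
proof (induction k rule: int_induct[where k = 0])
  case (step1 i)
  then show ?case by (simp add: zmul_add_1 distrib_right zmul_add)
next
  case (step2 i)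
  then show ?case by (simp add: zmul_diff_1 left_diff_distrib zmul_diff)
qed simp

lemma zmul_distrib: "zmul k (x + y) = zmul k x + zmul k y"
proof (induction k rule: int_induct[where k = 0])
  case (step1 i)
  then show ?case by (simp add: zmul_add_1)
next
  case (step2 i)
  then show ?case by (simp add: zmul_diff_1)
qed simp

lemma zmul_in: "add_subgroup T \<Longrightarrow> x \<in> T \<Longrightarrow> zmul k x \<in> T"
proof (induction k rule: int_induct[where k = 0])
  case base
  then show ?case by (simp add: add_subgroup_0)
next
  case (step1 i)
  then show ?case by (simp add: zmul_add_1 add_subgroup_add)
next
  case (step2 i)
  then show ?case by (simp add: zmul_diff_1 add_subgroup_diff)
qed

lemma zmul_of_int: "zmul k x = of_int k * (x :: 'a::ring_1)"
  by (induction k rule: int_induct[where k = 0]) (auto simp: zmul_add_1 zmul_diff_1 algebra_simps)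

lemma zmul_scaleR: "zmul k x = of_int k *\<^sub>R (x :: 'a::real_vector)"
  by (induction k rule: int_induct[where k = 0]) (auto simp: zmul_add_1 zmul_diff_1 algebra_simps)

lemma zspan_insertD:
  assumes "y \<in> zspan (insert x S)"
  shows "\<exists>k. \<exists>g\<in>zspan S. y = zmul k x + g"
  using assms
proof (induction rule: zspan.induct)
  case zspan_0
  then show ?case by (intro exI[of _ 0] bexI[of _ 0]) (auto intro: zspan.zspan_0)
next
  case (zspan_base y)
  then show ?case
    by (metis add.right_neutral add_cancel_left_left insertE zmul_0 zmul_1 zspan.zspan_0 zspan.zspan_base)
next
  case (zspan_diff y z)
  then obtain k g l h where "y = zmul k x + g" "z = zmul l x + h" "g \<in> zspan S" "h \<in> zspan S" by auto
  then show ?case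
    by (intro exI[of _ "k - l"] bexI[of _ "g - h"]) (auto simp: zmul_diff intro: zspan.zspan_diff)
qed

lemma zspan_empty [simp]: "zspan {} = {0}"
  using zspan_minimal[of "{}" "{0}"] zspan_0[of "{}"] by (auto simp: add_subgroup_def)

text \<open>The coefficients of one generator \<open>x\<close> occurring in \<open>H\<close> form an
  ideal of the integers. A generator \<open>d\<close> of it, lifted to some \<open>h\<close> in
  \<open>H\<close>, splits \<open>H\<close> into the multiples of \<open>h\<close> and the part of
  \<open>H\<close> in the span of the other generators. The bound on \<open>card T\<close> later
  forces a generating set of the lattice to be independent.\<close>

lemma zspan_subgroup_finitely_generated:
  assumes "finite S" "add_subgroup H" "H \<subseteq> zspan S"
  shows "\<exists>T. finite T \<and> card T \<le> card S \<and> zspan T = H"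
  using assms
proof (induction S arbitrary: H rule: finite_induct)
  case empty
  then have "H = {0}" by (auto simp: add_subgroup_0)
  then show ?case by (intro exI[of _ "{}"]) auto
next
  case (insert x S)
  define D where "D = {k. \<exists>g\<in>zspan S. zmul k x + g \<in> H}"
  have D_diff: "k - l \<in> D" if kl: "k \<in> D" "l \<in> D" for k l
  proof -
    obtain g h where "g \<in> zspan S" "h \<in> zspan S" "zmul k x + g \<in> H" "zmul l x + h \<in> H"
      using kl unfolding D_def by blast
    moreover have "zmul (k - l) x + (g - h) = (zmul k x + g) - (zmul l x + h)"
      by (simp add: zmul_diff)
    ultimately show ?thesis
      using insert.prems(1) unfolding D_def
      by (metis (mono_tags, lifting) add_subgroup_diff mem_Collect_eq zspan_diff)
  qed
  have sub: "add_subgroup (H \<inter> zspan S)"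
    by (rule add_subgroup_Int) (auto simp: insert.prems)
  then obtain T where T: "finite T" "card T \<le> card S" "zspan T = H \<inter> zspan S"
    using insert.IH[OF sub] by auto
  have D_of: "\<exists>k\<in>D. \<exists>g\<in>zspan S. y = zmul k x + g" if y: "y \<in> H" for y
    using zspan_insertD[of y x S] y insert.prems(2) by (auto simp: D_def)
  show ?case
  proof (cases "D \<subseteq> {0}")
    case True
    then have "H \<subseteq> zspan S" using D_of by fastforce
    then show ?thesis using T insert by (intro exI[of _ T]) (auto simp: card_insert_if)
  next
    case False
    then obtain k0 where "k0 \<in> D" "k0 \<noteq> 0" by auto
    moreover have "0 \<in> D" using D_diff[OF \<open>k0 \<in> D\<close> \<open>k0 \<in> D\<close>] by simp
    ultimately have "\<bar>k0\<bar> \<in> D" "\<bar>k0\<bar> > 0" using D_diff[of 0 k0] by (auto simp: abs_if)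
    then have ex: "\<exists>n::nat. n > 0 \<and> int n \<in> D" by (intro exI[of _ "nat \<bar>k0\<bar>"]) auto
    define d where "d = (LEAST n::nat. n > 0 \<and> int n \<in> D)"
    have d: "d > 0" "int d \<in> D" using LeastI_ex[OF ex] by (auto simp: d_def)
    have least: "n \<ge> d" if "n > 0" "int n \<in> D" for n
      unfolding d_def using that by (intro Least_le) auto
    have mulD: "q * int d \<in> D" for q
    proof (induction q rule: int_induct[where k = 0])
      case base
      then show ?case using \<open>0 \<in> D\<close> by simp
    next
      case (step1 i)
      have "i * int d - (0 - int d) \<in> D" using step1 d D_diff \<open>0 \<in> D\<close> by blast
      then show ?case by (simp add: algebra_simps)
    next
      case (step2 i)
      have "i * int d - int d \<in> D" using step2 d D_diff by blast
      then show ?case by (simp add: algebra_simps)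
    qed
    \<comment> \<open>The remainder modulo \<open>d\<close> lies in \<open>D\<close> and is smaller
      than \<open>d\<close>, so minimality makes it 0.\<close>
    have dvdD: "\<exists>q. k = q * int d" if "k \<in> D" for k
    proof -
      have "k - k div int d * int d \<in> D" using D_diff[OF that mulD] .
      then have "k mod int d \<in> D" by (simp add: minus_div_mult_eq_mod)
      then have "int (nat (k mod int d)) \<in> D" using d by simp
      moreover have "nat (k mod int d) < d" using d by (simp add: nat_less_iff)
      ultimately have "\<not> nat (k mod int d) > 0" using least by (meson not_le)
      then have "k mod int d \<le> 0" by simp
      then have "k mod int d = 0" using d by (intro antisym) auto
      then show ?thesis by (metis mod_0_imp_dvd dvd_def mult.commute)
    qed
    obtain g where g: "g \<in> zspan S" "zmul (int d) x + g \<in> H" using d by (auto simp: D_def)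
    define h where "h = zmul (int d) x + g"
    have "H = zspan (insert h T)"
    proof
      show "zspan (insert h T) \<subseteq> H"
        using g T insert.prems by (intro zspan_minimal) (auto simp: h_def intro: zspan_base)
      show "H \<subseteq> zspan (insert h T)"
      proof
        fix y assume y: "y \<in> H"
        then obtain k g' where k: "k \<in> D" "g' \<in> zspan S" "y = zmul k x + g'" using D_of by blast
        obtain q where q: "k = q * int d" using dvdD k by blast
        \<comment> \<open>Subtracting \<open>q\<close> copies of \<open>h\<close> removes the
          \<open>x\<close>-component of \<open>y\<close>.\<close>
        have eq: "y - zmul q h = g' - zmul q g"
          by (simp add: h_def k q zmul_mult zmul_distrib)
        have "y - zmul q h \<in> zspan S" unfolding eq using k g by (auto intro!: zspan_diff zmul_in)
        moreover have "y - zmul q h \<in> H"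
          using y g insert.prems(1) by (auto simp: h_def intro!: add_subgroup_diff zmul_in)
        ultimately have "y - zmul q h \<in> zspan (insert h T)"
          using T zspan_mono[of T "insert h T"] by auto
        moreover have "zmul q h \<in> zspan (insert h T)" by (intro zmul_in zspan_base) auto
        ultimately have "y - zmul q h + zmul q h \<in> zspan (insert h T)" by (rule zspan_add)
        then show "y \<in> zspan (insert h T)" by simp
      qed
    qed
    then show ?thesis using T insert
      by (intro exI[of _ "insert h T"]) (auto simp: card_insert_if)
  qed
qed

lemma int_span_eq_zspan: "int_span S = zspan S"
proof -
  interpret module "\<lambda>(k::int) (x::'a). of_int k * x"
    by unfold_locales (simp_all add: distrib_left distrib_right mult.assoc)
  have sc: "of_int k * x \<in> zspan S" if "x \<in> zspan S" for k and x :: 'a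
    using that zmul_in[OF add_subgroup_zspan, of x S k] by (simp add: zmul_of_int)
  have "span S \<subseteq> zspan S"
    by (rule span_minimal) (auto simp: subspace_def intro: zspan_base zspan_0 zspan_add sc)
  moreover have "zspan S \<subseteq> span S"
    by (rule zspan_minimal) (auto simp: add_subgroup_def span_base span_zero span_diff)
  ultimately show ?thesis by (simp add: int_span_def)
qed

lemma int_span_base: "x \<in> S \<Longrightarrow> x \<in> int_span S"
  by (simp add: int_span_eq_zspan zspan_base)

lemma add_subgroup_int_span [simp]: "add_subgroup (int_span S)"
  by (simp add: int_span_eq_zspan)

lemma int_span_minimal: "S \<subseteq> T \<Longrightarrow> add_subgroup T \<Longrightarrow> int_span S \<subseteq> T"
  by (simp add: int_span_eq_zspan zspan_minimal)

lemma int_span_additive_image: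
  assumes "\<And>x y. f (x - y) = f x - f y" "x \<in> int_span S" "add_subgroup T" "\<And>s. s \<in> S \<Longrightarrow> f s \<in> T"
  shows "f x \<in> T"
  using assms zspan_additive_image[of f x S T] by (simp add: int_span_eq_zspan)

section \<open>Integral elements\<close>

text \<open>A monic integral equation stated without polynomials, so that it makes sense in the
  noncommutative ring B; in fields it agrees with \<open>algebraic_int\<close>.\<close>

definition integral_elem :: "'a::ring_1 \<Rightarrow> bool" where
  "integral_elem t \<longleftrightarrow> (\<exists>n. t ^ n \<in> zspan {t ^ i | i. i < n})"

text \<open>The powers span a subgroup of a finitely generated group, so finitely many elements
  generate it. These involve only powers below some \<open>N\<close>, which makes
  \<open>t ^ N\<close> a combination of lower powers.\<close>

lemma integral_elem_of_powers:
  fixes t :: "'a::ring_1"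
  assumes "finite S" "\<And>k. t ^ k \<in> zspan S"
  shows "integral_elem t"
proof -
  have "zspan (range (\<lambda>k. t ^ k)) \<subseteq> zspan S" by (rule zspan_minimal) (use assms in auto)
  then obtain T where T: "finite T" "zspan T = zspan (range (\<lambda>k. t ^ k))"
    using zspan_subgroup_finitely_generated[OF assms(1) add_subgroup_zspan] by blast
  have fin: "\<exists>n. x \<in> zspan {t ^ i | i. i < n}" if "x \<in> zspan (range (\<lambda>k. t ^ k))" for x
    using that
  proof (induction rule: zspan.induct)
    case (zspan_base x)
    then obtain k where "x = t ^ k" by auto
    then show ?case by (intro exI[of _ "Suc k"] zspan.zspan_base) auto
  next
    case (zspan_diff x y)
    then obtain m n where "x \<in> zspan {t ^ i | i. i < m}" "y \<in> zspan {t ^ i | i. i < n}" by auto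
    then have "x \<in> zspan {t ^ i | i. i < max m n}" "y \<in> zspan {t ^ i | i. i < max m n}"
      using zspan_mono[of "{t ^ i | i. i < m}" "{t ^ i | i. i < max m n}"]
        zspan_mono[of "{t ^ i | i. i < n}" "{t ^ i | i. i < max m n}"] by fastforce+
    then show ?case by (blast intro: zspan.zspan_diff)
  qed (auto intro: zspan.zspan_0)
  have "\<exists>n. x \<in> zspan {t ^ i | i. i < n}" if "x \<in> T" for x
    using fin zspan_base[OF that] unfolding T(2) by blast
  then have n: "x \<in> zspan {t ^ i | i. i < n x}"
    if "x \<in> T" "n = (\<lambda>x. SOME n. x \<in> zspan {t ^ i | i. i < n})" for x n
    using that by (auto intro: someI_ex)
  define n where "n = (\<lambda>x. SOME n. x \<in> zspan {t ^ i | i. i < n})"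
  \<comment> \<open>Any common bound of the exponents will do; the sum avoids a maximum over a
    possibly empty set.\<close>
  define N where "N = (\<Sum>x\<in>T. n x)"
  have "T \<subseteq> zspan {t ^ i | i. i < N}"
  proof
    fix x assume "x \<in> T"
    then have "n x \<le> N" using T(1) unfolding N_def by (intro member_le_sum) auto
    then have "{t ^ i | i. i < n x} \<subseteq> {t ^ i | i. i < N}" by auto
    then show "x \<in> zspan {t ^ i | i. i < N}"
      using n[OF \<open>x \<in> T\<close> n_def] zspan_mono by blast
  qed
  then have "zspan T \<subseteq> zspan {t ^ i | i. i < N}" by (rule zspan_minimal) auto
  moreover have "t ^ N \<in> zspan T" unfolding T(2) by (intro zspan_base) auto
  ultimately show ?thesis unfolding integral_elem_def by blast
qed

lemma zspan_powers_closed: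
  fixes t :: "'a::ring_1"
  assumes "t ^ n \<in> zspan {t ^ i | i. i < n}"
  shows "t ^ k \<in> zspan {t ^ i | i. i < n}"
proof (induction k)
  case 0
  then show ?case using assms by (cases n) (auto intro!: zspan_base exI[of _ 0])
next
  case (Suc k)
  have "t * t ^ k \<in> zspan {t ^ i | i. i < n}"
  proof (rule zspan_additive_image[OF _ Suc])
    fix s assume "s \<in> {t ^ i | i. i < n}"
    then obtain i where i: "s = t ^ i" "i < n" by auto
    then show "t * s \<in> zspan {t ^ i | i. i < n}"
    proof (cases "Suc i = n")
      case True
      then show ?thesis using assms i by auto
    next
      case False
      then show ?thesis using i by (auto intro!: zspan_base exI[of _ "Suc i"])
    qed
  qed (auto simp: algebra_simps)
  then show ?case by simp
qed

text \<open>The finitely many products \<open>x ^ i * y ^ j\<close> span a group stable under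
  multiplication by \<open>x\<close> and by \<open>y\<close>; commutation is what allows
  \<open>y\<close> to pass \<open>x ^ i\<close>.\<close>

lemma integral_elem_commute:
  fixes x y :: "'a::ring_1"
  assumes "integral_elem x" "integral_elem y" "x * y = y * x"
  shows "integral_elem (x + y)" "integral_elem (x * y)"
proof -
  obtain n m where n: "x ^ n \<in> zspan {x ^ i | i. i < n}" and m: "y ^ m \<in> zspan {y ^ i | i. i < m}"
    using assms by (auto simp: integral_elem_def)
  define S where "S = {x ^ i * y ^ j | i j. i < n \<and> j < m}"
  have "S = (\<lambda>(i,j). x ^ i * y ^ j) ` ({..<n} \<times> {..<m})" by (auto simp: S_def)
  then have fin: "finite S" by simp
  have all: "x ^ k * y ^ l \<in> zspan S" for k l
  proof -
    have 1: "x ^ i * y ^ l \<in> zspan S" if "i < n" for i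
      by (rule zspan_additive_image[OF _ zspan_powers_closed[OF m, of l]])
         (use that in \<open>auto simp: S_def algebra_simps intro!: zspan_base\<close>)
    show ?thesis
      by (rule zspan_additive_image[where f = "\<lambda>z. z * y ^ l", OF _ zspan_powers_closed[OF n, of k]])
         (use 1 in \<open>auto simp: algebra_simps\<close>)
  qed
  have com: "y * x ^ k = x ^ k * y" for k
    using assms(3) by (metis power_commuting_commutes)
  have mulx: "x * z \<in> zspan S" if "z \<in> zspan S" for z
  proof (rule zspan_additive_image[OF _ that])
    fix s assume "s \<in> S"
    then obtain i j where "s = x ^ i * y ^ j" by (auto simp: S_def)
    then show "x * s \<in> zspan S" using all[of "Suc i" j] by (simp add: mult.assoc)
  qed (auto simp: algebra_simps)
  have muly: "y * z \<in> zspan S" if "z \<in> zspan S" for z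
  proof (rule zspan_additive_image[OF _ that])
    fix s assume "s \<in> S"
    then obtain i j where "s = x ^ i * y ^ j" by (auto simp: S_def)
    then have "y * s = x ^ i * y ^ Suc j" using com[of i] by (metis mult.assoc power_Suc)
    then show "y * s \<in> zspan S" using all[of i "Suc j"] by simp
  qed (auto simp: algebra_simps)
  have "1 \<in> zspan S" using all[of 0 0] by simp
  then have "(x + y) ^ k \<in> zspan S" for k
    by (induction k) (auto simp: distrib_right intro!: zspan_add mulx muly)
  then show "integral_elem (x + y)" by (rule integral_elem_of_powers[OF fin])
  have "(x * y) ^ k = x ^ k * y ^ k" for k
  proof (induction k)
    case (Suc k)
    have "(x * y) ^ Suc k = x * (y * x ^ k) * y ^ k" using Suc by (simp add: mult.assoc)
    then show ?case by (simp add: com mult.assoc)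
  qed simp
  then show "integral_elem (x * y)" using all by (intro integral_elem_of_powers[OF fin]) simp
qed

lemma zspan_powers_sum:
  fixes t :: "'a::ring_1"
  assumes "x \<in> zspan {t ^ i | i. i < n}"
  shows "\<exists>c::nat \<Rightarrow> int. x = (\<Sum>i<n. of_int (c i) * t ^ i)"
  using assms
proof (induction rule: zspan.induct)
  case zspan_0
  then show ?case by (intro exI[of _ "\<lambda>_. 0"]) simp
next
  case (zspan_base x)
  then obtain j where j: "x = t ^ j" "j < n" by auto
  have "(\<Sum>i<n. of_int (if i = j then 1 else 0) * t ^ i) = (\<Sum>i<n. if i = j then t ^ i else 0)"
    by (intro sum.cong) auto
  also have "\<dots> = x" using j by simp
  finally show ?case by (intro exI[of _ "\<lambda>i. if i = j then 1 else 0"]) simp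
next
  case (zspan_diff x y)
  then obtain c d where "x = (\<Sum>i<n. of_int (c i) * t ^ i)" "y = (\<Sum>i<n. of_int (d i) * t ^ i)" by auto
  then show ?case
    by (intro exI[of _ "\<lambda>i. c i - d i"]) (simp add: left_diff_distrib sum_subtractf)
qed

lemma integral_elem_iff_algebraic_int:
  fixes t :: "'a::field_char_0"
  shows "integral_elem t \<longleftrightarrow> algebraic_int t"
proof
  assume "integral_elem t"
  then obtain n where "t ^ n \<in> zspan {t ^ i | i. i < n}" by (auto simp: integral_elem_def)
  from zspan_powers_sum[OF this] obtain c where c: "t ^ n = (\<Sum>i<n. of_int (c i) * t ^ i)" by auto
  define p :: "'a poly" where "p = monom 1 n - (\<Sum>i<n. monom (of_int (c i)) i)"
  have co: "coeff (\<Sum>i<n. monom (of_int (c i)) i :: 'a poly) j = (if j < n then of_int (c j) else 0)" for j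
    by (simp add: coeff_sum)
  have "degree p = n" "coeff p n = 1"
  proof -
    show "coeff p n = 1" by (simp add: p_def co)
    then show "degree p = n"
      by (intro antisym degree_le le_degree) (auto simp: p_def co)
  qed
  moreover have "poly p t = 0"
    by (simp add: p_def poly_monom poly_sum c)
  moreover have "coeff p i \<in> \<int>" for i by (simp add: p_def co)
  ultimately show "algebraic_int t"
    by (intro algebraic_int.intros[of p]) auto
next
  assume "algebraic_int t"
  then obtain p where p: "\<And>i. coeff p i \<in> \<int>" "poly p t = 0" "lead_coeff p = 1"
    by cases blast
  have "poly p t = (\<Sum>i<degree p. coeff p i * t ^ i) + t ^ degree p"
    by (simp add: poly_altdef p flip: lessThan_Suc_atMost)
  then have "t ^ degree p = - (\<Sum>i<degree p. coeff p i * t ^ i)"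
    using p by (simp add: eq_neg_iff_add_eq_0 add.commute)
  moreover have "coeff p i * t ^ i \<in> zspan {t ^ i | i. i < degree p}" if "i < degree p" for i
  proof -
    obtain k where "coeff p i = of_int k" using p(1) Ints_cases by blast
    moreover have "zmul k (t ^ i) \<in> zspan {t ^ i | i. i < degree p}"
      by (intro zmul_in zspan_base) (use that in auto)
    ultimately show ?thesis by (simp add: zmul_of_int)
  qed
  ultimately have "t ^ degree p \<in> zspan {t ^ i | i. i < degree p}"
    by (auto intro: zspan_uminus zspan_sum)
  then show "integral_elem t" unfolding integral_elem_def by blast
qed

text \<open>Only powers have to be respected, not products, so that the anti-automorphism
  \<open>cj\<close> is covered.\<close>

lemma integral_elem_hom:
  assumes "integral_elem t" "f 1 = 1" "\<And>x y. f (x - y) = f x - f y" "\<And>k. f (t ^ k) = f t ^ k"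
  shows "integral_elem (f t)"
proof -
  obtain n where n: "t ^ n \<in> zspan {t ^ i | i. i < n}" using assms(1) by (auto simp: integral_elem_def)
  have "f (t ^ n) \<in> zspan {f t ^ i | i. i < n}"
    by (rule zspan_additive_image[OF assms(3) n]) (auto simp: assms(4) intro!: zspan_base)
  then show ?thesis unfolding integral_elem_def assms(4) by blast
qed

section \<open>Entire functions of several variables\<close>

lemma of_real_scalar_mult: "complex_of_real r *s (w :: complex^'m) = r *\<^sub>R w"
  by (simp add: vec_eq_iff complex_eq_iff)

lemma entireI:
  assumes "\<And>v. (f has_derivative D v) (at v)" "\<And>v c w. D v (c *s w) = c * D v w"
  shows "entire f"
  using assms unfolding entire_def by blast

lemma entireD:
  assumes "entire f"
  shows "\<exists>D. \<forall>v. (f has_derivative D v) (at v) \<and> (\<forall>c w. D v (c *s w) = c * D v w)"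
  using assms unfolding entire_def by (rule choice)

lemma entire_continuous: "entire f \<Longrightarrow> continuous_on S f"
  by (meson continuous_at_imp_continuous_on entire_def has_derivative_continuous)

lemma entire_const: "entire (\<lambda>v. c)"
  by (rule entireI[where D = "\<lambda>v w. 0"]) auto

lemma entire_add:
  assumes "entire f" "entire g"
  shows "entire (\<lambda>v. f v + g v)"
proof -
  obtain D where D: "\<And>v. (f has_derivative D v) (at v)" "\<And>v c w. D v (c *s w) = c * D v w"
    using entireD[OF assms(1)] by blast
  obtain D' where D': "\<And>v. (g has_derivative D' v) (at v)" "\<And>v c w. D' v (c *s w) = c * D' v w"
    using entireD[OF assms(2)] by blast
  show ?thesis
    by (rule entireI[OF has_derivative_add[OF D(1) D'(1)]]) (simp add: D D' distrib_left)
qed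

lemma entire_mult:
  assumes "entire f" "entire g"
  shows "entire (\<lambda>v. f v * g v)"
proof -
  obtain D where D: "\<And>v. (f has_derivative D v) (at v)" "\<And>v c w. D v (c *s w) = c * D v w"
    using entireD[OF assms(1)] by blast
  obtain D' where D': "\<And>v. (g has_derivative D' v) (at v)" "\<And>v c w. D' v (c *s w) = c * D' v w"
    using entireD[OF assms(2)] by blast
  show ?thesis
    by (rule entireI[OF has_derivative_mult[OF D(1) D'(1)]]) (simp add: D D' algebra_simps)
qed

lemma entire_minus: "entire f \<Longrightarrow> entire (\<lambda>v. - f v)"
  using entire_mult[OF entire_const[of "-1"], of f] by simp

lemma entire_diff: "entire f \<Longrightarrow> entire g \<Longrightarrow> entire (\<lambda>v. f v - g v)"
  using entire_add[OF _ entire_minus, of f g] by simp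

lemma entire_outer:
  assumes "entire f" "\<And>v. (h has_field_derivative h' v) (at (f v))"
  shows "entire (\<lambda>v. h (f v))"
proof -
  obtain D where D: "\<And>v. (f has_derivative D v) (at v)" "\<And>v c w. D v (c *s w) = c * D v w"
    using entireD[OF assms(1)] by blast
  have "((\<lambda>v. h (f v)) has_derivative (\<lambda>w. h' v * D v w)) (at v)" for v
    using has_derivative_compose[OF D(1)[of v] assms(2)[of v, THEN has_field_derivative_imp_has_derivative]]
    by (simp add: mult.commute)
  then show ?thesis by (rule entireI) (simp add: D)
qed

lemma entire_exp: "entire f \<Longrightarrow> entire (\<lambda>v. exp (f v))"
  by (rule entire_outer[where h = exp and h' = "\<lambda>v. exp (f v)"]) (auto intro: DERIV_exp)

lemma entire_inverse: "entire f \<Longrightarrow> (\<And>v. f v \<noteq> 0) \<Longrightarrow> entire (\<lambda>v. inverse (f v))"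
  by (rule entire_outer[OF _ DERIV_inverse])

lemma entire_divide: "entire f \<Longrightarrow> entire g \<Longrightarrow> (\<And>v. g v \<noteq> 0) \<Longrightarrow> entire (\<lambda>v. f v / g v)"
  using entire_mult[OF _ entire_inverse, of f g] by (simp add: divide_inverse)

lemma entire_affine:
  fixes M :: "complex^'n^'m"
  assumes "entire f"
  shows "entire (\<lambda>v. f (M *v v + l))"
proof -
  obtain D where D: "\<And>v. (f has_derivative D v) (at v)" "\<And>v c w. D v (c *s w) = c * D v w"
    using entireD[OF assms(1)] by blast
  have lin: "bounded_linear (\<lambda>v. M *v v)"
    by (intro linear_conv_bounded_linear[THEN iffD1] linearI)
       (simp_all add: matrix_vector_right_distrib flip: of_real_scalar_mult add: vector_scalar_commute)
  have "((\<lambda>v. f (M *v v + l)) has_derivative (\<lambda>w. D (M *v v + l) (M *v w))) (at v)" for v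
    by (rule has_derivative_compose[OF _ D(1)])
       (auto intro!: derivative_eq_intros bounded_linear.has_derivative[OF lin])
  then show ?thesis
    by (rule entireI) (simp add: D vector_scalar_commute)
qed

lemma entire_shift: "entire f \<Longrightarrow> entire (\<lambda>v. f (v + l))"
  using entire_affine[of f "mat 1" l] by simp

lemma entire_linear_form:
  fixes h :: "complex^'m::finite \<Rightarrow> complex"
  assumes "linear h" "\<And>c w. h (c *s w) = c * h w"
  shows "entire h"
  by (rule entireI[where D = "\<lambda>v. h"])
     (use assms in \<open>auto intro!: bounded_linear_imp_has_derivative simp: linear_conv_bounded_linear\<close>)

definition dird :: "(complex^'m::finite \<Rightarrow> complex) \<Rightarrow> complex^'m \<Rightarrow> complex^'m \<Rightarrow> complex" where
  "dird f v w = frechet_derivative f (at v) w"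

lemma entire_dird:
  assumes "entire f"
  shows "(f has_derivative dird f v) (at v)" "dird f v (c *s w) = c * dird f v w"
    "dird f v (w + w') = dird f v w + dird f v w'"
proof -
  obtain D where D: "\<And>v. (f has_derivative D v) (at v)" "\<And>v c w. D v (c *s w) = c * D v w"
    using entireD[OF assms(1)] by blast
  have eq: "dird f v = D v" for v
    unfolding dird_def using frechet_derivative_at[OF D(1)[of v]] by simp
  show 1: "(f has_derivative dird f v) (at v)" "dird f v (c *s w) = c * dird f v w"
    using D by (simp_all add: eq)
  show "dird f v (w + w') = dird f v w + dird f v w'"
    using has_derivative_linear[OF 1(1)] by (rule linear_add)
qed

lemma entire_line:
  assumes "entire f"
  shows "((\<lambda>z. f (v + z *s w)) has_field_derivative dird f (v + z *s w) w) (at z)"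
proof -
  have lin: "linear (\<lambda>z. z *s w)"
    by (intro linearI) (auto simp: vec_eq_iff algebra_simps)
  have "((\<lambda>z. v + z *s w) has_derivative (\<lambda>z'. 0 + z' *s w)) (at z)"
    using lin by (intro has_derivative_add has_derivative_const bounded_linear_imp_has_derivative)
                 (simp add: linear_conv_bounded_linear)
  then have "((\<lambda>z. f (v + z *s w)) has_derivative (\<lambda>z'. dird f (v + z *s w) (z' *s w))) (at z)"
    using has_derivative_compose[OF _ entire_dird(1)[OF assms]] by (simp only: add_0_left)
  moreover have "(\<lambda>z'. dird f (v + z *s w) (z' *s w)) = (*) (dird f (v + z *s w) w)"
    by (rule ext) (simp add: entire_dird(2)[OF assms])
  ultimately show ?thesis by (simp only: has_field_derivative_def)
qed

text \<open>\<open>entire\<close> asks only for a complex linear derivative at each point. Cauchy's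
  formula on the complex line through \<open>v\<close> in direction \<open>w\<close> writes this
  derivative as an integral that depends continuously on \<open>v\<close>; continuity is what
  permits derivatives to be averaged.\<close>

lemma dird_continuous:
  fixes f :: "complex^'m::finite \<Rightarrow> complex"
  assumes "entire f"
  shows "continuous_on UNIV (\<lambda>v. dird f v w)"
proof -
  have "dird f v w = 1 / (2 * of_real pi * \<i>) *
      integral (cbox 0 1) (\<lambda>t. f (v + circlepath 0 1 t *s w) / (circlepath 0 1 t)\<^sup>2 *
        (2 * of_real pi * \<i> * exp (2 * of_real pi * \<i> * of_real t)))" for v
  proof -
    have hol: "(\<lambda>z. f (v + z *s w)) holomorphic_on A" for A
      using entire_line[OF assms] by (meson DERIV_subset holomorphic_on_def field_differentiable_def subset_UNIV)
    have 1: "((\<lambda>z. f (v + z *s w)) has_field_derivative dird f v w) (at 0)"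
      using entire_line[OF assms, of v w 0] by simp
    have 2: "((\<lambda>z. f (v + z *s w)) has_field_derivative (1 / (2 * of_real pi * \<i>) *
        contour_integral (circlepath 0 1) (\<lambda>u. f (v + u *s w) / (u - 0)\<^sup>2))) (at 0)"
      by (rule Cauchy_derivative_integral_circlepath)
         (auto intro: hol holomorphic_on_imp_continuous_on)
    show ?thesis
      unfolding DERIV_unique[OF 1 2] contour_integral_integral
      by (simp add: vector_derivative_circlepath)
  qed
  moreover have "continuous_on UNIV (\<lambda>v. integral (cbox 0 1) (\<lambda>t. f (v + circlepath 0 1 t *s w) / (circlepath 0 1 t)\<^sup>2 *
        (2 * of_real pi * \<i> * exp (2 * of_real pi * \<i> * of_real t))))"
  proof (rule integral_continuous_on_param)
    have c: "continuous_on (UNIV \<times> cbox 0 (1::real)) (\<lambda>p::(complex^'m) \<times> real. fst p + circlepath 0 1 (snd p) *s w)"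
      unfolding circlepath vector_scalar_mult_def
      by (intro continuous_intros)
    show "continuous_on (UNIV \<times> cbox 0 1) (\<lambda>(v,t). f (v + circlepath 0 1 t *s w) / (circlepath 0 1 t)\<^sup>2 *
        (2 * of_real pi * \<i> * exp (2 * of_real pi * \<i> * of_real t)))"
      unfolding case_prod_unfold
      by (intro continuous_intros continuous_on_compose2[OF entire_continuous[OF assms, of UNIV] c])
         (auto simp: circlepath intro!: continuous_intros)
  qed
  ultimately show ?thesis by (auto intro!: continuous_intros)
qed

section \<open>Averaging along lattice directions\<close>

text \<open>The mean over the segment from \<open>v\<close> to \<open>v + b\<close>, so that
  averaging a derivative in direction \<open>b\<close> gives the difference of the two end
  values.\<close>

definition average :: "complex^'m::finite \<Rightarrow> (complex^'m \<Rightarrow> complex) \<Rightarrow> complex^'m \<Rightarrow> complex" where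
  "average b f v = integral (cbox 0 1) (\<lambda>t. f (v + t *\<^sub>R b))"

abbreviation continuous_fun :: "(complex^'m::finite \<Rightarrow> complex) \<Rightarrow> bool" where
  "continuous_fun \<equiv> continuous_on UNIV"

lemma average_integrable: "continuous_fun f \<Longrightarrow> (\<lambda>t. f (v + t *\<^sub>R b)) integrable_on cbox (0::real) 1"
  by (rule integrable_continuous, rule continuous_on_compose2[of UNIV f]) (auto intro!: continuous_intros)

lemma average_continuous: "continuous_fun f \<Longrightarrow> continuous_fun (average b f)"
  unfolding average_def[abs_def]
  by (rule integral_continuous_on_param, unfold case_prod_unfold, rule continuous_on_compose2[of UNIV f])
     (auto intro!: continuous_intros)

lemma average_commute:
  assumes "continuous_fun f"
  shows "average a (average b f) = average b (average a f)"
proof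
  fix v
  have "integral (cbox 0 1) (\<lambda>s. integral (cbox 0 1) (\<lambda>t. f (v + s *\<^sub>R a + t *\<^sub>R b))) =
      integral (cbox 0 1) (\<lambda>t. integral (cbox 0 1) (\<lambda>s. f (v + s *\<^sub>R a + t *\<^sub>R b)))"
    by (rule integral_swap_continuous, unfold case_prod_unfold, rule continuous_on_compose2[OF assms])
       (auto intro!: continuous_intros)
  then show "average a (average b f) v = average b (average a f) v"
    by (simp add: average_def algebra_simps)
qed

lemma average_add:
  "continuous_fun f \<Longrightarrow> continuous_fun g \<Longrightarrow>
    average b (\<lambda>v. f v + g v) = (\<lambda>v. average b f v + average b g v)"
  unfolding average_def[abs_def]
  by (rule ext, rule integral_add) (auto intro!: average_integrable[unfolded cbox_interval])

lemma average_cmult: "average b (\<lambda>v. c * f v) = (\<lambda>v. c * average b f v)"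
  by (simp add: average_def[abs_def])

lemma average_const: "average b (\<lambda>v. c) = (\<lambda>v. c)"
  by (simp add: average_def[abs_def])

lemma average_dird:
  assumes "entire f"
  shows "average b (\<lambda>v. dird f v b) = (\<lambda>v. f (v + b) - f v)"
proof
  fix v
  have *: "((\<lambda>t. f (v + t *\<^sub>R b)) has_vector_derivative dird f (v + t *\<^sub>R b) b) (at t within {0..1})" for t
  proof -
    have "((\<lambda>t. f (v + t *\<^sub>R b)) has_derivative (\<lambda>t'. dird f (v + t *\<^sub>R b) (t' *\<^sub>R b))) (at t within {0..1})"
      by (rule has_derivative_compose[OF _ entire_dird(1)[OF assms]])
         (auto intro!: derivative_eq_intros)
    then show ?thesis
      using entire_dird(2)[OF assms, of "v + t *\<^sub>R b" "of_real _" b]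
      by (simp add: has_vector_derivative_def of_real_scalar_mult scaleR_conv_of_real)
  qed
  have "((\<lambda>t. dird f (v + t *\<^sub>R b) b) has_integral (f (v + 1 *\<^sub>R b) - f (v + 0 *\<^sub>R b))) {0..1}"
    by (rule fundamental_theorem_of_calculus) (use * in auto)
  then show "average b (\<lambda>v. dird f v b) v = f (v + b) - f v"
    by (simp add: average_def integral_unique)
qed

definition averages :: "(complex^'m::finite) list \<Rightarrow> (complex^'m \<Rightarrow> complex) \<Rightarrow> complex^'m \<Rightarrow> complex" where
  "averages bs f = foldr average bs f"

lemma averages_continuous: "continuous_fun f \<Longrightarrow> continuous_fun (averages bs f)"
  by (induction bs) (auto simp: averages_def average_continuous)

lemma averages_add:
  "continuous_fun f \<Longrightarrow> continuous_fun g \<Longrightarrow>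
    averages bs (\<lambda>v. f v + g v) = (\<lambda>v. averages bs f v + averages bs g v)"
proof (induction bs)
  case (Cons a bs)
  then show ?case
    using average_add[OF averages_continuous[of f bs] averages_continuous[of g bs], of a]
    by (simp add: averages_def)
qed (simp add: averages_def)

lemma averages_cmult: "averages bs (\<lambda>v. c * f v) = (\<lambda>v. c * averages bs f v)"
  by (induction bs) (auto simp: averages_def average_cmult)

lemma averages_const: "averages bs (\<lambda>v. c) = (\<lambda>v. c)"
  by (induction bs) (auto simp: averages_def average_const)

lemma averages_diff:
  "continuous_fun f \<Longrightarrow> continuous_fun g \<Longrightarrow>
    averages bs (\<lambda>v. f v - g v) = (\<lambda>v. averages bs f v - averages bs g v)"
  using averages_add[of f "\<lambda>v. -1 * g v" bs] averages_cmult[of bs "-1" g]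
  by (simp add: continuous_on_minus)

lemma average_averages:
  "continuous_fun f \<Longrightarrow> average b (averages bs f) = averages bs (average b f)"
proof (induction bs)
  case (Cons a bs)
  then show ?case
    using average_commute[OF averages_continuous[OF Cons.prems], of b a bs] by (simp add: averages_def)
qed (simp add: averages_def)

text \<open>By Fubini the directions commute, so any one of them can be averaged first; it will be
  the one that undoes a derivative.\<close>

lemma averages_remove1:
  "continuous_fun f \<Longrightarrow> b \<in> set bs \<Longrightarrow> averages bs f = averages (remove1 b bs) (average b f)"
proof (induction bs)
  case (Cons a bs)
  then show ?case
    using average_averages[of f b bs] by (auto simp: averages_def)
qed simp

text \<open>Averaging the relation between \<open>g a\<close> and \<open>g b\<close> over all other basis directions turns its
  differences into derivatives: \<open>E a b = c b a - c a b\<close> with \<open>c a\<close> complex linear. So \<open>E\<close> has no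
  (0,2)-part, and being real it has no (2,0)-part either.\<close>

lemma chern_form_type_1_1:
  fixes E :: "complex^'m::finite \<Rightarrow> complex^'m \<Rightarrow> real"
  assumes bil: "bilinear E" and alt: "\<And>v. E v v = 0"
    and fin: "finite B" and ind: "independent B" and sp: "span B = UNIV"
    and g: "\<And>b. b \<in> B \<Longrightarrow> entire (g b)"
    and E: "\<And>a b v. a \<in> B \<Longrightarrow> b \<in> B \<Longrightarrow>
      complex_of_real (E a b) = g b (v + a) + g a v - g a (v + b) - g b v"
  shows "E (\<i> *s u) (\<i> *s w) = E u w"
proof -
  obtain bs where bs: "set bs = B" "distinct bs" using finite_distinct_list[OF fin] by auto
  \<comment> \<open>The direction \<open>a\<close> is left out. Averaging along \<open>b\<close>
    then turns the derivative of \<open>g a\<close> in direction \<open>b\<close> into a difference,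
    and \<open>c a b\<close>, \<open>c b a\<close> become averages over the same remaining
    directions. The base point 0 is arbitrary.\<close>
  define c where "c a w = averages (remove1 a bs) (\<lambda>v. dird (g a) v w) 0" for a w
  have c_add: "c a (w + w') = c a w + c a w'" if "a \<in> B" for a w w'
    unfolding c_def entire_dird(3)[OF g[OF that]]
    by (subst averages_add) (auto intro!: dird_continuous g that)
  have c_mult: "c a (k *s w) = k * c a w" if "a \<in> B" for a w k
    unfolding c_def entire_dird(2)[OF g[OF that]] averages_cmult ..
  have c_ab: "c a b = averages (remove1 b (remove1 a bs)) (\<lambda>v. g a (v + b) - g a v) 0"
    if "a \<in> B" "b \<in> B" "a \<noteq> b" for a b
    unfolding c_def using that bs
    by (subst averages_remove1[where b = b]) (auto intro!: dird_continuous g simp: average_dird[OF g])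
  have cE: "complex_of_real (E a b) = c b a - c a b" if ab: "a \<in> B" "b \<in> B" for a b
  proof (cases "a = b")
    case False
    have cont: "continuous_fun (\<lambda>v. g a (v + b) - g a v)" if "a \<in> B" for a b
      using that by (intro entire_continuous entire_diff entire_shift g) auto
    have "c b a - c a b = averages (remove1 b (remove1 a bs))
        (\<lambda>v. (g b (v + a) - g b v) - (g a (v + b) - g a v)) 0"
      using ab False
      by (subst averages_diff[OF cont cont]) (auto simp: c_ab remove1_commute)
    also have "(\<lambda>v. (g b (v + a) - g b v) - (g a (v + b) - g a v)) = (\<lambda>v. complex_of_real (E a b))"
      using E[OF ab] by (auto simp: algebra_simps)
    finally show ?thesis by (simp add: averages_const)
  qed (simp add: alt)
  define r where "r u a = representation B u a" for u a
  have r: "(\<Sum>a\<in>B. r u a *\<^sub>R a) = u" for u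
    unfolding r_def using sum_representation_eq[OF ind _ fin order_refl] sp by auto
  \<comment> \<open>Real linear extension of \<open>c\<close> in the first argument; in the second
    it stays complex linear.\<close>
  define C where "C u w = (\<Sum>a\<in>B. of_real (r u a) * c a w)" for u w
  have C_mult: "C u (k *s w) = k * C u w" for u w k
    by (simp add: C_def c_mult sum_distrib_left mult.left_commute)
  have c_sum: "c b u = (\<Sum>a\<in>B. of_real (r u a) * c b a)" if "b \<in> B" for b u
  proof -
    have 0: "c b 0 = 0" using c_mult[OF that, of 0 0] by simp
    have "c b (\<Sum>a\<in>A. r u a *\<^sub>R a) = (\<Sum>a\<in>A. of_real (r u a) * c b a)" if "finite A" for A
      using that
      by (induction A rule: finite_induct)
         (auto simp: 0 c_add[OF \<open>b \<in> B\<close>] c_mult[OF \<open>b \<in> B\<close>] simp flip: of_real_scalar_mult)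
    from this[OF fin] show ?thesis by (simp add: r)
  qed
  have EC: "complex_of_real (E u w) = C w u - C u w" for u w
  proof -
    have lin1: "linear (\<lambda>u. E u w)" and lin2: "linear (\<lambda>w. E u w)" for u w
      using bil by (auto simp: bilinear_def)
    have "E u w = E (\<Sum>a\<in>B. r u a *\<^sub>R a) (\<Sum>b\<in>B. r w b *\<^sub>R b)" by (simp only: r)
    also have "\<dots> = (\<Sum>a\<in>B. r u a * E a (\<Sum>b\<in>B. r w b *\<^sub>R b))"
      by (simp only: linear_sum[OF lin1] linear_scale[OF lin1] real_scaleR_def)
    also have "\<dots> = (\<Sum>a\<in>B. \<Sum>b\<in>B. r u a * (r w b * E a b))"
      by (simp add: linear_sum[OF lin2] linear_scale[OF lin2] sum_distrib_left)
    finally have "complex_of_real (E u w) =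
        (\<Sum>a\<in>B. \<Sum>b\<in>B. of_real (r u a) * (of_real (r w b) * (c b a - c a b)))"
      by (simp add: cE)
    also have "\<dots> = (\<Sum>a\<in>B. \<Sum>b\<in>B. of_real (r w b) * (of_real (r u a) * c b a)) -
        (\<Sum>a\<in>B. \<Sum>b\<in>B. of_real (r u a) * (of_real (r w b) * c a b))"
      by (simp add: right_diff_distrib sum_subtractf mult.left_commute)
    also have "(\<Sum>a\<in>B. \<Sum>b\<in>B. of_real (r w b) * (of_real (r u a) * c b a)) = C w u"
      unfolding C_def by (subst sum.swap) (simp add: c_sum[of _ u] sum_distrib_left)
    also have "(\<Sum>a\<in>B. \<Sum>b\<in>B. of_real (r u a) * (of_real (r w b) * c a b)) = C u w"
      unfolding C_def by (simp add: c_sum[of _ w] sum_distrib_left)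
    finally show ?thesis .
  qed
  \<comment> \<open>Both sides expand to the same expression in \<open>C\<close> by linearity in the
    second argument. The left side is real and the right side purely imaginary, so both
    vanish.\<close>
  have "complex_of_real (E (\<i> *s u) (\<i> *s w)) - complex_of_real (E u w) =
      \<i> * (complex_of_real (E (\<i> *s u) w) + complex_of_real (E u (\<i> *s w)))"
    by (simp add: EC C_mult algebra_simps)
  then have "complex_of_real (E (\<i> *s u) (\<i> *s w) - E u w) =
      \<i> * complex_of_real (E (\<i> *s u) w + E u (\<i> *s w))" by simp
  then show ?thesis by (simp add: complex_eq_iff)
qed

section \<open>Chern forms on a lattice\<close>

definition riemann_forms :: "(complex^'m::finite) set \<Rightarrow> (complex^'m \<Rightarrow> complex^'m \<Rightarrow> real) set" where
  "riemann_forms \<Lambda> = {E. bilinear E \<and> (\<forall>v. E v v = 0) \<and> (\<forall>l\<in>\<Lambda>. \<forall>m\<in>\<Lambda>. E l m \<in> \<int>) \<and>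
     (\<forall>u v. E (\<i> *s u) (\<i> *s v) = E u v)}"

text \<open>The intermediate group: Chern classes identify NS with it, trace forms identify it with
  the dual ideal.\<close>

definition form_group ::
  "(complex^'m::finite) set \<Rightarrow> (complex^'m \<Rightarrow> complex^'m \<Rightarrow> real) monoid" where
  "form_group \<Lambda> = \<lparr>carrier = riemann_forms \<Lambda>, mult = (\<lambda>E F u v. E u v + F u v), one = (\<lambda>u v. 0)\<rparr>"

lemma alternating_skew:
  assumes "bilinear E" "\<And>v. E v v = (0::real)"
  shows "E u v = - E v u"
proof -
  have "E (u + v) (u + v) = E u u + E u v + (E v u + E v v)"
    by (simp add: assms(1) bilinear_ladd bilinear_radd)
  then show ?thesis by (simp add: assms(2))
qed

lemma exp_2pi_i_eq_1: "exp (2 * of_real pi * \<i> * z) = 1 \<longleftrightarrow> z \<in> \<int>"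
proof
  assume "exp (2 * of_real pi * \<i> * z) = 1"
  then obtain n :: int where "Re (2 * of_real pi * \<i> * z) = 0" "Im (2 * of_real pi * \<i> * z) = of_int (2 * n) * pi"
    unfolding exp_eq_1 by auto
  then have "z = of_int n" by (simp add: complex_eq_iff)
  then show "z \<in> \<int>" by simp
next
  assume "z \<in> \<int>"
  then obtain n where "z = of_int n" by (rule Ints_cases)
  then show "exp (2 * of_real pi * \<i> * z) = 1" unfolding exp_eq_1 by auto
qed

text \<open>V is connected and distinct integers have distance at least 1. This removes the
  dependence on \<open>v\<close> from every discrepancy between logarithms.\<close>

lemma integer_valued_constant:
  fixes f :: "complex^'m::finite \<Rightarrow> complex"
  assumes "continuous_on UNIV f" "\<And>v. f v \<in> \<int>"
  shows "f v = f w"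
proof -
  have "f constant_on UNIV"
  proof (rule continuous_discrete_range_constant[OF connected_UNIV assms(1)])
    fix x
    have "1 \<le> norm (f y - f x)" if "f y \<noteq> f x" for y
    proof -
      obtain m n where mn: "f y = of_int m" "f x = of_int n" using assms(2) Ints_cases by metis
      then have "m \<noteq> n" using that by auto
      then have "\<bar>real_of_int (m - n)\<bar> \<ge> 1" by linarith
      then show ?thesis unfolding mn of_int_diff[symmetric] norm_of_int .
    qed
    then show "\<exists>e>0. \<forall>y. y \<in> UNIV \<and> f y \<noteq> f x \<longrightarrow> e \<le> norm (f y - f x)"
      by (intro exI[of _ 1]) auto
  qed
  then show ?thesis unfolding constant_on_def by auto
qed

text \<open>Contractibility of V gives a continuous logarithm \<open>h\<close>; near
  \<open>v\<close> it equals \<open>Ln (f x / f v) + h v\<close>, which is differentiable with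
  complex linear derivative.\<close>

lemma entire_logarithm:
  fixes f :: "complex^'m::finite \<Rightarrow> complex"
  assumes "entire f" "\<And>v. f v \<noteq> 0"
  shows "\<exists>g. entire g \<and> (\<forall>v. f v = exp (2 * of_real pi * \<i> * g v))"
proof -
  obtain h where h: "continuous_on UNIV h" "\<And>v. f v = exp (h v)"
    using continuous_logarithm_on_contractible[of UNIV f] entire_continuous[OF assms(1)] assms(2)
    by (metis UNIV_I contractible_UNIV)
  obtain D where D: "\<And>v. (f has_derivative D v) (at v)" "\<And>v c w. D v (c *s w) = c * D v w"
    using entireD[OF assms(1)] by blast
  have "(h has_derivative (\<lambda>w. D v w / f v)) (at v)" for v
  proof -
    have "((\<lambda>x. f x / f v) has_derivative (\<lambda>w. D v w / f v)) (at v)"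
      using has_derivative_mult_left[OF D(1), of "inverse (f v)"] by (simp add: divide_inverse)
    moreover have "(Ln has_derivative (*) 1) (at (f v / f v))"
      using has_field_derivative_Ln[of 1] assms(2)[of v] by (simp add: has_field_derivative_def)
    ultimately have "((\<lambda>x. Ln (f x / f v)) has_derivative (\<lambda>w. 1 * (D v w / f v))) (at v)"
      by (rule has_derivative_compose)
    then have der: "((\<lambda>x. Ln (f x / f v) + h v) has_derivative (\<lambda>w. D v w / f v)) (at v)"
      using has_derivative_add[OF _ has_derivative_const] by fastforce
    have "isCont h v" using h(1) by (simp add: continuous_on_eq_continuous_at)
    then have "\<forall>\<^sub>F x in at v. dist (h x) (h v) < 1"
      unfolding isCont_def tendsto_iff by (simp add: zero_less_one)
    then have "\<forall>\<^sub>F x in at v. Ln (f x / f v) + h v = h x"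
    proof (rule eventually_mono)
      fix x assume "dist (h x) (h v) < 1"
      then have "\<bar>Im (h x - h v)\<bar> < 1"
        using abs_Im_le_cmod[of "h x - h v"] by (simp add: dist_norm)
      \<comment> \<open>This keeps the imaginary part within the range where \<open>Ln\<close>
        inverts \<open>exp\<close>.\<close>
      moreover have "pi > 3" using pi_gt3 .
      ultimately have "Ln (exp (h x - h v)) = h x - h v" by (intro Ln_exp) auto
      then show "Ln (f x / f v) + h v = h x" by (simp add: h(2) exp_diff)
    qed
    moreover have "Ln (f v / f v) + h v = h v" using assms(2) by simp
    ultimately show ?thesis using has_derivative_transform_eventually[OF der] by simp
  qed
  then have "entire h" by (rule entireI) (simp add: D)
  then have "entire (\<lambda>v. (1 / (2 * of_real pi * \<i>)) * h v)" by (intro entire_mult entire_const)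
  moreover have "f v = exp (2 * of_real pi * \<i> * ((1 / (2 * of_real pi * \<i>)) * h v))" for v
    by (simp add: h(2))
  ultimately show ?thesis by blast
qed

lemma complex_linear_of_ii:
  fixes h :: "complex^'m::finite \<Rightarrow> complex"
  assumes "linear h" "\<And>w. h (\<i> *s w) = \<i> * h w"
  shows "h (c *s w) = c * h w"
proof -
  have "c *s w = Re c *\<^sub>R w + Im c *\<^sub>R (\<i> *s w)"
    by (simp add: vec_eq_iff complex_eq_iff)
  then have "h (c *s w) = of_real (Re c) * h w + of_real (Im c) * (\<i> * h w)"
    by (simp add: linear_add[OF assms(1)] linear_scale[OF assms(1)] assms(2) scaleR_conv_of_real[where 'a = complex])
  also have "\<dots> = (of_real (Re c) + \<i> * of_real (Im c)) * h w" by (simp add: algebra_simps)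
  finally show ?thesis by (simp add: complex_eq[symmetric])
qed

locale complex_lattice =
  fixes \<Lambda> B :: "(complex^'m::finite) set"
  assumes finite_B: "finite B" and independent_B: "independent B" and span_B: "span B = UNIV"
    and lattice: "\<Lambda> = zspan B"
begin

lemma B_subset: "b \<in> B \<Longrightarrow> b \<in> \<Lambda>"
  by (simp add: lattice zspan_base)

lemma subgroup_lattice: "add_subgroup \<Lambda>"
  by (simp add: lattice)

lemma lattice_add: "l \<in> \<Lambda> \<Longrightarrow> m \<in> \<Lambda> \<Longrightarrow> l + m \<in> \<Lambda>"
  using add_subgroup_add[OF subgroup_lattice] .

lemma bilinear_ext:
  assumes "bilinear E" "bilinear F" "\<And>a b. a \<in> B \<Longrightarrow> b \<in> B \<Longrightarrow> E a b = F a b"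
  shows "E = F"
proof (intro ext)
  fix u w
  show "E u w = F u w"
    by (rule bilinear_eq[OF assms(1,2), of UNIV B UNIV B]) (auto simp: span_B assms(3))
qed

lemma bilinear_extension:
  fixes p :: "complex^'m \<Rightarrow> complex^'m \<Rightarrow> real"
  shows "\<exists>F. bilinear F \<and> (\<forall>a\<in>B. \<forall>b\<in>B. F a b = p a b)"
proof -
  define r where "r u a = representation B u a" for u a
  have r_add: "r (u + w) a = r u a + r w a" and r_scale: "r (c *\<^sub>R u) a = c * r u a" for u w a c
    using span_B independent_B by (simp_all add: r_def representation_add representation_scale)
  have r_B: "r b a = (if a = b then 1 else 0)" if "b \<in> B" for a b
    using that independent_B by (simp add: r_def representation_basis)
  define F where "F u w = (\<Sum>a\<in>B. \<Sum>b\<in>B. r u a * (r w b * p a b))" for u w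
  have "bilinear F"
    unfolding bilinear_def
    by (auto intro!: linearI simp: F_def r_add r_scale distrib_right distrib_left sum.distrib sum_distrib_left mult.left_commute mult.assoc)
  moreover have "F a b = p a b" if "a \<in> B" "b \<in> B" for a b
  proof -
    have "F a b = (\<Sum>c\<in>B. \<Sum>d\<in>B. if c = a then if d = b then p c d else 0 else 0)"
      unfolding F_def by (intro sum.cong) (auto simp: r_B that)
    also have "\<dots> = (\<Sum>c\<in>B. if c = a then p c b else 0)"
      using that finite_B by (intro sum.cong) auto
    finally show ?thesis using that finite_B by simp
  qed
  ultimately show ?thesis by blast
qed

lemma lattice_bilinear_Ints:
  fixes E :: "complex^'m \<Rightarrow> complex^'m \<Rightarrow> real"
  assumes "bilinear E" "\<And>a b. a \<in> B \<Longrightarrow> b \<in> B \<Longrightarrow> E a b \<in> \<int>" "l \<in> \<Lambda>" "m \<in> \<Lambda>"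
  shows "E l m \<in> \<int>"
proof -
  have Z: "add_subgroup (\<int> :: real set)" by (auto simp: add_subgroup_def)
  have 1: "E a m \<in> \<int>" if "a \<in> B" for a
    by (rule zspan_additive_image[OF _ _ Z, of "E a" m B])
       (use assms that in \<open>auto simp: bilinear_rsub lattice\<close>)
  show ?thesis
    by (rule zspan_additive_image[OF _ _ Z, of "\<lambda>l. E l m" l B])
       (use assms 1 in \<open>auto simp: bilinear_lsub lattice\<close>)
qed

text \<open>The hypotheses are asymmetric because \<open>f\<close> will be a commutator of
  logarithms, additive only on the lattice, and \<open>f'\<close> a linear form on V.\<close>

lemma lattice_additive_eq:
  fixes f f' :: "complex^'m \<Rightarrow> 'a::ab_group_add"
  assumes "\<And>x y. x \<in> \<Lambda> \<Longrightarrow> y \<in> \<Lambda> \<Longrightarrow> f (x + y) = f x + f y"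
    and "\<And>x y. f' (x - y) = f' x - f' y"
    and "\<And>b. b \<in> B \<Longrightarrow> f b = f' b" and "l \<in> \<Lambda>"
  shows "f l = f' l"
proof -
  have 0: "0 \<in> \<Lambda>" using subgroup_lattice by (simp add: add_subgroup_0)
  have f0: "f 0 = 0" using assms(1)[OF 0 0] by simp
  have f'0: "f' 0 = 0" using assms(2)[of 0 0] by simp
  from assms(4) show ?thesis
    unfolding lattice
  proof (induction rule: zspan.induct)
    case (zspan_diff x y)
    have "f (x - y + y) = f (x - y) + f y"
      using zspan_diff.hyps by (intro assms(1)) (auto simp: lattice intro: zspan.zspan_diff)
    then have "f (x - y) = f x - f y" by simp
    then show ?case using zspan_diff.IH assms(2)[of x y] by simp
  qed (auto simp: f0 f'0 assms(3))
qed

lemma automorphy_factorD: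
  assumes "e \<in> carrier (automorphy_factors \<Lambda>)"
  shows "l \<in> \<Lambda> \<Longrightarrow> entire (e l)" "l \<in> \<Lambda> \<Longrightarrow> e l v \<noteq> 0"
    "l \<in> \<Lambda> \<Longrightarrow> m \<in> \<Lambda> \<Longrightarrow> e (l + m) v = e l (v + m) * e m v"
    "l \<notin> \<Lambda> \<Longrightarrow> e l = (\<lambda>v. 1)"
  using assms by (auto simp: automorphy_factors_def)

text \<open>Computing \<open>e (l + m)\<close> by the cocycle rule in the two possible orders shows
  that the exponential of the commutator is 1.\<close>

lemma chern_commutator_Ints:
  assumes "e \<in> carrier (automorphy_factors \<Lambda>)" "l \<in> \<Lambda>" "m \<in> \<Lambda>"
    and g: "\<And>l v. l \<in> \<Lambda> \<Longrightarrow> e l v = exp (2 * of_real pi * \<i> * g l v)"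
  shows "g m (v + l) + g l v - g l (v + m) - g m v \<in> \<int>"
proof -
  have "e m (v + l) * e l v = e l (v + m) * e m v"
    using automorphy_factorD(3)[OF assms(1), of m l v] automorphy_factorD(3)[OF assms(1), of l m v] assms(2,3)
    by (simp add: add.commute)
  then have "exp (2 * of_real pi * \<i> * (g m (v + l) + g l v)) = exp (2 * of_real pi * \<i> * (g l (v + m) + g m v))"
    using assms(2,3) by (simp add: g distrib_left exp_add)
  then have "exp (2 * of_real pi * \<i> * ((g m (v + l) + g l v) - (g l (v + m) + g m v))) = 1"
    unfolding right_diff_distrib exp_diff by simp
  then show ?thesis unfolding exp_2pi_i_eq_1 by (simp add: algebra_simps)
qed

lemma chern_form_Ints:
  assumes "e \<in> carrier (automorphy_factors \<Lambda>)" "is_chern_form \<Lambda> e E" "l \<in> \<Lambda>" "m \<in> \<Lambda>"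
  shows "E l m \<in> \<int>"
proof -
  obtain g where g: "\<And>l v. l \<in> \<Lambda> \<Longrightarrow> e l v = exp (2 * of_real pi * \<i> * g l v)"
    "\<And>v. complex_of_real (E l m) = g m (v + l) + g l v - g l (v + m) - g m v"
    using assms(2-4) unfolding is_chern_form_def by blast
  have "complex_of_real (E l m) \<in> \<int>"
    unfolding g(2)[of 0] by (rule chern_commutator_Ints[OF assms(1,3,4) g(1)])
  then show ?thesis by (metis Ints_cases Ints_of_int of_real_eq_iff of_real_of_int_eq)
qed

text \<open>Two choices of logarithm differ by an integer constant for each lattice vector, and
  constants cancel in the commutator.\<close>

lemma chern_form_unique:
  assumes "is_chern_form \<Lambda> e E" "is_chern_form \<Lambda> e F"
  shows "E = F"
proof (rule bilinear_ext)
  show "bilinear E" "bilinear F" using assms by (auto simp: is_chern_form_def)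
  fix a b assume ab: "a \<in> B" "b \<in> B"
  then have ab': "a \<in> \<Lambda>" "b \<in> \<Lambda>" by (auto simp: B_subset)
  obtain g where g: "\<And>l. l \<in> \<Lambda> \<Longrightarrow> entire (g l)" "\<And>l v. l \<in> \<Lambda> \<Longrightarrow> e l v = exp (2 * of_real pi * \<i> * g l v)"
    "\<And>l m v. l \<in> \<Lambda> \<Longrightarrow> m \<in> \<Lambda> \<Longrightarrow> complex_of_real (E l m) = g m (v + l) + g l v - g l (v + m) - g m v"
    using assms(1) unfolding is_chern_form_def by blast
  obtain h where h: "\<And>l. l \<in> \<Lambda> \<Longrightarrow> entire (h l)" "\<And>l v. l \<in> \<Lambda> \<Longrightarrow> e l v = exp (2 * of_real pi * \<i> * h l v)"
    "\<And>l m v. l \<in> \<Lambda> \<Longrightarrow> m \<in> \<Lambda> \<Longrightarrow> complex_of_real (F l m) = h m (v + l) + h l v - h l (v + m) - h m v"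
    using assms(2) unfolding is_chern_form_def by blast
  have const: "g l v - h l v = g l w - h l w" if "l \<in> \<Lambda>" for l v w
  proof (rule integer_valued_constant)
    show "continuous_on UNIV (\<lambda>v. g l v - h l v)"
      by (intro entire_continuous entire_diff g h that)
    fix v
    have "exp (2 * of_real pi * \<i> * (g l v - h l v)) = 1"
      using g(2)[OF that, of v] h(2)[OF that, of v] by (simp add: right_diff_distrib exp_diff)
    then show "g l v - h l v \<in> \<int>" by (simp only: exp_2pi_i_eq_1)
  qed
  have "complex_of_real (E a b) - complex_of_real (F a b) =
      ((g b (0 + a) - h b (0 + a)) - (g b 0 - h b 0)) + ((g a 0 - h a 0) - (g a (0 + b) - h a (0 + b)))"
    unfolding g(3)[OF ab', of 0] h(3)[OF ab', of 0] by simp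
  also have "\<dots> = 0"
    using const[OF ab'(1), of 0 "0 + b"] const[OF ab'(2), of 0 "0 + a"] by simp
  finally have "complex_of_real (E a b) = complex_of_real (F a b)" by simp
  then show "E a b = F a b" by simp
qed

lemma c1_eq: "is_chern_form \<Lambda> e E \<Longrightarrow> c1 \<Lambda> e = E"
  unfolding c1_def by (rule the_equality) (auto intro: chern_form_unique)

text \<open>For any choice of logarithms the commutator \<open>P\<close> is integral, hence
  independent of \<open>v\<close>; it is then biadditive and skew on the lattice, and its values on
  a basis determine the real form.\<close>

lemma chern_form_exists:
  assumes e: "e \<in> carrier (automorphy_factors \<Lambda>)"
  shows "\<exists>E. is_chern_form \<Lambda> e E"
proof -
  have "\<forall>l\<in>\<Lambda>. \<exists>g. entire g \<and> (\<forall>v. e l v = exp (2 * of_real pi * \<i> * g v))"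
    using automorphy_factorD[OF e] by (intro ballI entire_logarithm) auto
  then obtain g where g0: "\<forall>l\<in>\<Lambda>. entire (g l) \<and> (\<forall>v. e l v = exp (2 * of_real pi * \<i> * g l v))"
    using bchoice[of \<Lambda> "\<lambda>l g. entire g \<and> (\<forall>v. e l v = exp (2 * of_real pi * \<i> * g v))"] by blast
  then have g: "\<And>l. l \<in> \<Lambda> \<Longrightarrow> entire (g l)" "\<And>l v. l \<in> \<Lambda> \<Longrightarrow> e l v = exp (2 * of_real pi * \<i> * g l v)"
    by auto
  define P where "P l m v = g m (v + l) + g l v - g l (v + m) - g m v" for l m v
  have P_Ints: "P l m v \<in> \<int>" if "l \<in> \<Lambda>" "m \<in> \<Lambda>" for l m v
    unfolding P_def by (rule chern_commutator_Ints[OF e that g(2)])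
  have P_const: "P l m v = P l m 0" if "l \<in> \<Lambda>" "m \<in> \<Lambda>" for l m v
  proof (rule integer_valued_constant)
    show "continuous_on UNIV (P l m)" unfolding P_def[abs_def]
      by (intro entire_continuous entire_diff entire_add entire_shift g that)
  qed (rule P_Ints[OF that])
  have P_add: "P (l + l') m 0 = P l m 0 + P l' m 0" if l: "l \<in> \<Lambda>" "l' \<in> \<Lambda>" "m \<in> \<Lambda>" for l l' m
  proof -
    have ll: "l + l' \<in> \<Lambda>" using l lattice_add by blast
    \<comment> \<open>The defect of \<open>g\<close> from the additive cocycle rule is an integer
      and so does not depend on \<open>v\<close>; comparing it at 0 and at \<open>m\<close> gives
      additivity of \<open>P\<close>.\<close>
    have k: "g (l + l') v - g l (v + l') - g l' v = g (l + l') w - g l (w + l') - g l' w" for v w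
    proof (rule integer_valued_constant)
      show "continuous_on UNIV (\<lambda>v. g (l + l') v - g l (v + l') - g l' v)"
        by (intro entire_continuous entire_diff entire_shift g l ll)
      fix v
      have "exp (2 * of_real pi * \<i> * (g (l + l') v - g l (v + l') - g l' v)) = 1"
        using automorphy_factorD(3)[OF e l(1,2), of v] ll l automorphy_factorD(2)[OF e, of l] automorphy_factorD(2)[OF e, of l']
        by (simp add: right_diff_distrib exp_diff g(2)[symmetric])
      then show "g (l + l') v - g l (v + l') - g l' v \<in> \<int>" by (simp only: exp_2pi_i_eq_1)
    qed
    have "P (l + l') m 0 = P l m (0 + l') + P l' m 0"
      using k[of 0 "0 + m"] by (simp add: P_def algebra_simps)
    then show ?thesis using P_const[of l m "0 + l'"] l by simp
  qed
  have P_skew: "P l m 0 = - P m l 0" for l m by (simp add: P_def)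
  have P_add2: "P m (l + l') 0 = P m l 0 + P m l' 0" if "l \<in> \<Lambda>" "l' \<in> \<Lambda>" "m \<in> \<Lambda>" for l l' m
    using P_add[OF that] P_skew[of m] by simp
  obtain E :: "complex^'m \<Rightarrow> complex^'m \<Rightarrow> real" where E: "bilinear E" "\<And>a b. a \<in> B \<Longrightarrow> b \<in> B \<Longrightarrow> E a b = Re (P a b 0)"
    using bilinear_extension[of "\<lambda>a b. Re (P a b 0)"] by blast
  have EP1: "Re (P a m 0) = E a m" if "a \<in> B" "m \<in> \<Lambda>" for a m
    by (rule lattice_additive_eq[where f = "\<lambda>m. Re (P a m 0)"])
       (use that E P_add2[of _ _ a] B_subset in \<open>auto simp: bilinear_rsub\<close>)
  have EP2: "Re (P l m 0) = E l m" if "l \<in> \<Lambda>" "m \<in> \<Lambda>" for l m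
    by (rule lattice_additive_eq[where f = "\<lambda>l. Re (P l m 0)" and f' = "\<lambda>l. E l m"])
       (use that E P_add[of _ _ m] EP1 in \<open>auto simp: bilinear_lsub\<close>)
  have EP: "complex_of_real (E l m) = P l m v" if "l \<in> \<Lambda>" "m \<in> \<Lambda>" for l m v
  proof -
    have "P l m 0 \<in> \<real>" using P_Ints[OF that, of 0] by (auto elim!: Ints_cases)
    then show ?thesis
      unfolding EP2[OF that, symmetric] P_const[OF that, of v] by (simp add: complex_is_Real_iff complex_eq_iff)
  qed
  have "E v v = 0" for v
  proof -
    have bil: "bilinear (\<lambda>u w. - E w u)"
      using E(1) unfolding bilinear_def by (auto intro: linear_compose_neg)
    have "E = (\<lambda>u w. - E w u)"
    proof (rule bilinear_ext[OF E(1) bil])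
      fix a b assume "a \<in> B" "b \<in> B"
      then show "E a b = - E b a" using P_skew[of a b] by (simp add: E(2))
    qed
    then have "E v v = - E v v" by (rule fun_cong[THEN fun_cong])
    then show ?thesis by simp
  qed
  then have "is_chern_form \<Lambda> e E"
    unfolding is_chern_form_def using E(1) g EP unfolding P_def by (intro conjI exI[of _ g]) auto
  then show ?thesis by (rule exI[where x = E])
qed

lemma chern_form_riemann:
  assumes "e \<in> carrier (automorphy_factors \<Lambda>)" "is_chern_form \<Lambda> e E"
  shows "E \<in> riemann_forms \<Lambda>"
proof -
  obtain g where g: "\<And>l. l \<in> \<Lambda> \<Longrightarrow> entire (g l)"
    "\<And>l m v. l \<in> \<Lambda> \<Longrightarrow> m \<in> \<Lambda> \<Longrightarrow> complex_of_real (E l m) = g m (v + l) + g l v - g l (v + m) - g m v"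
    using assms(2) unfolding is_chern_form_def by blast
  have E: "bilinear E" "\<And>v. E v v = 0" using assms(2) by (auto simp: is_chern_form_def)
  have "E (\<i> *s u) (\<i> *s w) = E u w" for u w
    by (rule chern_form_type_1_1[OF E finite_B independent_B span_B g]) (auto simp: B_subset)
  then show ?thesis
    unfolding riemann_forms_def using E chern_form_Ints[OF assms] by auto
qed

lemma is_chern_form_c1: "e \<in> carrier (automorphy_factors \<Lambda>) \<Longrightarrow> is_chern_form \<Lambda> e (c1 \<Lambda> e)"
  using chern_form_exists c1_eq by metis

lemma c1_riemann: "e \<in> carrier (automorphy_factors \<Lambda>) \<Longrightarrow> c1 \<Lambda> e \<in> riemann_forms \<Lambda>"
  using is_chern_form_c1 chern_form_riemann by blast

text \<open>Appell--Humbert: the semicharacter is \<open>l \<mapsto> exp (\<pi> \<i> \<beta>(l, l))\<close> for the strictly upper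
  triangular part \<open>\<beta>\<close> of \<open>E\<close> with respect to an ordering of the basis.\<close>

lemma appell_humbert_exists:
  assumes E: "E \<in> riemann_forms \<Lambda>"
  shows "\<exists>e\<in>carrier (automorphy_factors \<Lambda>). is_chern_form \<Lambda> e E"
proof -
  have bil: "bilinear E" and alt: "\<And>v. E v v = 0" and int: "\<And>l m. l \<in> \<Lambda> \<Longrightarrow> m \<in> \<Lambda> \<Longrightarrow> E l m \<in> \<int>"
    and J: "\<And>u v. E (\<i> *s u) (\<i> *s v) = E u v"
    using E by (auto simp: riemann_forms_def)
  have skew: "E u v = - E v u" for u v by (rule alternating_skew[OF bil alt])
  obtain idx :: "complex^'m \<Rightarrow> nat" where idx: "inj_on idx B"
    using finite_imp_inj_to_nat_seg[OF finite_B] by blast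
  obtain \<beta> :: "complex^'m \<Rightarrow> complex^'m \<Rightarrow> real" where \<beta>: "bilinear \<beta>"
    "\<And>a b. a \<in> B \<Longrightarrow> b \<in> B \<Longrightarrow> \<beta> a b = (if idx a < idx b then E a b else 0)"
    using bilinear_extension[of "\<lambda>a b. if idx a < idx b then E a b else 0"] by blast
  have \<beta>_Ints: "\<beta> l m \<in> \<int>" if "l \<in> \<Lambda>" "m \<in> \<Lambda>" for l m
    by (rule lattice_bilinear_Ints[OF \<beta>(1) _ that]) (auto simp: \<beta>(2) intro!: int B_subset)
  have "E = (\<lambda>u w. \<beta> u w - \<beta> w u)"
  proof (rule bilinear_ext[OF bil])
    show "bilinear (\<lambda>u w. \<beta> u w - \<beta> w u)"
      using \<beta>(1) unfolding bilinear_def by (auto intro: linear_compose_sub)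
    fix a b assume ab: "a \<in> B" "b \<in> B"
    show "E a b = \<beta> a b - \<beta> b a"
    proof (cases "a = b")
      case False
      then have "idx a \<noteq> idx b" using idx ab by (auto simp: inj_on_def)
      then show ?thesis using ab skew[of a b] by (auto simp: \<beta>(2))
    qed (simp add: alt)
  qed
  then have E\<beta>: "E u w = \<beta> u w - \<beta> w u" for u w by metis
  \<comment> \<open>The hermitian form with imaginary part \<open>E\<close>; type (1,1) is what
    makes its real part symmetric.\<close>
  define H where "H u w = complex_of_real (E (\<i> *s u) w) + \<i> * complex_of_real (E u w)" for u w
  have ii: "\<i> *s (\<i> *s u) = - u" for u :: "complex^'m" by (simp add: vec_eq_iff)
  have sadd: "\<i> *s (u + u') = \<i> *s u + \<i> *s u'" and sscale: "\<i> *s (r *\<^sub>R u) = r *\<^sub>R (\<i> *s u)" for u u' :: "complex^'m" and r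
    by (simp_all add: vec_eq_iff algebra_simps)
  have H_add1: "H (u + u') w = H u w + H u' w" and H_add2: "H w (u + u') = H w u + H w u'" for u u' w
    by (simp_all add: H_def bilinear_ladd[OF bil] bilinear_radd[OF bil] sadd algebra_simps)
  have H_lin: "linear (\<lambda>u. H u w)" for w
    by (rule linearI) (simp_all add: H_add1, simp add: H_def bilinear_lmul[OF bil] sscale scaleR_conv_of_real[where 'a = complex] algebra_simps)
  have H_ii: "H (\<i> *s u) w = \<i> * H u w" for u w
    by (simp add: H_def ii bilinear_lneg[OF bil] algebra_simps)
  have H_entire: "entire (\<lambda>v. H v w)" for w
    by (rule entire_linear_form[OF H_lin complex_linear_of_ii[OF H_lin H_ii]])
  have H_skew: "H l m - H m l = 2 * \<i> * complex_of_real (E l m)" for l m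
  proof -
    have "E (\<i> *s m) l = E (\<i> *s l) m"
      using J[of "\<i> *s m" l] skew[of m "\<i> *s l"] by (simp add: ii bilinear_lneg[OF bil])
    then show ?thesis using skew[of m l] by (simp add: H_def)
  qed
  \<comment> \<open>The classical factor exp(pi H(v,l) + (pi/2) H(l,l)) times the semicharacter,
    divided by 2 pi i on the level of logarithms.\<close>
  define g where "g l v = H v l / (2 * \<i>) + (H l l / (4 * \<i>) + complex_of_real (\<beta> l l) / 2)" for l v
  define e where "e l v = (if l \<in> \<Lambda> then exp (2 * of_real pi * \<i> * g l v) else 1)" for l v
  have g_entire: "entire (g l)" for l
    unfolding g_def[abs_def] divide_inverse by (intro entire_add entire_mult entire_const H_entire)
  \<comment> \<open>The defect is half of \<open>E l m\<close> from the hermitian part plus half of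
    the symmetrised \<beta>; since \<open>E\<close> is the antisymmetrisation of \<beta>, this adds
    up to \<open>\<beta> l m\<close>, an integer.\<close>
  have g_cocycle: "g (l + m) v = g l (v + m) + g m v + complex_of_real (\<beta> l m)" for l m v
  proof -
    have "g (l + m) v - g l (v + m) - g m v =
        (H l m - H m l) / (4 * \<i>) + complex_of_real (\<beta> l m + \<beta> m l) / 2"
      by (simp add: g_def H_add1 H_add2 bilinear_ladd[OF \<beta>(1)] bilinear_radd[OF \<beta>(1)] field_simps)
    also have "\<dots> = complex_of_real (\<beta> l m)"
      unfolding H_skew E\<beta> by (simp add: field_simps)
    finally show ?thesis by (simp add: algebra_simps)
  qed
  have "e \<in> carrier (automorphy_factors \<Lambda>)"
  proof -
    have "e (l + m) v = e l (v + m) * e m v" if "l \<in> \<Lambda>" "m \<in> \<Lambda>" for l m v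
    proof -
      have "complex_of_real (\<beta> l m) \<in> \<int>" using \<beta>_Ints[OF that] by (auto elim!: Ints_cases)
      then have "exp (2 * of_real pi * \<i> * complex_of_real (\<beta> l m)) = 1" by (simp only: exp_2pi_i_eq_1)
      then show ?thesis
        using that lattice_add[OF that] by (simp add: e_def g_cocycle distrib_left exp_add)
    qed
    moreover have "entire (e l)" if "l \<in> \<Lambda>" for l
      unfolding e_def[abs_def] using that by (simp add: entire_exp entire_mult entire_const g_entire)
    ultimately show ?thesis by (auto simp: automorphy_factors_def e_def)
  qed
  moreover have "is_chern_form \<Lambda> e E"
  proof -
    have "complex_of_real (E l m) = g m (v + l) + g l v - g l (v + m) - g m v" for l m v
      using H_skew[of l m] by (simp add: g_def H_add1 field_simps)
    then show ?thesis
      unfolding is_chern_form_def using bil alt g_entire by (auto simp: e_def intro!: exI[of _ g])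
  qed
  ultimately show ?thesis by blast
qed

end

section \<open>The Neron--Severi group\<close>

text \<open>Used at both quotient levels, for the class in Pic and for the class in NS, to compute
  pullbacks on representatives.\<close>

lemma r_coset_image:
  assumes "N \<subseteq> carrier G" "x \<in> carrier G" "\<And>y z. y \<in> carrier G \<Longrightarrow> z \<in> carrier G \<Longrightarrow> \<rho> (y \<otimes>\<^bsub>G\<^esub> z) = \<rho> y \<otimes>\<^bsub>G\<^esub> \<rho> z"
    "\<rho> ` N = N"
  shows "\<rho> ` (N #>\<^bsub>G\<^esub> x) = N #>\<^bsub>G\<^esub> \<rho> x"
proof -
  have "\<rho> ` (N #>\<^bsub>G\<^esub> x) = (\<lambda>n. \<rho> (n \<otimes>\<^bsub>G\<^esub> x)) ` N" by (auto simp: r_coset_def)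
  also have "\<dots> = (\<lambda>n. \<rho> n \<otimes>\<^bsub>G\<^esub> \<rho> x) ` N" using assms by (intro image_cong) auto
  also have "\<dots> = (\<lambda>n. n \<otimes>\<^bsub>G\<^esub> \<rho> x) ` (\<rho> ` N)" by (simp add: image_image)
  also have "\<dots> = N #>\<^bsub>G\<^esub> \<rho> x" unfolding assms(4) by (auto simp: r_coset_def)
  finally show ?thesis .
qed

lemma carrier_FactGroup: "carrier (G Mod N) = {N #>\<^bsub>G\<^esub> x | x. x \<in> carrier G}"
  by (auto simp: FactGroup_def RCOSETS_def)

lemma riemann_formsI:
  assumes "bilinear E" "\<And>v. E v v = 0" "\<And>l m. l \<in> \<Lambda> \<Longrightarrow> m \<in> \<Lambda> \<Longrightarrow> E l m \<in> \<int>"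
    "\<And>u v. E (\<i> *s u) (\<i> *s v) = E u v"
  shows "E \<in> riemann_forms \<Lambda>"
  using assms by (auto simp: riemann_forms_def)

lemma riemann_formsD:
  assumes "E \<in> riemann_forms \<Lambda>"
  shows "bilinear E" "E v v = 0" "l \<in> \<Lambda> \<Longrightarrow> m \<in> \<Lambda> \<Longrightarrow> E l m \<in> \<int>" "E (\<i> *s u) (\<i> *s v) = E u v"
  using assms by (auto simp: riemann_forms_def)

lemma group_form_group: "group (form_group \<Lambda>)"
proof (rule groupI)
  fix E assume E: "E \<in> carrier (form_group \<Lambda>)"
  show "\<exists>F\<in>carrier (form_group \<Lambda>). F \<otimes>\<^bsub>form_group \<Lambda>\<^esub> E = \<one>\<^bsub>form_group \<Lambda>\<^esub>"
  proof (rule bexI[of _ "\<lambda>u v. - E u v"])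
    show "(\<lambda>u v. - E u v) \<in> carrier (form_group \<Lambda>)"
      using E by (auto simp: form_group_def riemann_forms_def bilinear_def intro: linear_compose_neg)
  qed (simp add: form_group_def)
next
  fix E F assume "E \<in> carrier (form_group \<Lambda>)" "F \<in> carrier (form_group \<Lambda>)"
  then show "E \<otimes>\<^bsub>form_group \<Lambda>\<^esub> F \<in> carrier (form_group \<Lambda>)"
    by (auto simp: form_group_def riemann_forms_def bilinear_def intro: linear_compose_add)
next
  show "\<one>\<^bsub>form_group \<Lambda>\<^esub> \<in> carrier (form_group \<Lambda>)"
    by (auto simp: form_group_def riemann_forms_def bilinear_def intro: linear_0 linearI)
qed (auto simp: form_group_def add.assoc)

lemma comm_group_automorphy_factors: "comm_group (automorphy_factors \<Lambda>)"
proof (rule comm_groupI)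
  fix e assume e: "e \<in> carrier (automorphy_factors \<Lambda>)"
  show "\<exists>f\<in>carrier (automorphy_factors \<Lambda>). f \<otimes>\<^bsub>automorphy_factors \<Lambda>\<^esub> e = \<one>\<^bsub>automorphy_factors \<Lambda>\<^esub>"
  proof (rule bexI[of _ "\<lambda>l v. inverse (e l v)"])
    have nz: "e l v \<noteq> 0" for l v using e by (cases "l \<in> \<Lambda>") (auto simp: automorphy_factors_def)
    show "(\<lambda>l v. inverse (e l v)) \<in> carrier (automorphy_factors \<Lambda>)"
      using e nz by (auto simp: automorphy_factors_def intro!: entire_inverse)
    show "(\<lambda>l v. inverse (e l v)) \<otimes>\<^bsub>automorphy_factors \<Lambda>\<^esub> e = \<one>\<^bsub>automorphy_factors \<Lambda>\<^esub>"
      by (simp add: automorphy_factors_def nz)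
  qed
next
  fix e f assume "e \<in> carrier (automorphy_factors \<Lambda>)" "f \<in> carrier (automorphy_factors \<Lambda>)"
  then show "e \<otimes>\<^bsub>automorphy_factors \<Lambda>\<^esub> f \<in> carrier (automorphy_factors \<Lambda>)"
    by (auto simp: automorphy_factors_def intro!: entire_mult)
qed (auto simp: automorphy_factors_def entire_const mult.assoc mult.commute intro!: ext)

lemma coboundariesI:
  assumes "entire h" "\<And>v. h v \<noteq> 0"
  shows "(\<lambda>l v. if l \<in> \<Lambda> then h (v + l) / h v else 1) \<in> coboundaries \<Lambda>"
  using assms unfolding coboundaries_def by blast

context complex_lattice
begin

lemma coboundaries_subset: "coboundaries \<Lambda> \<subseteq> carrier (automorphy_factors \<Lambda>)"
proof
  fix e assume "e \<in> coboundaries \<Lambda>"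
  then obtain h where h: "entire h" "\<And>v. h v \<noteq> 0" "e = (\<lambda>l v. if l \<in> \<Lambda> then h (v + l) / h v else 1)"
    by (auto simp: coboundaries_def)
  have "entire (\<lambda>v. h (v + l) / h v)" for l by (intro entire_divide entire_shift h)
  then show "e \<in> carrier (automorphy_factors \<Lambda>)"
    unfolding h(3) using h(2) lattice_add by (auto simp: automorphy_factors_def ac_simps)
qed

lemma subgroup_coboundaries: "subgroup (coboundaries \<Lambda>) (automorphy_factors \<Lambda>)"
proof -
  interpret G: comm_group "automorphy_factors \<Lambda>" by (rule comm_group_automorphy_factors)
  show ?thesis
  proof (rule G.subgroupI[OF coboundaries_subset])
    have "(\<lambda>l v. if l \<in> \<Lambda> then (\<lambda>v. 1) (v + l) / (\<lambda>v. 1) v else 1) \<in> coboundaries \<Lambda>"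
      by (rule coboundariesI[of "\<lambda>v. 1"]) (auto intro: entire_const)
    then show "coboundaries \<Lambda> \<noteq> {}" by blast
  next
    fix e assume e: "e \<in> coboundaries \<Lambda>"
    then obtain h where h: "entire h" "\<And>v. h v \<noteq> 0" "e = (\<lambda>l v. if l \<in> \<Lambda> then h (v + l) / h v else 1)"
      by (auto simp: coboundaries_def)
    let ?f = "\<lambda>l v. if l \<in> \<Lambda> then (\<lambda>v. inverse (h v)) (v + l) / (\<lambda>v. inverse (h v)) v else 1"
    have f: "?f \<in> coboundaries \<Lambda>"
      by (rule coboundariesI[of "\<lambda>v. inverse (h v)"]) (use h(1,2) in \<open>auto intro: entire_inverse\<close>)
    have "?f \<otimes>\<^bsub>automorphy_factors \<Lambda>\<^esub> e = \<one>\<^bsub>automorphy_factors \<Lambda>\<^esub>"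
      by (auto simp: automorphy_factors_def h field_simps intro!: ext)
    then have "inv\<^bsub>automorphy_factors \<Lambda>\<^esub> e = ?f"
      using e f coboundaries_subset by (intro G.inv_equality) auto
    then show "inv\<^bsub>automorphy_factors \<Lambda>\<^esub> e \<in> coboundaries \<Lambda>" using f by simp
  next
    fix e f assume e: "e \<in> coboundaries \<Lambda>" and f: "f \<in> coboundaries \<Lambda>"
    obtain h where h: "entire h" "\<And>v. h v \<noteq> 0" "e = (\<lambda>l v. if l \<in> \<Lambda> then h (v + l) / h v else 1)"
      using e by (auto simp: coboundaries_def)
    obtain k where k: "entire k" "\<And>v. k v \<noteq> 0" "f = (\<lambda>l v. if l \<in> \<Lambda> then k (v + l) / k v else 1)"
      using f by (auto simp: coboundaries_def)
    have "(\<lambda>l v. if l \<in> \<Lambda> then (\<lambda>v. h v * k v) (v + l) / (\<lambda>v. h v * k v) v else 1) \<in> coboundaries \<Lambda>"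
      by (rule coboundariesI[of "\<lambda>v. h v * k v"]) (use h(1,2) k(1,2) in \<open>auto intro: entire_mult\<close>)
    also have "(\<lambda>l v. if l \<in> \<Lambda> then (\<lambda>v. h v * k v) (v + l) / (\<lambda>v. h v * k v) v else 1) = e \<otimes>\<^bsub>automorphy_factors \<Lambda>\<^esub> f"
      by (auto simp: automorphy_factors_def h(3) k(3) intro!: ext)
    finally show "e \<otimes>\<^bsub>automorphy_factors \<Lambda>\<^esub> f \<in> coboundaries \<Lambda>" .
  qed
qed

lemma normal_coboundaries: "coboundaries \<Lambda> \<lhd> automorphy_factors \<Lambda>"
  using comm_group.normal_iff_subgroup[OF comm_group_automorphy_factors] subgroup_coboundaries by blast

lemma group_Pic: "group (Pic \<Lambda>)"
  unfolding Pic_def by (rule normal.factorgroup_is_group[OF normal_coboundaries])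

lemma is_chern_form_mult:
  assumes "is_chern_form \<Lambda> e E" "is_chern_form \<Lambda> f F"
  shows "is_chern_form \<Lambda> (\<lambda>l v. e l v * f l v) (\<lambda>u v. E u v + F u v)"
proof -
  obtain g where g: "\<And>l. l \<in> \<Lambda> \<Longrightarrow> entire (g l)" "\<And>l v. l \<in> \<Lambda> \<Longrightarrow> e l v = exp (2 * of_real pi * \<i> * g l v)"
    "\<And>l m v. l \<in> \<Lambda> \<Longrightarrow> m \<in> \<Lambda> \<Longrightarrow> complex_of_real (E l m) = g m (v + l) + g l v - g l (v + m) - g m v"
    using assms(1) unfolding is_chern_form_def by blast
  obtain h where h: "\<And>l. l \<in> \<Lambda> \<Longrightarrow> entire (h l)" "\<And>l v. l \<in> \<Lambda> \<Longrightarrow> f l v = exp (2 * of_real pi * \<i> * h l v)"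
    "\<And>l m v. l \<in> \<Lambda> \<Longrightarrow> m \<in> \<Lambda> \<Longrightarrow> complex_of_real (F l m) = h m (v + l) + h l v - h l (v + m) - h m v"
    using assms(2) unfolding is_chern_form_def by blast
  have "bilinear (\<lambda>u v. E u v + F u v)"
    using assms by (auto simp: is_chern_form_def bilinear_def intro: linear_compose_add)
  moreover have "E v v + F v v = 0" for v using assms by (auto simp: is_chern_form_def)
  moreover have "\<exists>k. (\<forall>l\<in>\<Lambda>. entire (k l) \<and> (\<forall>v. e l v * f l v = exp (2 * of_real pi * \<i> * k l v))) \<and>
      (\<forall>l\<in>\<Lambda>. \<forall>m\<in>\<Lambda>. \<forall>v. complex_of_real (E l m + F l m) = k m (v + l) + k l v - k l (v + m) - k m v)"
  proof (intro exI[of _ "\<lambda>l v. g l v + h l v"] conjI ballI allI)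
    fix l m v assume "l \<in> \<Lambda>" "m \<in> \<Lambda>"
    then show "complex_of_real (E l m + F l m) =
        g m (v + l) + h m (v + l) + (g l v + h l v) - (g l (v + m) + h l (v + m)) - (g m v + h m v)"
      by (simp add: g(3)[of l m v] h(3)[of l m v])
  qed (auto simp: g(1,2) h(1,2) exp_add distrib_left intro!: entire_add)
  ultimately show ?thesis unfolding is_chern_form_def by blast
qed

text \<open>With a logarithm \<open>f\<close> of \<open>h\<close> the factor has logarithm
  \<open>f (v + l) - f v\<close>, whose commutator cancels.\<close>

lemma is_chern_form_coboundary:
  assumes "e \<in> coboundaries \<Lambda>"
  shows "is_chern_form \<Lambda> e (\<lambda>u v. 0)"
proof -
  obtain h where h: "entire h" "\<And>v. h v \<noteq> 0" "e = (\<lambda>l v. if l \<in> \<Lambda> then h (v + l) / h v else 1)"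
    using assms by (auto simp: coboundaries_def)
  obtain f where f: "entire f" "\<And>v. h v = exp (2 * of_real pi * \<i> * f v)"
    using entire_logarithm[OF h(1,2)] by blast
  have "bilinear (\<lambda>(u::complex^'m) (v::complex^'m). 0::real)" by (auto simp: bilinear_def intro: linearI)
  moreover have "entire (\<lambda>v. f (v + l) - f v)" for l by (intro entire_diff entire_shift f)
  ultimately show ?thesis
    unfolding is_chern_form_def h(3)
    by (auto simp: f(2) exp_diff right_diff_distrib add.commute add.left_commute
        intro!: exI[of _ "\<lambda>l v. f (v + l) - f v"])
qed

lemma c1_group_hom: "group_hom (automorphy_factors \<Lambda>) (form_group \<Lambda>) (c1 \<Lambda>)"
proof -
  have "c1 \<Lambda> \<in> hom (automorphy_factors \<Lambda>) (form_group \<Lambda>)"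
  proof (rule homI)
    fix e assume "e \<in> carrier (automorphy_factors \<Lambda>)"
    then show "c1 \<Lambda> e \<in> carrier (form_group \<Lambda>)" by (simp add: form_group_def c1_riemann)
  next
    fix e f assume "e \<in> carrier (automorphy_factors \<Lambda>)" "f \<in> carrier (automorphy_factors \<Lambda>)"
    then have "is_chern_form \<Lambda> (\<lambda>l v. e l v * f l v) (\<lambda>u v. c1 \<Lambda> e u v + c1 \<Lambda> f u v)"
      by (intro is_chern_form_mult is_chern_form_c1)
    from c1_eq[OF this]
    show "c1 \<Lambda> (e \<otimes>\<^bsub>automorphy_factors \<Lambda>\<^esub> f) = c1 \<Lambda> e \<otimes>\<^bsub>form_group \<Lambda>\<^esub> c1 \<Lambda> f"
      by (simp add: automorphy_factors_def form_group_def)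
  qed
  then show ?thesis
    using comm_group.axioms(2)[OF comm_group_automorphy_factors] group_form_group
    by (auto simp: group_hom_def group_hom_axioms_def)
qed

lemma coboundaries_kernel: "coboundaries \<Lambda> \<subseteq> kernel (automorphy_factors \<Lambda>) (form_group \<Lambda>) (c1 \<Lambda>)"
  using coboundaries_subset c1_eq[OF is_chern_form_coboundary]
  by (auto simp: kernel_def form_group_def)

lemma c1_Pic_coset:
  assumes "e \<in> carrier (automorphy_factors \<Lambda>)"
  shows "c1_Pic \<Lambda> (coboundaries \<Lambda> #>\<^bsub>automorphy_factors \<Lambda>\<^esub> e) = c1 \<Lambda> e"
proof -
  interpret G: group_hom "automorphy_factors \<Lambda>" "form_group \<Lambda>" "c1 \<Lambda>" by (rule c1_group_hom)
  have "c1 \<Lambda> (n \<otimes>\<^bsub>automorphy_factors \<Lambda>\<^esub> e) = c1 \<Lambda> e" if "n \<in> coboundaries \<Lambda>" for n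
  proof -
    have "n \<in> carrier (automorphy_factors \<Lambda>)" "c1 \<Lambda> n = \<one>\<^bsub>form_group \<Lambda>\<^esub>"
      using that coboundaries_kernel by (auto simp: kernel_def)
    then show ?thesis using assms by simp
  qed
  then have "c1 \<Lambda> ` (coboundaries \<Lambda> #>\<^bsub>automorphy_factors \<Lambda>\<^esub> e) \<subseteq> {c1 \<Lambda> e}" by (auto simp: r_coset_def)
  moreover have "coboundaries \<Lambda> #>\<^bsub>automorphy_factors \<Lambda>\<^esub> e \<noteq> {}"
    using subgroup.one_closed[OF subgroup_coboundaries] by (auto simp: r_coset_def)
  ultimately have "c1 \<Lambda> ` (coboundaries \<Lambda> #>\<^bsub>automorphy_factors \<Lambda>\<^esub> e) = {c1 \<Lambda> e}" by (simp add: subset_singleton_iff)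
  then show ?thesis by (simp add: c1_Pic_def)
qed

lemma carrier_Pic:
  "carrier (Pic \<Lambda>) = {coboundaries \<Lambda> #>\<^bsub>automorphy_factors \<Lambda>\<^esub> e | e. e \<in> carrier (automorphy_factors \<Lambda>)}"
  by (simp add: Pic_def carrier_FactGroup)

lemma mult_Pic:
  assumes "e \<in> carrier (automorphy_factors \<Lambda>)" "f \<in> carrier (automorphy_factors \<Lambda>)"
  shows "(coboundaries \<Lambda> #>\<^bsub>automorphy_factors \<Lambda>\<^esub> e) \<otimes>\<^bsub>Pic \<Lambda>\<^esub> (coboundaries \<Lambda> #>\<^bsub>automorphy_factors \<Lambda>\<^esub> f) =
    coboundaries \<Lambda> #>\<^bsub>automorphy_factors \<Lambda>\<^esub> (e \<otimes>\<^bsub>automorphy_factors \<Lambda>\<^esub> f)"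
  using normal.rcos_sum[OF normal_coboundaries assms] by (simp add: Pic_def FactGroup_def)

lemma c1_Pic_group_hom: "group_hom (Pic \<Lambda>) (form_group \<Lambda>) (c1_Pic \<Lambda>)"
proof -
  interpret G: group_hom "automorphy_factors \<Lambda>" "form_group \<Lambda>" "c1 \<Lambda>" by (rule c1_group_hom)
  have "c1_Pic \<Lambda> \<in> hom (Pic \<Lambda>) (form_group \<Lambda>)"
    by (rule homI) (auto simp: carrier_Pic mult_Pic c1_Pic_coset G.H.m_closed)
  then show ?thesis using group_Pic group_form_group by (auto simp: group_hom_def group_hom_axioms_def)
qed

lemma Pic0_kernel: "Pic0 \<Lambda> = kernel (Pic \<Lambda>) (form_group \<Lambda>) (c1_Pic \<Lambda>)"
  by (auto simp: Pic0_def kernel_def form_group_def)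

lemma c1_Pic_surj: "c1_Pic \<Lambda> ` carrier (Pic \<Lambda>) = carrier (form_group \<Lambda>)"
proof
  show "c1_Pic \<Lambda> ` carrier (Pic \<Lambda>) \<subseteq> carrier (form_group \<Lambda>)"
    by (auto simp: carrier_Pic c1_Pic_coset form_group_def c1_riemann)
  show "carrier (form_group \<Lambda>) \<subseteq> c1_Pic \<Lambda> ` carrier (Pic \<Lambda>)"
  proof
    fix E assume "E \<in> carrier (form_group \<Lambda>)"
    then obtain e where e: "e \<in> carrier (automorphy_factors \<Lambda>)" "is_chern_form \<Lambda> e E"
      using appell_humbert_exists by (auto simp: form_group_def)
    then have "E = c1_Pic \<Lambda> (coboundaries \<Lambda> #>\<^bsub>automorphy_factors \<Lambda>\<^esub> e)"
      by (simp add: c1_Pic_coset c1_eq)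
    then show "E \<in> c1_Pic \<Lambda> ` carrier (Pic \<Lambda>)" using e(1) unfolding carrier_Pic by blast
  qed
qed

text \<open>The first isomorphism theorem: \<open>Pic0\<close> is the kernel of
  \<open>c1_Pic\<close>, and Appell--Humbert makes \<open>c1_Pic\<close> surjective onto the Riemann
  forms.\<close>

theorem c1_NS_iso: "c1_NS \<Lambda> \<in> iso (NS \<Lambda>) (form_group \<Lambda>)"
  using group_hom.FactGroup_iso_set[OF c1_Pic_group_hom c1_Pic_surj]
  unfolding NS_def Pic0_kernel c1_NS_def[abs_def] .

lemma carrier_NS: "carrier (NS \<Lambda>) = {Pic0 \<Lambda> #>\<^bsub>Pic \<Lambda>\<^esub> P | P. P \<in> carrier (Pic \<Lambda>)}"
  by (simp add: NS_def carrier_FactGroup)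

lemma c1_NS_coset:
  assumes "P \<in> carrier (Pic \<Lambda>)"
  shows "c1_NS \<Lambda> (Pic0 \<Lambda> #>\<^bsub>Pic \<Lambda>\<^esub> P) = c1_Pic \<Lambda> P"
proof -
  interpret G: group_hom "Pic \<Lambda>" "form_group \<Lambda>" "c1_Pic \<Lambda>" by (rule c1_Pic_group_hom)
  have "c1_Pic \<Lambda> (Q \<otimes>\<^bsub>Pic \<Lambda>\<^esub> P) = c1_Pic \<Lambda> P" if "Q \<in> Pic0 \<Lambda>" for Q
    using that assms by (simp add: Pic0_kernel kernel_def)
  then have "c1_Pic \<Lambda> ` (Pic0 \<Lambda> #>\<^bsub>Pic \<Lambda>\<^esub> P) \<subseteq> {c1_Pic \<Lambda> P}" by (auto simp: r_coset_def)
  moreover have "\<one>\<^bsub>Pic \<Lambda>\<^esub> \<in> Pic0 \<Lambda>" by (simp add: Pic0_kernel kernel_def)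
  moreover from this have "Pic0 \<Lambda> #>\<^bsub>Pic \<Lambda>\<^esub> P \<noteq> {}" by (auto simp: r_coset_def)
  ultimately have "c1_Pic \<Lambda> ` (Pic0 \<Lambda> #>\<^bsub>Pic \<Lambda>\<^esub> P) = {c1_Pic \<Lambda> P}" by (simp add: subset_singleton_iff)
  then show ?thesis by (simp add: c1_NS_def)
qed

subsection \<open>Pullback along automorphisms\<close>

lemma pullback_factor_compose:
  "pullback_factor M (pullback_factor N e) = pullback_factor (N ** M) e"
  by (simp add: pullback_factor_def matrix_vector_mul_assoc)

lemma pullback_factor_id: "pullback_factor (mat 1) e = e"
  by (simp add: pullback_factor_def)

lemma Aut_torus_inverse:
  assumes "M \<in> Aut_torus \<Lambda>"
  obtains N where "N \<in> Aut_torus \<Lambda>" "M ** N = mat 1" "N ** M = mat 1"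
  using assms unfolding Aut_torus_def by auto

text \<open>Both directions matter: factors are normalised to 1 outside the lattice, and a pullback
  keeps this normalisation only if no outside vector is mapped inside.\<close>

lemma Aut_torus_mem:
  assumes "M \<in> Aut_torus \<Lambda>"
  shows "M *v l \<in> \<Lambda> \<longleftrightarrow> l \<in> \<Lambda>"
proof -
  obtain N where N: "N \<in> Aut_torus \<Lambda>" "N ** M = mat 1" using Aut_torus_inverse[OF assms] by blast
  have "N *v (M *v l) = l" by (simp add: matrix_vector_mul_assoc N)
  then show ?thesis using assms N(1) unfolding Aut_torus_def End_torus_def by (metis (no_types, lifting) mem_Collect_eq)
qed

lemma pullback_factor_closed:
  assumes M: "M \<in> Aut_torus \<Lambda>" and e: "e \<in> carrier (automorphy_factors \<Lambda>)"
  shows "pullback_factor M e \<in> carrier (automorphy_factors \<Lambda>)"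
proof -
  note D = automorphy_factorD[OF e]
  have "entire (\<lambda>v. e (M *v l) (M *v v))" if "l \<in> \<Lambda>" for l
    using entire_affine[OF D(1), of "M *v l" M 0] that by (simp add: Aut_torus_mem[OF M])
  then show ?thesis
    using D(2-4) by (auto simp: automorphy_factors_def pullback_factor_def Aut_torus_mem[OF M] matrix_vector_right_distrib)
qed

lemma pullback_factor_coboundary:
  assumes M: "M \<in> Aut_torus \<Lambda>" and e: "e \<in> coboundaries \<Lambda>"
  shows "pullback_factor M e \<in> coboundaries \<Lambda>"
proof -
  obtain h where h: "entire h" "\<And>v. h v \<noteq> 0" "e = (\<lambda>l v. if l \<in> \<Lambda> then h (v + l) / h v else 1)"
    using e by (auto simp: coboundaries_def)
  have "(\<lambda>l v. if l \<in> \<Lambda> then (\<lambda>v. h (M *v v)) (v + l) / (\<lambda>v. h (M *v v)) v else 1) \<in> coboundaries \<Lambda>"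
    by (rule coboundariesI[of "\<lambda>v. h (M *v v)"]) (use entire_affine[OF h(1), of M 0] h(2) in auto)
  also have "(\<lambda>l v. if l \<in> \<Lambda> then (\<lambda>v. h (M *v v)) (v + l) / (\<lambda>v. h (M *v v)) v else 1) = pullback_factor M e"
    by (auto simp: pullback_factor_def h(3) Aut_torus_mem[OF M] matrix_vector_right_distrib intro!: ext)
  finally show ?thesis .
qed

lemma pullback_factor_coboundaries:
  assumes M: "M \<in> Aut_torus \<Lambda>"
  shows "pullback_factor M ` coboundaries \<Lambda> = coboundaries \<Lambda>"
proof
  show "pullback_factor M ` coboundaries \<Lambda> \<subseteq> coboundaries \<Lambda>" using pullback_factor_coboundary[OF M] by auto
  obtain N where N: "N \<in> Aut_torus \<Lambda>" "N ** M = mat 1" using Aut_torus_inverse[OF assms] by blast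
  show "coboundaries \<Lambda> \<subseteq> pullback_factor M ` coboundaries \<Lambda>"
  proof
    fix e assume "e \<in> coboundaries \<Lambda>"
    then have "pullback_factor N e \<in> coboundaries \<Lambda>" by (rule pullback_factor_coboundary[OF N(1)])
    moreover have "e = pullback_factor M (pullback_factor N e)"
      by (simp add: pullback_factor_compose N pullback_factor_id)
    ultimately show "e \<in> pullback_factor M ` coboundaries \<Lambda>" by blast
  qed
qed

lemma pullback_factor_mult:
  "pullback_factor M (e \<otimes>\<^bsub>automorphy_factors \<Lambda>\<^esub> f) =
    pullback_factor M e \<otimes>\<^bsub>automorphy_factors \<Lambda>\<^esub> pullback_factor M f"
  by (simp add: pullback_factor_def automorphy_factors_def)

lemma c1_pullback_factor:
  assumes M: "M \<in> Aut_torus \<Lambda>" and e: "e \<in> carrier (automorphy_factors \<Lambda>)"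
  shows "c1 \<Lambda> (pullback_factor M e) = (\<lambda>u v. c1 \<Lambda> e (M *v u) (M *v v))"
proof (rule c1_eq)
  have E: "is_chern_form \<Lambda> e (c1 \<Lambda> e)" using is_chern_form_c1[OF e] .
  then obtain g where g: "\<And>l. l \<in> \<Lambda> \<Longrightarrow> entire (g l)" "\<And>l v. l \<in> \<Lambda> \<Longrightarrow> e l v = exp (2 * of_real pi * \<i> * g l v)"
    "\<And>l m v. l \<in> \<Lambda> \<Longrightarrow> m \<in> \<Lambda> \<Longrightarrow> complex_of_real (c1 \<Lambda> e l m) = g m (v + l) + g l v - g l (v + m) - g m v"
    unfolding is_chern_form_def by blast
  have lin: "linear (\<lambda>v. M *v v)"
    by (intro linearI) (simp_all add: matrix_vector_right_distrib flip: of_real_scalar_mult add: vector_scalar_commute)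
  have "bilinear (c1 \<Lambda> e)" using E by (simp add: is_chern_form_def)
  then have "bilinear (\<lambda>u v. c1 \<Lambda> e (M *v u) (M *v v))"
    unfolding bilinear_def using linear_compose[OF lin, unfolded comp_def] by blast
  moreover have "entire (\<lambda>v. g (M *v l) (M *v v))" if "l \<in> \<Lambda>" for l
    using entire_affine[OF g(1), of "M *v l" M 0] that by (simp add: Aut_torus_mem[OF M])
  ultimately show "is_chern_form \<Lambda> (pullback_factor M e) (\<lambda>u v. c1 \<Lambda> e (M *v u) (M *v v))"
    unfolding is_chern_form_def pullback_factor_def
    using E g(2,3) by (auto simp: is_chern_form_def Aut_torus_mem[OF M] matrix_vector_right_distrib
        intro!: exI[of _ "\<lambda>l v. g (M *v l) (M *v v)"])
qed

lemma pullback_Pic_coset: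
  assumes M: "M \<in> Aut_torus \<Lambda>" and e: "e \<in> carrier (automorphy_factors \<Lambda>)"
  shows "pullback_factor M ` (coboundaries \<Lambda> #>\<^bsub>automorphy_factors \<Lambda>\<^esub> e) =
    coboundaries \<Lambda> #>\<^bsub>automorphy_factors \<Lambda>\<^esub> pullback_factor M e"
  by (rule r_coset_image[OF coboundaries_subset e pullback_factor_mult pullback_factor_coboundaries[OF M]])

lemma pullback_Pic:
  assumes M: "M \<in> Aut_torus \<Lambda>" and P: "P \<in> carrier (Pic \<Lambda>)"
  shows "pullback_factor M ` P \<in> carrier (Pic \<Lambda>)"
    "c1_Pic \<Lambda> (pullback_factor M ` P) = (\<lambda>u v. c1_Pic \<Lambda> P (M *v u) (M *v v))"
proof -
  obtain e where e: "e \<in> carrier (automorphy_factors \<Lambda>)" "P = coboundaries \<Lambda> #>\<^bsub>automorphy_factors \<Lambda>\<^esub> e"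
    using P by (auto simp: carrier_Pic)
  show "pullback_factor M ` P \<in> carrier (Pic \<Lambda>)"
    unfolding e(2) pullback_Pic_coset[OF M e(1)] carrier_Pic using pullback_factor_closed[OF M e(1)] by blast
  show "c1_Pic \<Lambda> (pullback_factor M ` P) = (\<lambda>u v. c1_Pic \<Lambda> P (M *v u) (M *v v))"
    unfolding e(2) pullback_Pic_coset[OF M e(1)]
    by (simp add: c1_Pic_coset e(1) pullback_factor_closed[OF M] c1_pullback_factor[OF M])
qed

lemma pullback_Pic_mult:
  assumes M: "M \<in> Aut_torus \<Lambda>" and P: "P \<in> carrier (Pic \<Lambda>)" and Q: "Q \<in> carrier (Pic \<Lambda>)"
  shows "pullback_factor M ` (P \<otimes>\<^bsub>Pic \<Lambda>\<^esub> Q) = pullback_factor M ` P \<otimes>\<^bsub>Pic \<Lambda>\<^esub> pullback_factor M ` Q"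
proof -
  interpret G: comm_group "automorphy_factors \<Lambda>" by (rule comm_group_automorphy_factors)
  obtain e where e: "e \<in> carrier (automorphy_factors \<Lambda>)" "P = coboundaries \<Lambda> #>\<^bsub>automorphy_factors \<Lambda>\<^esub> e"
    using P by (auto simp: carrier_Pic)
  obtain f where f: "f \<in> carrier (automorphy_factors \<Lambda>)" "Q = coboundaries \<Lambda> #>\<^bsub>automorphy_factors \<Lambda>\<^esub> f"
    using Q by (auto simp: carrier_Pic)
  show ?thesis
    unfolding e(2) f(2)
    by (simp add: mult_Pic e f pullback_Pic_coset[OF M] G.m_closed pullback_factor_closed[OF M] pullback_factor_mult)
qed

lemma pullback_Pic0:
  assumes M: "M \<in> Aut_torus \<Lambda>"
  shows "(\<lambda>P. pullback_factor M ` P) ` Pic0 \<Lambda> = Pic0 \<Lambda>"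
proof
  have sub: "pullback_factor M ` P \<in> Pic0 \<Lambda>" if "M \<in> Aut_torus \<Lambda>" "P \<in> Pic0 \<Lambda>" for M P
    using that pullback_Pic[of M P] by (auto simp: Pic0_def)
  show "(\<lambda>P. pullback_factor M ` P) ` Pic0 \<Lambda> \<subseteq> Pic0 \<Lambda>" using sub[OF M] by auto
  obtain N where N: "N \<in> Aut_torus \<Lambda>" "N ** M = mat 1" using Aut_torus_inverse[OF assms] by blast
  show "Pic0 \<Lambda> \<subseteq> (\<lambda>P. pullback_factor M ` P) ` Pic0 \<Lambda>"
  proof
    fix P assume P: "P \<in> Pic0 \<Lambda>"
    have "P = pullback_factor M ` (pullback_factor N ` P)"
      by (simp add: image_image pullback_factor_compose N pullback_factor_id)
    then show "P \<in> (\<lambda>P. pullback_factor M ` P) ` Pic0 \<Lambda>" using sub[OF N(1) P] by blast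
  qed
qed

theorem pullback_NS:
  assumes M: "M \<in> Aut_torus \<Lambda>" and L: "L \<in> carrier (NS \<Lambda>)"
  shows "pullback_NS M L \<in> carrier (NS \<Lambda>)"
    "c1_NS \<Lambda> (pullback_NS M L) = (\<lambda>u v. c1_NS \<Lambda> L (M *v u) (M *v v))"
proof -
  obtain P where P: "P \<in> carrier (Pic \<Lambda>)" "L = Pic0 \<Lambda> #>\<^bsub>Pic \<Lambda>\<^esub> P" using L unfolding carrier_NS by blast
  have sub: "Pic0 \<Lambda> \<subseteq> carrier (Pic \<Lambda>)" by (auto simp: Pic0_def)
  have eq: "pullback_NS M L = Pic0 \<Lambda> #>\<^bsub>Pic \<Lambda>\<^esub> (pullback_factor M ` P)"
    unfolding pullback_NS_def P(2)
    by (rule r_coset_image[OF sub P(1) pullback_Pic_mult[OF M] pullback_Pic0[OF M]])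
  show "pullback_NS M L \<in> carrier (NS \<Lambda>)"
    unfolding eq carrier_NS using pullback_Pic(1)[OF M P(1)] by blast
  show "c1_NS \<Lambda> (pullback_NS M L) = (\<lambda>u v. c1_NS \<Lambda> L (M *v u) (M *v v))"
    unfolding eq unfolding P(2) by (simp add: c1_NS_coset P(1) pullback_Pic[OF M P(1)])
qed

end

section \<open>Quaternion algebras over totally real fields\<close>

text \<open>The adjugate, which is the canonical involution of the real matrix algebra.\<close>

definition adj2 :: "real^2^2 \<Rightarrow> real^2^2" where
  "adj2 M = (\<chi> p q. if p = 1 then (if q = 1 then M $ 2 $ 2 else - M $ 1 $ 2)
     else (if q = 1 then - M $ 2 $ 1 else M $ 1 $ 1))"

lemma mat2_eq_iff: "(M :: real^2^2) = N \<longleftrightarrow>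
    M $ 1 $ 1 = N $ 1 $ 1 \<and> M $ 1 $ 2 = N $ 1 $ 2 \<and> M $ 2 $ 1 = N $ 2 $ 1 \<and> M $ 2 $ 2 = N $ 2 $ 2"
  by (auto simp: vec_eq_iff forall_2)

lemma adj2_nth [simp]:
  "adj2 M $ 1 $ 1 = M $ 2 $ 2" "adj2 M $ 1 $ 2 = - M $ 1 $ 2"
  "adj2 M $ 2 $ 1 = - M $ 2 $ 1" "adj2 M $ 2 $ 2 = M $ 1 $ 1"
  by (simp_all add: adj2_def)

lemma mat2_nth [simp]:
  "(mat r :: real^2^2) $ 1 $ 1 = r" "(mat r :: real^2^2) $ 1 $ 2 = 0"
  "(mat r :: real^2^2) $ 2 $ 1 = 0" "(mat r :: real^2^2) $ 2 $ 2 = r"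
  by (simp_all add: mat_def)

lemma mult2_nth [simp]: "((M :: real^2^2) ** N) $ p $ q = M $ p $ 1 * N $ 1 $ q + M $ p $ 2 * N $ 2 $ q"
  by (simp add: matrix_matrix_mult_def sum_2)

lemma trace2: "trace (M :: real^2^2) = M $ 1 $ 1 + M $ 2 $ 2"
  by (simp add: trace_def sum_2)

lemma adj2_mult: "adj2 (M ** N) = adj2 N ** adj2 M"
  by (simp add: mat2_eq_iff)

lemma adj2_add: "adj2 (M + N) = adj2 M + adj2 N"
  by (simp add: mat2_eq_iff)

lemma adj2_adj2 [simp]: "adj2 (adj2 M) = M"
  by (simp add: mat2_eq_iff)

lemma adj2_mat [simp]: "adj2 (mat r) = mat r"
  by (simp add: mat2_eq_iff)

lemma adj2_eq: "adj2 M = mat (trace M) - M"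
  by (simp add: mat2_eq_iff trace2)

lemma unital_ring_homD:
  assumes "unital_ring_hom h"
  shows "h 1 = 1" "h (x + y) = h x + h y" "h (x * y) = h x * h y" "h 0 = 0" "h (- x) = - h x" "h (x - y) = h x - h y"
proof -
  show 1: "h 1 = 1" "h (x + y) = h x + h y" "h (x * y) = h x * h y" for x y
    using assms by (auto simp: unital_ring_hom_def)
  show 2: "h 0 = 0" using 1(2)[of 0 0] by simp
  show 3: "h (- x) = - h x" for x using 1(2)[of x "- x"] 2 by (simp add: eq_neg_iff_add_eq_0 add.commute)
  show "h (x - y) = h x - h y" using 1(2)[of x "- y"] 3[of y] by simp
qed

lemma unital_ring_hom_power: "unital_ring_hom h \<Longrightarrow> h (x ^ k) = h x ^ k"
  by (induction k) (auto simp: unital_ring_homD)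

lemma unital_ring_hom_inj:
  fixes h :: "'a::division_ring \<Rightarrow> 'b::ring_1"
  assumes "unital_ring_hom h"
  shows "inj h"
proof (rule injI)
  fix x y assume "h x = h y"
  then have 0: "h (x - y) = 0" by (simp add: unital_ring_homD[OF assms])
  show "x = y"
  proof (rule ccontr)
    assume "x \<noteq> y"
    then have "h ((x - y) * inverse (x - y)) = 1" by (simp add: unital_ring_homD[OF assms])
    then show False using 0 by (simp only: unital_ring_homD(3)[OF assms]) simp
  qed
qed

lemma unital_ring_hom_of_int: "unital_ring_hom h \<Longrightarrow> h (of_int k) = of_int k"
  by (induction k rule: int_induct[where k = 0]) (auto simp: unital_ring_homD)

lemma unital_ring_hom_of_rat:
  fixes h :: "'a::field_char_0 \<Rightarrow> real"
  assumes "unital_ring_hom h"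
  shows "h (of_rat q) = of_rat q"
proof (cases q)
  case (Fract a b)
  have "h (of_rat q) * h (of_int b) = h (of_int a)"
    unfolding unital_ring_homD(3)[OF assms, symmetric] using Fract by (simp add: of_rat_rat)
  then have "h (of_rat q) * of_int b = of_int a" by (simp only: unital_ring_hom_of_int[OF assms])
  then show ?thesis using Fract by (simp add: of_rat_rat field_simps)
qed

lemma common_denominator:
  fixes f :: "'a \<Rightarrow> rat"
  assumes "finite A"
  shows "\<exists>m::int. m > 0 \<and> (\<forall>a\<in>A. of_int m * f a \<in> \<int>)"
  using assms
proof (induction A rule: finite_induct)
  case empty
  show ?case by (intro exI[of _ 1]) auto
next
  case (insert a A)
  then obtain m where m: "m > 0" "\<And>a. a \<in> A \<Longrightarrow> of_int m * f a \<in> \<int>" by blast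
  obtain p q where pq: "f a = Fract p q" "q > 0" by (cases "f a")
  have "of_int (m * q) * f a \<in> \<int>"
  proof -
    have "of_int q * f a = of_int p" using pq by (simp add: Fract_of_int_quotient)
    then have "of_int (m * q) * f a = of_int (m * p)" by simp
    then show ?thesis by (simp only: Ints_of_int)
  qed
  moreover have "of_int (m * q) * f b \<in> \<int>" if "b \<in> A" for b
  proof -
    have "of_int (m * q) * f b = of_int q * (of_int m * f b)" by simp
    then show ?thesis using m(2)[OF that] by (simp only: Ints_mult Ints_of_int)
  qed
  ultimately show ?case using m pq by (intro exI[of _ "m * q"]) auto
qed

section \<open>Number fields: integral multiples, embeddings, trace\<close>

lemma vector_space_rat_scale: "vector_space (rat_scale :: rat \<Rightarrow> 'f::field_char_0 \<Rightarrow> 'f)"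
  by unfold_locales (simp_all add: rat_scale_def of_rat_add of_rat_mult distrib_left distrib_right)

lemma number_field_basis:
  assumes "number_field TYPE('f::field_char_0)"
  shows "\<exists>S :: 'f set. finite S \<and> \<not> module.dependent rat_scale S \<and> module.span rat_scale S = UNIV"
proof -
  interpret F: vector_space "rat_scale :: rat \<Rightarrow> 'f \<Rightarrow> 'f" by (rule vector_space_rat_scale)
  obtain S :: "'f set" where S: "finite S" "F.span S = UNIV"
    using assms by (auto simp: number_field_def)
  obtain T where T: "T \<subseteq> S" "F.independent T" "S \<subseteq> F.span T" by (rule F.maximal_independent_subset)
  have "F.span T = UNIV" using S F.span_minimal[OF T(3) F.subspace_span] by auto
  then show ?thesis using T S finite_subset by blast
qed

text \<open>Clear the denominators in the matrix of multiplication by \<open>x\<close> on a rational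
  basis: the multiple then preserves the integer span of the basis. Dividing by a nonzero basis
  vector places all its powers in one finitely generated group.\<close>

lemma number_field_integral_multiple:
  assumes "number_field TYPE('f::field_char_0)"
  shows "\<exists>m::int. m > 0 \<and> of_int m * (x::'f) \<in> ring_of_integers"
proof -
  interpret F: vector_space "rat_scale :: rat \<Rightarrow> 'f \<Rightarrow> 'f" by (rule vector_space_rat_scale)
  obtain S :: "'f set" where S: "finite S" "F.independent S" "F.span S = UNIV"
    using number_field_basis[OF assms] by blast
  define r where "r y b = F.representation S y b" for y b
  have r: "(\<Sum>b\<in>S. of_rat (r y b) * b) = y" for y
    unfolding r_def using F.sum_representation_eq[OF S(2) _ S(1) order_refl] S(3) by (auto simp: rat_scale_def)
  obtain m :: int where m: "m > 0" "\<And>a b. a \<in> S \<Longrightarrow> b \<in> S \<Longrightarrow> of_int m * r (x * a) b \<in> \<int>"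
    using common_denominator[of "S \<times> S" "\<lambda>(a,b). r (x * a) b"] S(1) by auto
  define t where "t = of_int m * x"
  have tS: "t * s \<in> zspan S" if s: "s \<in> S" for s
  proof -
    have "t * s = of_int m * (\<Sum>b\<in>S. of_rat (r (x * s) b) * b)" unfolding r by (simp add: t_def)
    also have "\<dots> = (\<Sum>b\<in>S. of_rat (of_int m * r (x * s) b) * b)"
      by (simp add: sum_distrib_left of_rat_mult mult.assoc)
    also have "\<dots> \<in> zspan S"
    proof (rule zspan_sum)
      fix b assume b: "b \<in> S"
      obtain k where "of_int m * r (x * s) b = of_int k" using m(2)[OF s b] Ints_cases by blast
      then have "of_rat (of_int m * r (x * s) b) * b = zmul k b" by (simp add: zmul_of_int)
      then show "of_rat (of_int m * r (x * s) b) * b \<in> zspan S"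
        using zmul_in[OF add_subgroup_zspan zspan_base[OF b]] by simp
    qed
    finally show ?thesis .
  qed
  have tz: "t * z \<in> zspan S" if "z \<in> zspan S" for z
    by (rule zspan_additive_image[OF _ that]) (auto simp: right_diff_distrib tS)
  have "\<exists>s\<in>S. s \<noteq> 0"
  proof (rule ccontr)
    assume "\<not> (\<exists>s\<in>S. s \<noteq> 0)"
    then have "(\<Sum>b\<in>S. of_rat (r 1 b) * b) = 0" by (intro sum.neutral) auto
    then show False using r[of 1] by simp
  qed
  then obtain s where s: "s \<in> S" "s \<noteq> 0" by blast
  have pow: "t ^ k * s \<in> zspan S" for k
    by (induction k) (auto simp: s zspan_base tz mult.assoc)
  have "t ^ k \<in> zspan ((\<lambda>z. z * inverse s) ` S)" for k
  proof -
    have "(\<lambda>z. z * inverse s) (t ^ k * s) \<in> zspan ((\<lambda>z. z * inverse s) ` S)"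
      by (rule zspan_additive_image[OF _ pow]) (auto simp: left_diff_distrib intro: zspan_base)
    then show ?thesis using s by (simp add: mult.assoc)
  qed
  then have "integral_elem t"
    using S(1) by (intro integral_elem_of_powers[of "(\<lambda>z. z * inverse s) ` S"]) auto
  then show ?thesis
    using m(1) by (auto simp: integral_elem_iff_algebraic_int ring_of_integers_def t_def)
qed

lemma ring_of_integers_mult: "x \<in> ring_of_integers \<Longrightarrow> y \<in> ring_of_integers \<Longrightarrow> x * y \<in> ring_of_integers"
  using integral_elem_commute(2)[of x y]
  by (simp add: ring_of_integers_def integral_elem_iff_algebraic_int mult.commute)

lemma ring_of_integers_1: "1 \<in> ring_of_integers"
  by (simp add: ring_of_integers_def int_imp_algebraic_int)

text \<open>Dedekind's argument: the relation at \<open>y * x\<close> minus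
  \<open>\<sigma> k0 y\<close> times the relation at \<open>x\<close> is shorter, and
  \<open>y\<close> is chosen to keep the coefficient of \<open>k1\<close> alive.\<close>

lemma field_homs_independent:
  fixes \<sigma> :: "'k \<Rightarrow> 'f::field_char_0 \<Rightarrow> real" and c :: "'k \<Rightarrow> real"
  assumes "finite K" "inj_on \<sigma> K" "\<And>k. k \<in> K \<Longrightarrow> unital_ring_hom (\<sigma> k)"
    "\<And>x. (\<Sum>k\<in>K. c k * \<sigma> k x) = 0"
  shows "\<forall>k\<in>K. c k = 0"
  using assms
proof (induction K arbitrary: c rule: finite_induct)
  case (insert k0 K)
  note hom = insert.prems(2)
  have "c k1 = 0" if k1: "k1 \<in> K" for k1
  proof -
    have "\<sigma> k1 \<noteq> \<sigma> k0" using insert.prems(1) insert.hyps(2) k1 by (auto simp: inj_on_def)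
    then obtain y where y: "\<sigma> k1 y \<noteq> \<sigma> k0 y" by auto
    have "(\<Sum>k\<in>K. c k * (\<sigma> k y - \<sigma> k0 y) * \<sigma> k x) = 0" for x
    proof -
      have "(\<Sum>k\<in>K. c k * (\<sigma> k y - \<sigma> k0 y) * \<sigma> k x) =
          (\<Sum>k\<in>insert k0 K. c k * (\<sigma> k y - \<sigma> k0 y) * \<sigma> k x)"
        using insert.hyps by simp
      also have "\<dots> = (\<Sum>k\<in>insert k0 K. c k * \<sigma> k (y * x) - \<sigma> k0 y * (c k * \<sigma> k x))"
        using hom by (intro sum.cong) (simp_all add: unital_ring_homD algebra_simps)
      also have "\<dots> = (\<Sum>k\<in>insert k0 K. c k * \<sigma> k (y * x)) - \<sigma> k0 y * (\<Sum>k\<in>insert k0 K. c k * \<sigma> k x)"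
        by (simp only: sum_subtractf sum_distrib_left)
      also have "\<dots> = 0" by (simp only: insert.prems(3))
      finally show ?thesis .
    qed
    then have "\<forall>k\<in>K. c k * (\<sigma> k y - \<sigma> k0 y) = 0"
      using insert.prems by (intro insert.IH) (auto simp: inj_on_def)
    then show ?thesis using y k1 by auto
  qed
  moreover have "c k0 = 0"
    using insert.prems(3)[of 1] insert.hyps calculation hom by (simp add: unital_ring_homD)
  ultimately show ?case by simp
qed simp

text \<open>Multiplication by \<open>x\<close> is diagonalised by the embeddings. Coordinates in the
  rational basis are recovered through the inverse \<open>T\<close> of the matrix \<open>S\<close>
  of embedded basis vectors, and the trace collapses to the diagonal of
  \<open>S ** T\<close>.\<close>

lemma field_trace_eq:
  fixes \<sigma> :: "'n::finite \<Rightarrow> 'f::field_char_0 \<Rightarrow> real"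
  assumes nf: "number_field TYPE('f)" and deg: "field_degree TYPE('f) = CARD('n)"
    and inj: "inj \<sigma>" and hom: "\<And>k. unital_ring_hom (\<sigma> k)"
  shows "of_rat (field_trace x) = (\<Sum>k\<in>UNIV. \<sigma> k x)"
proof -
  interpret F: vector_space "rat_scale :: rat \<Rightarrow> 'f \<Rightarrow> 'f" by (rule vector_space_rat_scale)
  define Bs where "Bs = F.extend_basis {}"
  have ind: "F.independent Bs" and sp: "F.span Bs = UNIV"
    unfolding Bs_def
    using F.independent_extend_basis[OF F.independent_empty] F.span_extend_basis[OF F.independent_empty]
    by blast+
  obtain S :: "'f set" where S: "finite S" "F.span S = UNIV" using nf by (auto simp: number_field_def)
  have fin: "finite Bs" using F.independent_span_bound[OF S(1) ind] S(2) by auto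
  have "card Bs = CARD('n)"
    using F.basis_card_eq_dim[of Bs UNIV] ind sp deg by (simp add: field_degree_def)
  then obtain \<beta> :: "'n \<Rightarrow> 'f" where \<beta>: "bij_betw \<beta> UNIV Bs"
    using finite_same_card_bij[OF finite_class.finite_UNIV fin] by metis
  define r where "r y l = F.representation Bs y (\<beta> l)" for y l
  have r: "(\<Sum>l\<in>UNIV. of_rat (r y l) * \<beta> l) = y" for y
  proof -
    have "(\<Sum>l\<in>UNIV. of_rat (r y l) * \<beta> l) = (\<Sum>b\<in>Bs. rat_scale (F.representation Bs y b) b)"
      unfolding r_def rat_scale_def by (rule sum.reindex_bij_betw[OF \<beta>])
    also have "\<dots> = y" by (rule F.sum_representation_eq[OF ind _ fin order_refl]) (simp add: sp)
    finally show ?thesis .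
  qed
  have \<sigma>_sum: "\<sigma> k (\<Sum>l\<in>A. f l) = (\<Sum>l\<in>A. \<sigma> k (f l))" for k and f :: "'n \<Rightarrow> 'f" and A
    by (induction A rule: infinite_finite_induct) (auto simp: unital_ring_homD[OF hom])
  have \<sigma>r: "\<sigma> k y = (\<Sum>l\<in>UNIV. of_rat (r y l) * \<sigma> k (\<beta> l))" for k y
    by (subst r[symmetric]) (simp add: \<sigma>_sum unital_ring_homD[OF hom] unital_ring_hom_of_rat[OF hom])
  \<comment> \<open>Square because the degree equals the number of real embeddings; invertible by
    their linear independence.\<close>
  define S :: "real^'n^'n" where "S = (\<chi> k l. \<sigma> k (\<beta> l))"
  have "x = 0" if "transpose S *v x = 0" for x
  proof -
    have 0: "(\<Sum>k\<in>UNIV. x $ k * \<sigma> k (\<beta> l)) = 0" for l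
      using arg_cong[OF that, of "\<lambda>v. v $ l"]
      by (simp add: S_def transpose_def matrix_vector_mult_def mult.commute)
    have "(\<Sum>k\<in>UNIV. x $ k * \<sigma> k y) = 0" for y
    proof -
      have "(\<Sum>k\<in>UNIV. x $ k * \<sigma> k y) = (\<Sum>k\<in>UNIV. \<Sum>l\<in>UNIV. of_rat (r y l) * (x $ k * \<sigma> k (\<beta> l)))"
        unfolding \<sigma>r[of _ y] by (simp add: sum_distrib_left mult.left_commute)
      also have "\<dots> = (\<Sum>l\<in>UNIV. of_rat (r y l) * (\<Sum>k\<in>UNIV. x $ k * \<sigma> k (\<beta> l)))"
        by (subst sum.swap) (simp add: sum_distrib_left)
      finally show ?thesis by (simp add: 0)
    qed
    then have "\<forall>k\<in>UNIV. x $ k = 0"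
      by (rule field_homs_independent[OF finite_class.finite_UNIV inj hom])
    then show ?thesis by (simp add: vec_eq_iff)
  qed
  then have "\<exists>R. R ** transpose S = mat 1" unfolding matrix_left_invertible_ker by blast
  then obtain R where "R ** transpose S = mat 1" by (rule exE)
  from arg_cong[OF this, of transpose] have ST: "S ** transpose R = mat 1"
    by (simp add: matrix_transpose_mul transpose_transpose transpose_mat)
  define T where "T = transpose R"
  have ST: "S ** T = mat 1" using ST by (simp add: T_def)
  then have TS: "T ** S = mat 1" using matrix_left_right_inverse by blast
  have TS': "(\<Sum>k\<in>UNIV. T $ l $ k * \<sigma> k (\<beta> l')) = (if l = l' then 1 else 0)" for l l'
    using arg_cong[OF TS, of "\<lambda>M. M $ l $ l'"] by (simp add: matrix_matrix_mult_def mat_def S_def)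
  have ST': "(\<Sum>l\<in>UNIV. \<sigma> k (\<beta> l) * T $ l $ k) = 1" for k
    using arg_cong[OF ST, of "\<lambda>M. M $ k $ k"] by (simp add: matrix_matrix_mult_def mat_def S_def)
  have rT: "of_rat (r y l) = (\<Sum>k\<in>UNIV. T $ l $ k * \<sigma> k y)" for y l
  proof -
    have "(\<Sum>k\<in>UNIV. T $ l $ k * \<sigma> k y) = (\<Sum>k\<in>UNIV. \<Sum>l'\<in>UNIV. of_rat (r y l') * (T $ l $ k * \<sigma> k (\<beta> l')))"
      unfolding \<sigma>r[of _ y] by (simp add: sum_distrib_left mult.left_commute)
    also have "\<dots> = (\<Sum>l'\<in>UNIV. of_rat (r y l') * (\<Sum>k\<in>UNIV. T $ l $ k * \<sigma> k (\<beta> l')))"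
      by (subst sum.swap) (simp add: sum_distrib_left)
    finally show ?thesis by (simp add: TS' if_distrib cong: if_cong)
  qed
  have "field_trace x = (\<Sum>l\<in>UNIV. r (x * \<beta> l) l)"
    unfolding field_trace_def Let_def Bs_def[symmetric] r_def
    by (rule sum.reindex_bij_betw[OF \<beta>, symmetric])
  then have "of_rat (field_trace x) = (\<Sum>l\<in>UNIV. \<Sum>k\<in>UNIV. \<sigma> k x * (\<sigma> k (\<beta> l) * T $ l $ k))"
    by (simp add: of_rat_sum rT unital_ring_homD[OF hom] mult_ac)
  also have "\<dots> = (\<Sum>k\<in>UNIV. \<sigma> k x * (\<Sum>l\<in>UNIV. \<sigma> k (\<beta> l) * T $ l $ k))"
    by (subst sum.swap) (simp add: sum_distrib_left)
  finally show ?thesis by (simp add: ST')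
qed

lemma trace_uminus2: "trace (- M :: real^2^2) = - trace M"
  by (simp add: trace2)

lemma adj2_fixed:
  assumes "adj2 M = M" "trace M = 2 * r"
  shows "M = mat r"
proof -
  have "M $ 2 $ 2 = M $ 1 $ 1" "- M $ 1 $ 2 = M $ 1 $ 2" "- M $ 2 $ 1 = M $ 2 $ 1"
    using assms(1) unfolding mat2_eq_iff adj2_nth by blast+
  moreover have "M $ 1 $ 1 + M $ 2 $ 2 = 2 * r" using assms(2) unfolding trace2 .
  ultimately show ?thesis unfolding mat2_eq_iff mat2_nth by (intro conjI) linarith+
qed

lemma module_span_subsetI:
  assumes "module s" "0 \<in> Q" "\<And>x y. x \<in> Q \<Longrightarrow> y \<in> Q \<Longrightarrow> x + y \<in> Q" "\<And>c x. x \<in> Q \<Longrightarrow> s c x \<in> Q" "L \<subseteq> Q"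
  shows "module.span s L \<subseteq> Q"
  using module.span_minimal[OF assms(1,5)] module.subspaceI[OF assms(1), of Q] assms(2-4) by blast

section \<open>Canonical involution and trace form of B\<close>

locale quat_setup =
  fixes \<iota> :: "'f::field_char_0 \<Rightarrow> 'b::division_ring"
    and \<sigma> :: "'n::finite \<Rightarrow> 'f \<Rightarrow> real"
    and \<phi> :: "'n \<Rightarrow> 'b \<Rightarrow> real^2^2"
  assumes number_field: "number_field TYPE('f)"
    and degree: "field_degree TYPE('f) = CARD('n)"
    and bij_\<sigma>: "bij_betw \<sigma> UNIV real_embeddings"
    and quat_alg: "quaternion_algebra \<iota>"
    and split: "\<And>k. splitting \<iota> (\<sigma> k) (\<phi> k)"
begin

lemma hom_\<iota>: "unital_ring_hom \<iota>"
  using quat_alg by (simp add: quaternion_algebra_def)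

lemmas \<iota>_simps = unital_ring_homD[OF hom_\<iota>]

lemma central: "\<iota> a * x = x * \<iota> a"
  using quat_alg by (simp add: quaternion_algebra_def)

lemma inj_\<iota>: "inj \<iota>"
  by (rule unital_ring_hom_inj[OF hom_\<iota>])

lemma \<iota>_eq_0: "\<iota> a = 0 \<longleftrightarrow> a = 0"
  using inj_eq[OF inj_\<iota>, of a 0] by (simp add: \<iota>_simps)

lemma \<iota>_of_int: "\<iota> (of_int k) = of_int k"
  by (rule unital_ring_hom_of_int[OF hom_\<iota>])

lemma hom_\<sigma>: "unital_ring_hom (\<sigma> k)"
  using bij_betwE[OF bij_\<sigma>] by (auto simp: real_embeddings_def)

lemmas \<sigma>_simps = unital_ring_homD[OF hom_\<sigma>]

lemma inj_family_\<sigma>: "inj \<sigma>"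
  using bij_\<sigma> by (simp add: bij_betw_def)

lemma \<phi>_add: "\<phi> k (x + y) = \<phi> k x + \<phi> k y"
  and \<phi>_mult: "\<phi> k (x * y) = \<phi> k x ** \<phi> k y"
  and \<phi>_\<iota>: "\<phi> k (\<iota> a) = mat (\<sigma> k a)"
  and span_\<phi>: "span (range (\<phi> k)) = UNIV"
  using split[of k] by (auto simp: splitting_def)

lemma \<phi>_0: "\<phi> k 0 = 0"
  using \<phi>_add[of k 0 0] by simp

lemma \<phi>_uminus: "\<phi> k (- x) = - \<phi> k x"
  using \<phi>_add[of k x "- x"] by (simp add: \<phi>_0 eq_neg_iff_add_eq_0 add.commute)

lemma \<phi>_diff: "\<phi> k (x - y) = \<phi> k x - \<phi> k y"
  using \<phi>_add[of k x "- y"] by (simp add: \<phi>_uminus)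

lemma \<phi>_1: "\<phi> k 1 = mat 1"
  using \<phi>_\<iota>[of k 1] by (simp add: \<iota>_simps \<sigma>_simps)

lemma \<phi>_eq_0: "\<phi> k x = 0 \<Longrightarrow> x = 0"
proof (rule ccontr)
  assume 0: "\<phi> k x = 0" and "x \<noteq> 0"
  then have "\<phi> k (x * inverse x) = mat 1" by (simp add: \<phi>_1)
  then have "(mat 1 :: real^2^2) = 0" by (simp only: \<phi>_mult 0) (simp add: mat2_eq_iff)
  then show False by (simp add: mat2_eq_iff)
qed

lemma \<phi>_inj: "\<phi> k x = \<phi> k y \<Longrightarrow> x = y"
  using \<phi>_eq_0[of k "x - y"] by (simp add: \<phi>_diff)

text \<open>\<open>w\<close> is conjugate to \<open>- w\<close> under \<open>u\<close>, and
  conjugate matrices have equal trace. It serves for \<open>i\<close>, \<open>j\<close> and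
  \<open>i * j\<close>.\<close>

lemma trace_\<phi>_anticommuting:
  assumes "u \<noteq> 0" "u * w = - (w * u)"
  shows "trace (\<phi> k w) = 0"
proof -
  have "inverse u * (u * w) = - (inverse u * w * u)" unfolding assms(2) by (simp add: mult.assoc)
  then have "w = - (inverse u * w * u)" using assms(1) by (simp add: mult.assoc[symmetric])
  then have "trace (\<phi> k w) = trace (\<phi> k (- (inverse u * w * u)))"
    by (rule arg_cong)
  then have "trace (\<phi> k w) = - trace (\<phi> k (inverse u) ** \<phi> k w ** \<phi> k u)"
    by (simp only: \<phi>_uminus \<phi>_mult trace_uminus2)
  also have "trace (\<phi> k (inverse u) ** \<phi> k w ** \<phi> k u) = trace (\<phi> k u ** (\<phi> k (inverse u) ** \<phi> k w))"
    by (rule trace_mul_sym)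
  also have "\<phi> k u ** (\<phi> k (inverse u) ** \<phi> k w) = \<phi> k w"
    unfolding \<phi>_mult[symmetric] using assms(1) by (simp add: mult.assoc[symmetric])
  finally show ?thesis by simp
qed

text \<open>\<open>c x - d x\<close> lies in F, and so does its product with \<open>x\<close>. If it
  is nonzero then \<open>x\<close> itself lies in F, where both involutions are the
  identity.\<close>

lemma standard_involution_unique:
  assumes "standard_involution \<iota> c" "standard_involution \<iota> d"
  shows "c = d"
proof
  fix x
  have rng: "\<exists>t. x + e x = \<iota> t" "\<exists>n. x * e x = \<iota> n" if "standard_involution \<iota> e" for e
    using that unfolding standard_involution_def by blast+
  obtain t t' n n' where *: "x + c x = \<iota> t" "x + d x = \<iota> t'" "x * c x = \<iota> n" "x * d x = \<iota> n'"
    using rng[OF assms(1)] rng[OF assms(2)] by blast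
  have 1: "c x - d x = \<iota> (t - t')" unfolding \<iota>_simps *[symmetric] by simp
  have 2: "x * \<iota> (t - t') = \<iota> (n - n')"
    unfolding 1[symmetric] \<iota>_simps(6)[of n n'] *(3,4)[symmetric] by (simp add: right_diff_distrib)
  show "c x = d x"
  proof (cases "t = t'")
    case True
    then show ?thesis using 1 by (simp add: \<iota>_simps)
  next
    case False
    then have "\<iota> (t - t') * \<iota> (inverse (t - t')) = 1"
      unfolding \<iota>_simps(3)[symmetric] by (simp add: \<iota>_simps)
    then have "x = x * \<iota> (t - t') * \<iota> (inverse (t - t'))" by (simp add: mult.assoc)
    then have "x = \<iota> ((n - n') * inverse (t - t'))" unfolding 2 \<iota>_simps(3)[symmetric] .
    then show ?thesis using assms by (auto simp: standard_involution_def)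
  qed
qed

text \<open>In the basis 1, i, j, ij only the coordinate of 1 contributes to the trace of
  \<open>\<phi> k x\<close>. Hence a single element of F gives half the trace for all
  \<open>k\<close> at once, and the adjugate formula descends to B.\<close>

lemma standard_involution_exists:
  "\<exists>c. standard_involution \<iota> c \<and> (\<forall>k x. \<phi> k (c x) = adj2 (\<phi> k x))"
proof -
  obtain i j a b where ij: "a \<noteq> 0" "b \<noteq> 0" "i * i = \<iota> a" "j * j = \<iota> b" "j * i = - (i * j)"
    and ex: "\<And>x. \<exists>!(p, q, r, s). x = \<iota> p + \<iota> q * i + \<iota> r * j + \<iota> s * (i * j)"
    using quat_alg unfolding quaternion_algebra_def by blast
  have "\<iota> a \<noteq> 0" "\<iota> b \<noteq> 0" using ij(1,2) by (simp_all add: \<iota>_eq_0)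
  then have nz: "i \<noteq> 0" "j \<noteq> 0" using ij(3,4) by auto
  have tri: "trace (\<phi> k i) = 0" for k
    by (rule trace_\<phi>_anticommuting[OF nz(2)]) (simp add: ij)
  have trj: "trace (\<phi> k j) = 0" for k
    by (rule trace_\<phi>_anticommuting[OF nz(1)]) (simp add: ij)
  have trij: "trace (\<phi> k (i * j)) = 0" for k
  proof (rule trace_\<phi>_anticommuting[OF nz(1)])
    have "i * j * i = i * (j * i)" by (simp add: mult.assoc)
    then show "i * (i * j) = - (i * j * i)" by (simp add: ij)
  qed
  have exp: "\<exists>p. \<forall>k. trace (\<phi> k x) = 2 * \<sigma> k p" for x
  proof -
    obtain p q r s where x: "x = \<iota> p + \<iota> q * i + \<iota> r * j + \<iota> s * (i * j)" using ex[of x] by auto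
    have sc: "trace (\<phi> k (\<iota> q * y)) = \<sigma> k q * trace (\<phi> k y)" for k q y
      by (simp add: \<phi>_mult \<phi>_\<iota> trace2 distrib_left)
    have ta: "trace (\<phi> k (y + z)) = trace (\<phi> k y) + trace (\<phi> k z)" for k y z
      by (simp add: \<phi>_add trace2)
    have "trace (\<phi> k x) = 2 * \<sigma> k p" for k
      unfolding x ta sc tri trj trij by (simp add: \<phi>_\<iota> trace2)
    then show ?thesis by blast
  qed
  define p where "p x = (SOME p. \<forall>k. trace (\<phi> k x) = 2 * \<sigma> k p)" for x
  have p: "trace (\<phi> k x) = 2 * \<sigma> k (p x)" for k x
    using someI_ex[OF exp[of x]] unfolding p_def by blast
  \<comment> \<open>Forced by \<open>adj2_eq\<close>: the conjugate is the trace minus the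
    element.\<close>
  define c where "c x = \<iota> (2 * p x) - x" for x
  have \<phi>c: "\<phi> k (c x) = adj2 (\<phi> k x)" for k x
    by (simp add: c_def \<phi>_diff \<phi>_\<iota> adj2_eq p \<sigma>_simps(3) unital_ring_hom_of_int[OF hom_\<sigma>, of k 2, simplified])
  \<comment> \<open>Any index will do, since each \<phi> k is injective; identities for
    \<open>c\<close> are checked on matrices.\<close>
  let ?k = "undefined :: 'n"
  have c_cong: "x = y" if "\<phi> ?k x = \<phi> ?k y" for x y using \<phi>_inj that .
  have c_mult: "c (x * y) = c y * c x" for x y by (rule c_cong) (simp add: \<phi>c \<phi>_mult adj2_mult)
  have c_c: "c (c x) = x" for x by (rule c_cong) (simp add: \<phi>c)
  have "standard_involution \<iota> c"
    unfolding standard_involution_def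
  proof (intro conjI allI)
    fix x y a
    show "c (x + y) = c x + c y" by (rule c_cong) (simp add: \<phi>c \<phi>_add adj2_add)
    show "c (x * y) = c y * c x" by (rule c_mult)
    show "c (c x) = x" by (rule c_c)
    show "c (\<iota> a) = \<iota> a" by (rule c_cong) (simp add: \<phi>c \<phi>_\<iota>)
    show "x + c x \<in> range \<iota>" by (simp add: c_def)
    have "c (x * c x) = x * c x" by (simp add: c_mult c_c)
    then have "adj2 (\<phi> ?k (x * c x)) = \<phi> ?k (x * c x)" by (simp only: \<phi>c[symmetric])
    from adj2_fixed[OF this p]
    have "\<phi> ?k (x * c x) = mat (\<sigma> ?k (p (x * c x)))" .
    then have "x * c x = \<iota> (p (x * c x))" by (intro c_cong) (simp add: \<phi>_\<iota>)
    then show "x * c x \<in> range \<iota>" by simp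
  qed
  then show ?thesis using \<phi>c by blast
qed

lemma standard_involution_quat_conj: "standard_involution \<iota> (quat_conj \<iota>)"
  using standard_involution_exists standard_involution_unique theI[of "standard_involution \<iota>"]
  unfolding quat_conj_def by blast

abbreviation cj :: "'b \<Rightarrow> 'b" where "cj \<equiv> quat_conj \<iota>"

lemma \<phi>_cj: "\<phi> k (cj x) = adj2 (\<phi> k x)"
proof -
  obtain c where "standard_involution \<iota> c" "\<forall>k x. \<phi> k (c x) = adj2 (\<phi> k x)"
    using standard_involution_exists by blast
  then show ?thesis using standard_involution_unique[OF standard_involution_quat_conj] by metis
qed

lemma cj_add: "cj (x + y) = cj x + cj y"
  and cj_mult: "cj (x * y) = cj y * cj x"
  and cj_cj [simp]: "cj (cj x) = x"
  and cj_\<iota> [simp]: "cj (\<iota> a) = \<iota> a"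
  and trd_range: "x + cj x \<in> range \<iota>"
  and nrd_range: "x * cj x \<in> range \<iota>"
  using standard_involution_quat_conj by (auto simp: standard_involution_def)

lemma cj_1 [simp]: "cj 1 = 1"
  using cj_\<iota>[of 1] by (simp add: \<iota>_simps)

lemma cj_0 [simp]: "cj 0 = 0"
  using cj_\<iota>[of 0] by (simp add: \<iota>_simps)

lemma cj_uminus: "cj (- x) = - cj x"
  using cj_add[of x "- x"] by (simp add: eq_neg_iff_add_eq_0 add.commute)

lemma cj_diff: "cj (x - y) = cj x - cj y"
  using cj_add[of x "- y"] by (simp add: cj_uminus)

lemma cj_power: "cj (x ^ k) = cj x ^ k"
  by (induction k) (auto simp: cj_mult power_commutes)

lemma cj_sum: "cj (sum f A) = (\<Sum>a\<in>A. cj (f a))"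
  by (induction A rule: infinite_finite_induct) (auto simp: cj_add)

lemma \<iota>_trd: "\<iota> (trd \<iota> x) = x + cj x"
  unfolding trd_def by (rule f_the_inv_into_f[OF inj_\<iota> trd_range])

lemma \<iota>_nrd: "\<iota> (nrd \<iota> x) = x * cj x"
  unfolding nrd_def by (rule f_the_inv_into_f[OF inj_\<iota> nrd_range])

lemma cj_eq: "cj x = \<iota> (trd \<iota> x) - x"
  by (simp add: \<iota>_trd)

lemma cj_commute: "cj x * x = x * cj x"
  unfolding cj_eq by (simp add: left_diff_distrib right_diff_distrib central)

lemma \<sigma>_trd: "\<sigma> k (trd \<iota> x) = trace (\<phi> k x)"
proof -
  have "mat (\<sigma> k (trd \<iota> x)) = \<phi> k x + adj2 (\<phi> k x)"
    unfolding \<phi>_\<iota>[symmetric] \<iota>_trd \<phi>_add \<phi>_cj ..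
  from arg_cong[OF this, of "\<lambda>M. M $ 1 $ 1"] show ?thesis by (simp add: trace2)
qed

lemma trd_eq_0: "trd \<iota> x = 0 \<longleftrightarrow> cj x = - x"
proof -
  have "trd \<iota> x = 0 \<longleftrightarrow> \<iota> (trd \<iota> x) = \<iota> 0" using inj_\<iota> by (auto dest: injD)
  then show ?thesis by (simp add: \<iota>_trd \<iota>_simps eq_neg_iff_add_eq_0 add.commute)
qed

lemma tr_BQ_eq: "of_rat (tr_BQ \<iota> x) = (\<Sum>k\<in>UNIV. trace (\<phi> k x))"
  unfolding tr_BQ_def field_trace_eq[OF number_field degree inj_family_\<sigma> hom_\<sigma>] \<sigma>_trd ..

lemma tr_eqI: "(\<Sum>k\<in>UNIV. trace (\<phi> k x)) = of_rat r \<Longrightarrow> tr_BQ \<iota> x = r"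
  using tr_BQ_eq[of x] by simp

lemma tr_add: "tr_BQ \<iota> (x + y) = tr_BQ \<iota> x + tr_BQ \<iota> y"
  by (rule tr_eqI) (simp add: of_rat_add tr_BQ_eq \<phi>_add trace2 sum.distrib)

lemma tr_uminus: "tr_BQ \<iota> (- x) = - tr_BQ \<iota> x"
  by (rule tr_eqI) (simp add: of_rat_minus tr_BQ_eq \<phi>_uminus trace2 sum_negf sum_subtractf sum.distrib)

lemma tr_diff: "tr_BQ \<iota> (x - y) = tr_BQ \<iota> x - tr_BQ \<iota> y"
  using tr_add[of x "- y"] by (simp add: tr_uminus)

lemma tr_commute: "tr_BQ \<iota> (x * y) = tr_BQ \<iota> (y * x)"
  by (rule tr_eqI, unfold tr_BQ_eq \<phi>_mult, intro sum.cong refl trace_mul_sym)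

lemma tr_cj: "tr_BQ \<iota> (cj x) = tr_BQ \<iota> x"
  by (rule tr_eqI) (simp add: tr_BQ_eq \<phi>_cj trace2 add.commute)

abbreviation qscale :: "rat \<Rightarrow> 'b \<Rightarrow> 'b" where "qscale q x \<equiv> \<iota> (of_rat q) * x"

lemma tr_qscale: "tr_BQ \<iota> (qscale q x) = q * tr_BQ \<iota> x"
  by (rule tr_eqI)
     (simp add: of_rat_mult tr_BQ_eq \<phi>_mult \<phi>_\<iota> trace2 unital_ring_hom_of_rat[OF hom_\<sigma>] sum_distrib_left distrib_left)

lemma tr_1: "tr_BQ \<iota> 1 = of_nat (2 * CARD('n))"
  by (rule tr_eqI) (simp add: \<phi>_1 trace2 of_rat_mult)

text \<open>A nonzero \<open>y\<close> is invertible in B, and tr 1 = 2n does not vanish.\<close>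

lemma tr_nondegenerate:
  assumes "\<And>x. tr_BQ \<iota> (y * x) = 0"
  shows "y = 0"
proof (rule ccontr)
  assume "y \<noteq> 0"
  then have "tr_BQ \<iota> (y * inverse y) = of_nat (2 * CARD('n))" by (simp only: right_inverse[OF \<open>y \<noteq> 0\<close>] tr_1)
  then show False using assms by simp
qed

lemma tr_cancel:
  assumes "\<And>x. tr_BQ \<iota> (y * x) = tr_BQ \<iota> (z * x)"
  shows "y = z"
  using tr_nondegenerate[of "y - z"] assms by (simp add: left_diff_distrib tr_diff)

lemma mult_qscale: "y * qscale q x = qscale q (y * x)"
proof -
  have "y * qscale q x = y * \<iota> (of_rat q) * x" by (simp only: mult.assoc)
  also have "\<dots> = qscale q (y * x)" by (simp only: central[symmetric] mult.assoc)
  finally show ?thesis .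
qed

lemma tr_mult_qscale: "tr_BQ \<iota> (y * qscale q x) = q * tr_BQ \<iota> (y * x)"
  unfolding mult_qscale tr_qscale ..

lemma qscale_vector_space: "vector_space qscale"
  by unfold_locales
     (simp_all add: of_rat_add of_rat_mult \<iota>_simps distrib_left distrib_right mult.assoc)

lemma qbasis: "\<exists>S :: 'b set. finite S \<and> \<not> module.dependent qscale S \<and> module.span qscale S = UNIV"
proof -
  interpret V: vector_space qscale by (rule qscale_vector_space)
  interpret F: vector_space "rat_scale :: rat \<Rightarrow> 'f \<Rightarrow> 'f" by (rule vector_space_rat_scale)
  obtain S :: "'f set" where S: "finite S" "F.span S = UNIV" using number_field unfolding number_field_def by blast
  obtain i j a b where ex: "\<And>x. \<exists>!(p, q, r, s). x = \<iota> p + \<iota> q * i + \<iota> r * j + \<iota> s * (i * j)"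
    using quat_alg unfolding quaternion_algebra_def by blast
  define X where "X = (\<lambda>(s,e). \<iota> s * e) ` (S \<times> {1, i, j, i * j})"
  have sp: "\<iota> p * e \<in> V.span X" if e: "e \<in> {1, i, j, i * j}" for p e
  proof -
    have "F.span S \<subseteq> {p. \<iota> p * e \<in> V.span X}"
    proof (rule F.span_minimal)
      show "S \<subseteq> {p. \<iota> p * e \<in> V.span X}" using e by (auto simp: X_def intro!: V.span_base)
      show "F.subspace {p. \<iota> p * e \<in> V.span X}"
        by (rule F.subspaceI)
           (auto simp: \<iota>_simps distrib_right rat_scale_def mult.assoc intro: V.span_zero V.span_add V.span_scale)
    qed
    then show ?thesis using S by auto
  qed
  have "x \<in> V.span X" for x
  proof -
    obtain p q r s where x: "x = \<iota> p + \<iota> q * i + \<iota> r * j + \<iota> s * (i * j)" using ex[of x] by auto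
    show ?thesis unfolding x using sp[of 1 p] sp[of i q] sp[of j r] sp[of "i * j" s]
      by (intro V.span_add) auto
  qed
  then have X: "finite X" "V.span X = UNIV" using S(1) by (auto simp: X_def)
  obtain T where T: "T \<subseteq> X" "V.independent T" "X \<subseteq> V.span T" by (rule V.maximal_independent_subset)
  have "V.span T = UNIV" using X V.span_minimal[OF T(3) V.subspace_span] by auto
  moreover have "finite T" using T(1) X(1) by (rule finite_subset)
  ultimately show ?thesis using T(2) by (intro exI[of _ T]) simp
qed

text \<open>Nondegeneracy of the trace form makes B isomorphic to its rational dual, by counting
  dimensions.\<close>

lemma functional_representation:
  fixes f :: "'b \<Rightarrow> rat"
  assumes "\<And>x y. f (x + y) = f x + f y" "\<And>q x. f (qscale q x) = q * f x"
  shows "\<exists>\<delta>. \<forall>x. f x = tr_BQ \<iota> (\<delta> * x)"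
proof -
  obtain S :: "'b set" where S: "finite S" "\<not> module.dependent qscale S" "module.span qscale S = UNIV"
    using qbasis by blast
  interpret V: vector_space qscale by (rule qscale_vector_space)
  interpret V: finite_dimensional_vector_space qscale S by unfold_locales (use S in auto)
  have spanI: "f x = g x" if "\<And>x y. f (x + y) = f x + f y" "\<And>q x. f (qscale q x) = q * f x"
     "\<And>x y. g (x + y) = g x + g y" "\<And>q x. g (qscale q x) = q * g x" "\<And>s. s \<in> S \<Longrightarrow> f s = g s"
   for f g :: "'b \<Rightarrow> rat" and x
  proof -
    have "f 0 = 0" "g 0 = 0" using that(1)[of 0 0] that(3)[of 0 0] by simp_all
    then have "V.span S \<subseteq> {x. f x = g x}"
      using that by (intro V.span_minimal V.subspaceI) auto
    then show ?thesis using S by auto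
  qed
  \<comment> \<open>The values of \<delta> against a rational basis, stored as coefficients in that
    same basis: the map from B to its dual becomes an endomorphism of B, which is onto once it is
    injective.\<close>
  define T where "T \<delta> = (\<Sum>s\<in>S. qscale (tr_BQ \<iota> (\<delta> * s)) s)" for \<delta>
  have coeffs: "\<forall>s\<in>S. u s = v s" if eq: "(\<Sum>s\<in>S. qscale (u s) s) = (\<Sum>s\<in>S. qscale (v s) s)" for u v
  proof -
    have "(\<Sum>s\<in>S. qscale (u s - v s) s) = 0"
      using eq by (simp add: of_rat_diff \<iota>_simps left_diff_distrib sum_subtractf)
    then have "u s - v s = 0" if "s \<in> S" for s
      by (rule V.independentD[OF S(2) S(1) order_refl _ that])
    then show ?thesis by simp
  qed
  have T_add: "T (x + y) = T x + T y" for x y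
    by (simp add: T_def distrib_right tr_add of_rat_add \<iota>_simps(2) sum.distrib)
  have T_scale: "T (qscale q x) = qscale q (T x)" for q x
  proof -
    have "qscale (tr_BQ \<iota> (qscale q x * s)) s = qscale q (qscale (tr_BQ \<iota> (x * s)) s)" for s
      unfolding mult.assoc tr_qscale of_rat_mult \<iota>_simps(3) ..
    then show ?thesis unfolding T_def sum_distrib_left by (intro sum.cong refl)
  qed
  have lin: "Vector_Spaces.linear qscale qscale T"
    unfolding Vector_Spaces.linear_iff using qscale_vector_space T_add T_scale by blast
  have "inj T"
  proof (rule injI)
    fix \<delta> \<epsilon> assume "T \<delta> = T \<epsilon>"
    then have eq: "\<forall>s\<in>S. tr_BQ \<iota> (\<delta> * s) = tr_BQ \<iota> (\<epsilon> * s)"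
      unfolding T_def by (rule coeffs)
    have "tr_BQ \<iota> (\<delta> * x) = tr_BQ \<iota> (\<epsilon> * x)" for x
      by (rule spanI[of "\<lambda>x. tr_BQ \<iota> (\<delta> * x)" "\<lambda>x. tr_BQ \<iota> (\<epsilon> * x)"])
         (simp_all add: distrib_left tr_add tr_mult_qscale eq)
    then show "\<delta> = \<epsilon>" by (rule tr_cancel)
  qed
  then have "surj T" using V.linear_inj_imp_surj[OF lin] by blast
  then obtain \<delta> where "T \<delta> = (\<Sum>s\<in>S. qscale (f s) s)" by (metis surjD)
  then have eq: "\<forall>s\<in>S. tr_BQ \<iota> (\<delta> * s) = f s" unfolding T_def by (rule coeffs)
  have "f x = tr_BQ \<iota> (\<delta> * x)" for x
    by (rule spanI[of f "\<lambda>x. tr_BQ \<iota> (\<delta> * x)"])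
       (simp_all add: distrib_left tr_add tr_mult_qscale assms eq)
  then show ?thesis by blast
qed

section \<open>Lattices in B\<close>

lemma module_alg_scale: "module (alg_scale \<iota>)"
  by unfold_locales (simp_all add: alg_scale_def \<iota>_simps distrib_left distrib_right mult.assoc)

lemma lattice_add_subgroup: "lattice_in \<iota> L \<Longrightarrow> add_subgroup L"
  unfolding lattice_in_def by auto

lemma lattice_integers_mult:
  assumes "lattice_in \<iota> L" "r \<in> ring_of_integers" "x \<in> L"
  shows "\<iota> r * x \<in> L"
proof -
  obtain S where S: "L = int_span {\<iota> r * x | r x. r \<in> ring_of_integers \<and> x \<in> S}"
    using assms(1) unfolding lattice_in_def by blast
  have L: "add_subgroup L" using lattice_add_subgroup[OF assms(1)] .
  show ?thesis
  proof (rule int_span_additive_image[where f = "\<lambda>x. \<iota> r * x", OF _ _ L])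
    show "x \<in> int_span {\<iota> r * x | r x. r \<in> ring_of_integers \<and> x \<in> S}" using assms(3) S by simp
    fix s assume "s \<in> {\<iota> r * x | r x. r \<in> ring_of_integers \<and> x \<in> S}"
    then obtain t x where "s = \<iota> t * x" "t \<in> ring_of_integers" "x \<in> S" by auto
    then have "\<iota> r * s = \<iota> (r * t) * x" "r * t \<in> ring_of_integers"
      using assms(2) by (simp_all add: \<iota>_simps mult.assoc ring_of_integers_mult)
    then show "\<iota> r * s \<in> L" unfolding S using \<open>x \<in> S\<close> by (intro int_span_base) auto
  qed (simp add: right_diff_distrib)
qed

text \<open>The elements with a positive integer multiple in \<open>L\<close> form an F-subspace
  containing \<open>L\<close>, which spans B. Scalars of F are handled by first multiplying them
  into the ring of integers.\<close>

lemma lattice_multiple: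
  assumes "lattice_in \<iota> L"
  shows "\<exists>m::int. m > 0 \<and> of_int m * x \<in> L"
proof -
  have L: "add_subgroup L" using lattice_add_subgroup[OF assms] .
  have mul: "of_int k * x \<in> L" if "x \<in> L" for k x
    using zmul_in[OF L that, of k] by (simp add: zmul_of_int)
  have "module.span (alg_scale \<iota>) L \<subseteq> {x. \<exists>m::int. m > 0 \<and> of_int m * x \<in> L}"
  proof (rule module_span_subsetI[OF module_alg_scale])
    show "0 \<in> {x. \<exists>m::int. m > 0 \<and> of_int m * x \<in> L}"
      using add_subgroup_0[OF L] by (auto intro: exI[of _ 1])
    show "L \<subseteq> {x. \<exists>m::int. m > 0 \<and> of_int m * x \<in> L}" by (auto intro!: exI[of _ 1])
  next
    fix x y assume "x \<in> {x. \<exists>m::int. m > 0 \<and> of_int m * x \<in> L}" "y \<in> {x. \<exists>m::int. m > 0 \<and> of_int m * x \<in> L}"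
    then obtain m n :: int where mn: "m > 0" "n > 0" "of_int m * x \<in> L" "of_int n * y \<in> L" by blast
    have "of_int (m * n) * (x + y) = of_int n * (of_int m * x) + of_int m * (of_int n * y)"
      by (simp add: distrib_left mult.assoc[symmetric] of_int_mult[symmetric] mult.commute del: of_int_mult)
    moreover have "of_int n * (of_int m * x) + of_int m * (of_int n * y) \<in> L"
      by (intro add_subgroup_add[OF L] mul mn)
    ultimately show "x + y \<in> {x. \<exists>m::int. m > 0 \<and> of_int m * x \<in> L}"
      using mn(1,2) by (intro CollectI exI[of _ "m * n"]) auto
  next
    fix c :: 'f and x assume "x \<in> {x. \<exists>m::int. m > 0 \<and> of_int m * x \<in> L}"
    then obtain m :: int where m: "m > 0" "of_int m * x \<in> L" by blast
    obtain n :: int where n: "n > 0" "of_int n * c \<in> ring_of_integers"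
      using number_field_integral_multiple[OF number_field, of c] by blast
    have "of_int (n * m) * alg_scale \<iota> c x = \<iota> (of_int n * c) * (of_int m * x)"
    proof -
      have "of_int m * (\<iota> c * x) = \<iota> c * (of_int m * x)"
        using central[of "of_int m" "\<iota> c"] unfolding \<iota>_of_int by (simp only: mult.assoc[symmetric])
      then show ?thesis by (simp add: alg_scale_def \<iota>_simps \<iota>_of_int mult.assoc)
    qed
    moreover have "\<iota> (of_int n * c) * (of_int m * x) \<in> L" by (rule lattice_integers_mult[OF assms n(2) m(2)])
    ultimately show "alg_scale \<iota> c x \<in> {x. \<exists>m::int. m > 0 \<and> of_int m * x \<in> L}"
      using m(1) n(1) by (intro CollectI exI[of _ "n * m"]) auto
  qed
  then show ?thesis using assms by (auto simp: lattice_in_def)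
qed

lemma lattice_common_multiple:
  assumes "lattice_in \<iota> L" "finite A"
  shows "\<exists>m::int. m > 0 \<and> (\<forall>x\<in>A. of_int m * x \<in> L)"
  using assms(2)
proof (induction A rule: finite_induct)
  case empty
  show ?case by (intro exI[of _ 1]) auto
next
  case (insert a A)
  have L: "add_subgroup L" using lattice_add_subgroup[OF assms(1)] .
  have mul: "of_int k * x \<in> L" if "x \<in> L" for k x
    using zmul_in[OF L that, of k] by (simp add: zmul_of_int)
  obtain m where m: "m > 0" "\<forall>x\<in>A. of_int m * x \<in> L" using insert.IH by blast
  obtain n :: int where n: "n > 0" "of_int n * a \<in> L" using lattice_multiple[OF assms(1)] by blast
  have "of_int (m * n) * a \<in> L" using mul[OF n(2), of m] by (simp add: mult.assoc)
  moreover have "of_int (m * n) * x \<in> L" if "x \<in> A" for x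
    using mul[of "of_int m * x" n] m(2) that by (simp add: mult.assoc[symmetric] of_int_mult[symmetric] mult.commute del: of_int_mult)
  ultimately show ?case using m n by (intro exI[of _ "m * n"]) auto
qed

end

section \<open>The ideal of reduced norms\<close>

text \<open>The last two assumptions isolate what the torus contributes to the ideal theory: the
  left order comes from End(A) = \<O>, the generators over Z from the polarization.\<close>

locale quat_ideal = quat_setup \<iota> \<sigma> \<phi>
  for \<iota> :: "'f::field_char_0 \<Rightarrow> 'b::division_ring"
    and \<sigma> :: "'n::finite \<Rightarrow> 'f \<Rightarrow> real"
    and \<phi> :: "'n \<Rightarrow> 'b \<Rightarrow> real^2^2" +
  fixes \<O> I :: "'b set"
  assumes hereditary: "hereditary_order \<iota> \<O>"
    and left_ideal: "left_ideal \<iota> \<O> I"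
    and left_order: "\<And>d. (\<And>x. x \<in> I \<Longrightarrow> d * x \<in> I) \<Longrightarrow> d \<in> \<O>"
    and finitely_generated: "\<exists>S. finite S \<and> I = zspan S"
begin

lemma lattice_\<O>: "lattice_in \<iota> \<O>"
  and \<O>_1: "1 \<in> \<O>"
  and \<O>_mult: "x \<in> \<O> \<Longrightarrow> y \<in> \<O> \<Longrightarrow> x * y \<in> \<O>"
  using hereditary by (auto simp: hereditary_order_def quat_order_def)

lemma lattice_I: "lattice_in \<iota> I"
  and I_left: "r \<in> \<O> \<Longrightarrow> x \<in> I \<Longrightarrow> r * x \<in> I"
  using left_ideal by (auto simp: left_ideal_def)

lemmas subgroup_\<O> = lattice_add_subgroup[OF lattice_\<O>]
lemmas subgroup_I = lattice_add_subgroup[OF lattice_I]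

lemma \<O>_of_int: "of_int k \<in> \<O>"
  using zmul_in[OF subgroup_\<O> \<O>_1, of k] by (simp add: zmul_of_int)

lemma \<O>_integers: "r \<in> ring_of_integers \<Longrightarrow> \<iota> r \<in> \<O>"
  using lattice_integers_mult[OF lattice_\<O> _ \<O>_1] by simp

lemma of_int_nonzero: "m \<noteq> 0 \<Longrightarrow> (of_int m :: 'b) \<noteq> 0"
  using \<iota>_eq_0[of "of_int m"] by (simp add: \<iota>_of_int)

lemma central_left: "y * (\<iota> a * x) = \<iota> a * (y * x)"
proof -
  have "y * (\<iota> a * x) = y * \<iota> a * x" by (simp only: mult.assoc)
  also have "\<dots> = \<iota> a * (y * x)" unfolding central[of a y, symmetric] by (simp only: mult.assoc)
  finally show ?thesis .
qed

lemma of_int_left: "y * (of_int m * x) = of_int m * (y * x)" for x y :: 'b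
  using central_left[of y "of_int m" x] by (simp add: \<iota>_of_int)

lemma I_nonzero: "\<exists>x\<in>I. x \<noteq> 0"
proof -
  obtain m :: int where "m > 0" "of_int m * 1 \<in> I" using lattice_multiple[OF lattice_I, of 1] by blast
  then show ?thesis using of_int_nonzero[of m] by (intro bexI[of _ "of_int m * 1"]) auto
qed

text \<open>All \<open>u ^ k * x\<close> stay in the finitely generated group \<open>I\<close>;
  cancelling a nonzero \<open>x\<close> bounds the powers of \<open>u\<close>.\<close>

lemma integral_left:
  assumes "\<And>x. x \<in> I \<Longrightarrow> u * x \<in> I"
  shows "integral_elem u"
proof -
  obtain x where x: "x \<in> I" "x \<noteq> 0" using I_nonzero by blast
  obtain S where S: "finite S" "I = zspan S" using finitely_generated by blast
  have pow: "u ^ k * x \<in> I" for k by (induction k) (auto simp: x mult.assoc assms)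
  have "u ^ k \<in> zspan ((\<lambda>z. z * inverse x) ` S)" for k
  proof -
    have "(\<lambda>z. z * inverse x) (u ^ k * x) \<in> zspan ((\<lambda>z. z * inverse x) ` S)"
      by (rule zspan_additive_image[of _ _ S]) (use pow S in \<open>auto simp: left_diff_distrib intro: zspan_base\<close>)
    then show ?thesis using x by (simp add: mult.assoc)
  qed
  then show ?thesis by (rule integral_elem_of_powers[OF finite_imageI[OF S(1)]])
qed

lemma integral_right:
  assumes "\<And>x. x \<in> I \<Longrightarrow> x * u \<in> I"
  shows "integral_elem u"
proof -
  obtain x where x: "x \<in> I" "x \<noteq> 0" using I_nonzero by blast
  obtain S where S: "finite S" "I = zspan S" using finitely_generated by blast
  have pow: "x * u ^ k \<in> I" for k
    by (induction k) (auto simp: x power_Suc2 mult.assoc[symmetric] assms simp del: power_Suc)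
  have "u ^ k \<in> zspan ((\<lambda>z. inverse x * z) ` S)" for k
  proof -
    have "(\<lambda>z. inverse x * z) (x * u ^ k) \<in> zspan ((\<lambda>z. inverse x * z) ` S)"
      by (rule zspan_additive_image[of _ _ S]) (use pow S in \<open>auto simp: right_diff_distrib intro: zspan_base\<close>)
    then show ?thesis using x by (simp add: mult.assoc[symmetric])
  qed
  then show ?thesis by (rule integral_elem_of_powers[OF finite_imageI[OF S(1)]])
qed

text \<open>The trace is the sum of the commuting integral elements \<open>u\<close> and
  \<open>cj u\<close>; the integral equation lies in the image of F and is pulled back along the
  injective \<iota>.\<close>

lemma trd_integral:
  assumes "integral_elem u"
  shows "trd \<iota> u \<in> ring_of_integers"
proof -
  have "integral_elem (cj u)"
    by (rule integral_elem_hom[OF assms]) (auto simp: cj_diff cj_power)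
  then have "integral_elem (\<iota> (trd \<iota> u))"
    unfolding \<iota>_trd by (rule integral_elem_commute(1)[OF assms]) (simp add: cj_commute)
  then obtain n where n: "\<iota> (trd \<iota> u) ^ n \<in> zspan {\<iota> (trd \<iota> u) ^ i | i. i < n}"
    by (auto simp: integral_elem_def)
  have "{\<iota> (trd \<iota> u) ^ i | i. i < n} = \<iota> ` {trd \<iota> u ^ i | i. i < n}"
    by (auto simp: unital_ring_hom_power[OF hom_\<iota>, symmetric])
  then have "\<iota> (trd \<iota> u ^ n) \<in> \<iota> ` zspan {trd \<iota> u ^ i | i. i < n}"
    using n by (simp only: additive_image_zspan[of \<iota>, OF \<iota>_simps(6)] unital_ring_hom_power[OF hom_\<iota>])
  then have "trd \<iota> u ^ n \<in> zspan {trd \<iota> u ^ i | i. i < n}"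
    by (simp only: inj_image_mem_iff[OF inj_\<iota>])
  then show ?thesis
    unfolding ring_of_integers_def integral_elem_iff_algebraic_int[symmetric] integral_elem_def by blast
qed

text \<open>\<open>cj r\<close> is the trace minus \<open>r\<close>. Left multiplication by
  \<open>r\<close> preserves \<open>I\<close>, so \<open>r\<close> is integral, and its trace is an
  algebraic integer, which lies in \<O>.\<close>

lemma cj_\<O>:
  assumes "r \<in> \<O>"
  shows "cj r \<in> \<O>"
proof -
  have "integral_elem r" by (rule integral_left) (rule I_left[OF assms])
  then have "\<iota> (trd \<iota> r) \<in> \<O>" by (intro \<O>_integers trd_integral)
  then show ?thesis unfolding cj_eq by (rule add_subgroup_diff[OF subgroup_\<O> _ assms])
qed

text \<open>The same argument for the right order of \<open>I\<close>, with the central trace moved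
  to the left of \<open>x\<close>.\<close>

lemma cj_right_order:
  assumes "\<And>x. x \<in> I \<Longrightarrow> x * u \<in> I" "x \<in> I"
  shows "x * cj u \<in> I"
proof -
  have "\<iota> (trd \<iota> u) \<in> \<O>" by (intro \<O>_integers trd_integral integral_right assms)
  then have "\<iota> (trd \<iota> u) * x - x * u \<in> I" by (intro add_subgroup_diff[OF subgroup_I] I_left assms)
  then show ?thesis by (simp only: cj_eq right_diff_distrib central)
qed

text \<open>An \<open>\<O>\<close>-linear map from a left ideal to \<open>\<O>\<close> is right multiplication
  by an element of \<open>B\<close>.\<close>

lemma projective_dual_basis:
  assumes J: "one_sided_ideal (\<lambda>r x. r * x) \<O> J" and y0: "y0 \<in> J" "y0 \<noteq> 0"
  shows "\<exists>(T :: 'b set) c g. finite T \<and> (\<forall>t\<in>T. (\<forall>x\<in>J. x * c t \<in> \<O>) \<and> g t \<in> J) \<and> (\<Sum>t\<in>T. c t * g t) = 1"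
proof -
  have "projective_module (\<lambda>r x. r * x) \<O> J" using hereditary J by (auto simp: hereditary_order_def)
  then obtain X s p where P:
     "(\<forall>x\<in>J. s x \<in> free_module \<O> X) \<and>
      (\<forall>x\<in>J. \<forall>y\<in>J. s (x + y) = (\<lambda>t. s x t + s y t)) \<and>
      (\<forall>r\<in>\<O>. \<forall>x\<in>J. s (r * x) = (\<lambda>t. r * s x t)) \<and>
      (\<forall>c\<in>free_module \<O> X. p c \<in> J) \<and>
      (\<forall>c\<in>free_module \<O> X. \<forall>d\<in>free_module \<O> X. p (\<lambda>t. c t + d t) = p c + p d) \<and>
      (\<forall>r\<in>\<O>. \<forall>c\<in>free_module \<O> X. p (\<lambda>t. r * c t) = r * p c) \<and>
      (\<forall>x\<in>J. p (s x) = x)"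
    unfolding projective_module_def by (elim exE)
  then have s: "\<And>x. x \<in> J \<Longrightarrow> s x \<in> free_module \<O> X"
    and s_act: "\<And>r x. r \<in> \<O> \<Longrightarrow> x \<in> J \<Longrightarrow> s (r * x) = (\<lambda>t. r * s x t)"
    and p: "\<And>c. c \<in> free_module \<O> X \<Longrightarrow> p c \<in> J"
    and p_add: "\<And>c d. c \<in> free_module \<O> X \<Longrightarrow> d \<in> free_module \<O> X \<Longrightarrow> p (\<lambda>t. c t + d t) = p c + p d"
    and p_act: "\<And>r c. r \<in> \<O> \<Longrightarrow> c \<in> free_module \<O> X \<Longrightarrow> p (\<lambda>t. r * c t) = r * p c"
    and ps: "\<And>x. x \<in> J \<Longrightarrow> p (s x) = x"
    by blast+
  \<comment> \<open>If the coordinate function \<open>t\<close> of \<open>s\<close> is right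
    multiplication by some element, its value at \<open>y0\<close> determines that element.\<close>
  define c where "c t = inverse y0 * s y0 t" for t
  \<comment> \<open>The quotient \<open>x * inverse y0\<close> need not lie in \<O>, but an integer
    multiple does, and \<open>s\<close> is linear over it; the integer is cancelled
    afterwards.\<close>
  have sx: "s x t = x * c t" if x: "x \<in> J" for x t
  proof -
    obtain m :: int where m: "m > 0" "of_int m * (x * inverse y0) \<in> \<O>"
      using lattice_multiple[OF lattice_\<O>] by blast
    have "of_int m * (x * inverse y0) * y0 = of_int m * x" using y0 by (simp add: mult.assoc)
    then have "s (of_int m * x) t = of_int m * (x * inverse y0) * s y0 t"
      using s_act[OF m(2) y0(1)] by simp
    moreover have "s (of_int m * x) t = of_int m * s x t" using s_act[OF \<O>_of_int x] by simp
    ultimately have "of_int m * s x t = of_int m * (x * c t)" by (simp add: c_def mult.assoc)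
    then show ?thesis using of_int_nonzero[of m] m(1) by simp
  qed
  define e where "e t = (\<lambda>u. if u = t then 1 else 0 :: 'b)" for t :: 'b
  have \<O>0: "0 \<in> \<O>" using subgroup_\<O> by (rule add_subgroup_0)
  have e: "e t \<in> free_module \<O> X" if "t \<in> X" for t
    using that \<O>0 \<O>_1 by (auto simp: free_module_def e_def)
  define T where "T = {t. s y0 t \<noteq> 0}"
  have T: "finite T" "T \<subseteq> X" using s[OF y0(1)] by (auto simp: free_module_def T_def)
  have zero: "(\<lambda>u. 0) \<in> free_module \<O> X" using \<O>0 by (auto simp: free_module_def)
  have p0: "p (\<lambda>u. 0) = 0" using p_add[OF zero zero] by simp
  have sum: "(\<lambda>u. if u \<in> A then d u else 0) \<in> free_module \<O> X \<and> p (\<lambda>u. if u \<in> A then d u else 0) = (\<Sum>t\<in>A. d t * p (e t))"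
    if "finite A" "A \<subseteq> X" "\<And>t. d t \<in> \<O>" for A d
    using that
  proof (induction A rule: finite_induct)
    case empty
    then show ?case using zero p0 by simp
  next
    case (insert a A)
    then have IH: "(\<lambda>u. if u \<in> A then d u else 0) \<in> free_module \<O> X" "p (\<lambda>u. if u \<in> A then d u else 0) = (\<Sum>t\<in>A. d t * p (e t))"
      by auto
    have ea: "e a \<in> free_module \<O> X" using insert.prems by (intro e) auto
    have da: "(\<lambda>u. d a * e a u) \<in> free_module \<O> X"
      using insert.prems \<O>0 by (auto simp: free_module_def e_def)
    have eq: "(\<lambda>u. if u \<in> insert a A then d u else 0) = (\<lambda>u. d a * e a u + (if u \<in> A then d u else 0))"
      using insert.hyps by (auto simp: e_def fun_eq_iff)
    have "(\<lambda>u. if u \<in> insert a A then d u else 0) \<in> free_module \<O> X"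
      using insert.prems insert.hyps \<O>0 by (auto simp: free_module_def)
    moreover have "p (\<lambda>u. if u \<in> insert a A then d u else 0) = d a * p (e a) + (\<Sum>t\<in>A. d t * p (e t))"
      unfolding eq p_add[OF da IH(1)] IH(2) using p_act[OF insert.prems(2) ea] by simp
    ultimately show ?case using insert.hyps by simp
  qed
  have "s y0 t \<in> \<O>" for t using s[OF y0(1)] by (auto simp: free_module_def)
  from sum[OF T, of "s y0", OF this] have "p (\<lambda>u. if u \<in> T then s y0 u else 0) = (\<Sum>t\<in>T. s y0 t * p (e t))" by blast
  moreover have "(\<lambda>u. if u \<in> T then s y0 u else 0) = s y0" by (auto simp: T_def)
  ultimately have "y0 = (\<Sum>t\<in>T. y0 * (c t * p (e t)))"
    using ps[OF y0(1)] by (simp add: sx[OF y0(1)] mult.assoc)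
  then have "y0 * 1 = y0 * (\<Sum>t\<in>T. c t * p (e t))" by (simp add: sum_distrib_left)
  then have "(\<Sum>t\<in>T. c t * p (e t)) = 1" using y0 by simp
  moreover have "x * c t \<in> \<O>" if x: "x \<in> J" for x t
    unfolding sx[OF x, symmetric] using s[OF x] by (simp add: free_module_def)
  moreover have "p (e t) \<in> J" if "t \<in> T" for t using that T by (intro p e) auto
  ultimately show ?thesis
    using T(1) by (intro exI[of _ T] exI[of _ c] exI[of _ "\<lambda>t. p (e t)"] conjI ballI)
qed

section \<open>Invertibility of I\<close>

text \<open>The dual module Hom(I, \<O>), realised by right multiplications; it will be the inverse
  of \<open>I\<close> on both sides.\<close>

definition Iinv :: "'b set" where "Iinv = {a. \<forall>y\<in>I. y * a \<in> \<O>}"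

text \<open>This says 1 lies in \<open>Iinv\<close> times \<open>I\<close>. Heredity concerns ideals
  inside \<O>, so \<open>I\<close> is scaled by an integer \<open>m\<close> into \<O>, and the
  factor \<open>m\<close> is then moved from the elements \<open>g\<close> to the functionals
  \<open>c\<close>.\<close>

lemma I_dual_basis:
  "\<exists>(T :: 'b set) c g. finite T \<and> (\<forall>t\<in>T. c t \<in> Iinv \<and> g t \<in> I) \<and> (\<Sum>t\<in>T. c t * g t) = 1"
proof -
  obtain S where S: "finite S" "I = zspan S" using finitely_generated by blast
  obtain m :: int where m: "m > 0" "\<And>x. x \<in> S \<Longrightarrow> of_int m * x \<in> \<O>"
    using lattice_common_multiple[OF lattice_\<O> S(1)] by blast
  have mI: "of_int m * x \<in> \<O>" if "x \<in> I" for x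
    by (rule zspan_additive_image[of "\<lambda>x. of_int m * x" x S])
       (use that S m subgroup_\<O> in \<open>auto simp: right_diff_distrib\<close>)
  define J where "J = {of_int m * x | x. x \<in> I}"
  have J: "one_sided_ideal (\<lambda>r x. r * x) \<O> J"
    unfolding one_sided_ideal_def
  proof (intro conjI ballI)
    show "J \<subseteq> \<O>" using mI by (auto simp: J_def)
    show "0 \<in> J" using add_subgroup_0[OF subgroup_I] by (auto simp: J_def intro!: exI[of _ 0])
  next
    fix x y assume "x \<in> J" "y \<in> J"
    then obtain x' y' where "x = of_int m * x'" "y = of_int m * y'" "x' \<in> I" "y' \<in> I" by (auto simp: J_def)
    then show "x - y \<in> J"
      unfolding J_def by (intro CollectI exI[of _ "x' - y'"]) (auto simp: right_diff_distrib intro: add_subgroup_diff[OF subgroup_I])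
  next
    fix r x assume "r \<in> \<O>" "x \<in> J"
    then obtain x' where x': "x = of_int m * x'" "x' \<in> I" by (auto simp: J_def)
    have "r * x = of_int m * (r * x')"
      unfolding x'(1) by (rule of_int_left)
    then show "r * x \<in> J" unfolding J_def using I_left[OF \<open>r \<in> \<O>\<close> x'(2)] by blast
  qed
  obtain x where x: "x \<in> I" "x \<noteq> 0" using I_nonzero by blast
  have "of_int m * x \<in> J" "of_int m * x \<noteq> 0" using x m(1) of_int_nonzero[of m] by (auto simp: J_def)
  from projective_dual_basis[OF J this] obtain T :: "'b set" and c g where
    T: "finite T" "\<And>t x. t \<in> T \<Longrightarrow> x \<in> J \<Longrightarrow> x * c t \<in> \<O>" "\<And>t. t \<in> T \<Longrightarrow> g t \<in> J" "(\<Sum>t\<in>T. c t * g t) = 1"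
    by blast
  have "\<forall>t\<in>T. \<exists>h. g t = of_int m * h \<and> h \<in> I" using T(3) unfolding J_def by blast
  then obtain h where h: "\<And>t. t \<in> T \<Longrightarrow> g t = of_int m * h t" "\<And>t. t \<in> T \<Longrightarrow> h t \<in> I"
    using bchoice[of T "\<lambda>t h. g t = of_int m * h \<and> h \<in> I"] by blast
  have "(\<Sum>t\<in>T. of_int m * c t * h t) = (\<Sum>t\<in>T. c t * g t)"
  proof (rule sum.cong[OF refl])
    fix t assume "t \<in> T"
    then show "of_int m * c t * h t = c t * g t"
      by (simp only: h(1) mult.assoc of_int_left)
  qed
  moreover have "of_int m * c t \<in> Iinv" if t: "t \<in> T" for t
  proof -
    have "y * (of_int m * c t) \<in> \<O>" if "y \<in> I" for y
    proof -
      have "y * (of_int m * c t) = of_int m * y * c t"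
        by (simp only: mult.assoc of_int_left)
      then show ?thesis using T(2)[OF t, of "of_int m * y"] that by (auto simp: J_def)
    qed
    then show ?thesis by (simp add: Iinv_def)
  qed
  ultimately show ?thesis using T(1,4) h(2) by (intro exI[of _ T] exI[of _ "\<lambda>t. of_int m * c t"] exI[of _ h]) auto
qed

lemma Iinv_right: "a \<in> Iinv \<Longrightarrow> r \<in> \<O> \<Longrightarrow> a * r \<in> Iinv"
  by (auto simp: Iinv_def mult.assoc[symmetric] intro: \<O>_mult)

text \<open>Let \<open>T\<close> be the two-sided ideal generated by \<open>I Iinv\<close>. As \<open>T I = I\<close>, every \<open>d\<close> with \<open>d T \<subseteq> \<O>\<close>
  satisfies \<open>d I \<subseteq> I\<close> and so lies in the left order \<open>\<O>\<close>; projectivity of the conjugate of \<open>T\<close> then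
  gives \<open>1 \<in> T \<O>\<close>.\<close>

lemma unit_in_I_Iinv: "1 \<in> zspan {x * a | x a. x \<in> I \<and> a \<in> Iinv}" (is "1 \<in> ?T")
proof -
  have T_\<O>: "w \<in> \<O>" if "w \<in> ?T" for w
    using zspan_minimal[OF _ subgroup_\<O>, of "{x * a | x a. x \<in> I \<and> a \<in> Iinv}"] that by (auto simp: Iinv_def)
  have T_right: "w * r \<in> ?T" if "w \<in> ?T" "r \<in> \<O>" for w r
  proof (rule zspan_additive_image[of "\<lambda>w. w * r", OF _ that(1)])
    fix s assume "s \<in> {x * a | x a. x \<in> I \<and> a \<in> Iinv}"
    then obtain x a where "s = x * a" "x \<in> I" "a \<in> Iinv" by blast
    then have "s * r = x * (a * r)" "x \<in> I" "a * r \<in> Iinv" using that(2) Iinv_right by (auto simp: mult.assoc)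
    then show "s * r \<in> ?T" by (intro zspan_base) blast
  qed (auto simp: left_diff_distrib)
  \<comment> \<open>Conjugation exchanges sides: a dual basis relation of \<open>J\<close>, with
    functionals on the left, becomes one with the elements of \<open>?T\<close> on the left.\<close>
  define J where "J = cj ` ?T"
  have J: "one_sided_ideal (\<lambda>r x. r * x) \<O> J"
    unfolding one_sided_ideal_def
  proof (intro conjI ballI)
    show "J \<subseteq> \<O>" using T_\<O> cj_\<O> by (auto simp: J_def)
    show "0 \<in> J" unfolding J_def by (rule image_eqI[OF _ zspan_0]) simp
  next
    fix x y assume "x \<in> J" "y \<in> J"
    then obtain x' y' where "x = cj x'" "y = cj y'" "x' \<in> ?T" "y' \<in> ?T" unfolding J_def by blast
    then show "x - y \<in> J" unfolding J_def by (intro image_eqI[of _ _ "x' - y'"] zspan_diff) (simp_all add: cj_diff)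
  next
    fix r x assume r: "r \<in> \<O>" "x \<in> J"
    then obtain x' where x': "x = cj x'" "x' \<in> ?T" unfolding J_def by blast
    have "r * x = cj (x' * cj r)" by (simp add: x' cj_mult)
    then show "r * x \<in> J" unfolding J_def using T_right[OF x'(2) cj_\<O>[OF r(1)]] by blast
  qed
  obtain T1 :: "'b set" and c' g' where T1: "finite T1" "\<And>t. t \<in> T1 \<Longrightarrow> c' t \<in> Iinv" "\<And>t. t \<in> T1 \<Longrightarrow> g' t \<in> I" "(\<Sum>t\<in>T1. c' t * g' t) = 1"
    using I_dual_basis by blast
  have "\<exists>t\<in>T1. c' t \<noteq> 0"
  proof (rule ccontr)
    assume "\<not> (\<exists>t\<in>T1. c' t \<noteq> 0)"
    then have "(\<Sum>t\<in>T1. c' t * g' t) = 0" by (intro sum.neutral) auto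
    then show False using T1(4) by simp
  qed
  then obtain t where t: "t \<in> T1" "c' t \<noteq> 0" by blast
  obtain x where x: "x \<in> I" "x \<noteq> 0" using I_nonzero by blast
  have "x * c' t \<in> ?T" using x t T1(2) by (intro zspan_base) blast
  then have mem: "cj (x * c' t) \<in> J" unfolding J_def by (rule imageI)
  have nonzero: "cj (x * c' t) \<noteq> 0"
  proof
    assume "cj (x * c' t) = 0"
    then have "cj (cj (x * c' t)) = cj 0" by (rule arg_cong)
    then show False using x t by simp
  qed
  from projective_dual_basis[OF J mem nonzero] obtain T :: "'b set" and c g where
    T: "finite T" "\<And>t x. t \<in> T \<Longrightarrow> x \<in> J \<Longrightarrow> x * c t \<in> \<O>" "\<And>t. t \<in> T \<Longrightarrow> g t \<in> J" "(\<Sum>t\<in>T. c t * g t) = 1"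
    by blast
  have d: "cj (c t) \<in> \<O>" if t: "t \<in> T" for t
  proof (rule left_order)
    fix x assume x: "x \<in> I"
    have dw: "cj (c t) * w \<in> \<O>" if "w \<in> ?T" for w
    proof -
      have "cj (cj w * c t) \<in> \<O>" using that by (intro cj_\<O> T(2)[OF t]) (auto simp: J_def)
      then show ?thesis by (simp add: cj_mult)
    qed
    \<comment> \<open>Inserting the dual basis relation of \<open>I\<close> writes \<open>x\<close>
      as a sum of elements of \<open>?T\<close> times elements of \<open>I\<close>.\<close>
    have "cj (c t) * x = cj (c t) * x * (\<Sum>s\<in>T1. c' s * g' s)" by (simp add: T1)
    also have "\<dots> = (\<Sum>s\<in>T1. cj (c t) * (x * c' s) * g' s)" by (simp add: sum_distrib_left mult.assoc)
    also have "\<dots> \<in> I"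
      by (intro add_subgroup_sum[OF subgroup_I] I_left dw zspan_base) (use x T1 in auto)
    finally show "cj (c t) * x \<in> I" .
  qed
  have "1 = cj (\<Sum>t\<in>T. c t * g t)" by (simp add: T)
  also have "\<dots> = (\<Sum>t\<in>T. cj (g t) * cj (c t))" by (simp add: cj_sum cj_mult)
  also have "\<dots> \<in> ?T"
  proof (intro zspan_sum T_right d)
    fix t assume "t \<in> T"
    then obtain w where "g t = cj w" "w \<in> ?T" using T(3) unfolding J_def by blast
    then show "cj (g t) \<in> ?T" by simp
  qed
  finally show ?thesis .
qed

section \<open>Alternating words modulo the norm ideal\<close>

text \<open>Products in which every second letter is conjugated; the flag tells whether the first
  letter is plain, so that recursion can flip it.\<close>

fun word :: "bool \<Rightarrow> 'b list \<Rightarrow> 'b" where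
  "word b [] = 1"
| "word b (x # xs) = (if b then x else cj x) * word (\<not> b) xs"

lemma word_append: "word b (xs @ ys) = word b xs * word (if even (length xs) then b else \<not> b) ys"
  by (induction xs arbitrary: b) (auto simp: mult.assoc)

text \<open>Both orders of \<open>x\<close> and \<open>cj x\<close> give the reduced norm, which is
  central, so the pair may be pulled out of any position.\<close>

lemma word_double: "word b (us @ x # x # ws) = \<iota> (nrd \<iota> x) * word b (us @ ws)"
proof (induction us arbitrary: b)
  case Nil
  show ?case by (cases b) (simp_all add: \<iota>_nrd cj_commute mult.assoc[symmetric])
next
  case (Cons u us)
  then show ?case by (simp add: central_left)
qed

text \<open>The polarised form of \<open>word_double\<close>.\<close>

lemma word_swap:
  "word b (us @ x # y # ws) + word b (us @ y # x # ws) =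
    \<iota> (nrd \<iota> (x + y) - nrd \<iota> x - nrd \<iota> y) * word b (us @ ws)"
proof (induction us arbitrary: b)
  case Nil
  have 1: "\<iota> (nrd \<iota> (x + y) - nrd \<iota> x - nrd \<iota> y) = x * cj y + y * cj x"
    by (simp add: \<iota>_simps(6) \<iota>_nrd cj_add distrib_left distrib_right)
  have 2: "\<iota> (nrd \<iota> (x + y) - nrd \<iota> x - nrd \<iota> y) = cj x * y + cj y * x"
    unfolding \<iota>_simps(6) \<iota>_nrd cj_commute[symmetric] by (simp add: cj_add distrib_left distrib_right)
  show ?case
  proof (cases b)
    case True
    then show ?thesis unfolding 1 by (simp add: distrib_right mult.assoc)
  next
    case False
    then show ?thesis unfolding 2 by (simp add: distrib_right mult.assoc)
  qed
next
  case (Cons u us)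
  have "word b ((u # us) @ x # y # ws) + word b ((u # us) @ y # x # ws) =
      (if b then u else cj u) * (word (\<not> b) (us @ x # y # ws) + word (\<not> b) (us @ y # x # ws))"
    by (simp add: distrib_left)
  then show ?case unfolding Cons.IH by (simp add: central_left)
qed

lemma norm_ideal_nrd: "x \<in> I \<Longrightarrow> nrd \<iota> x \<in> norm_ideal \<iota> I"
  unfolding norm_ideal_def using ring_of_integers_1 by (intro int_span_base) force

lemma norm_ideal_subgroup: "add_subgroup (norm_ideal \<iota> I)"
  by (simp add: norm_ideal_def)

lemma norm_ideal_mult:
  assumes "r \<in> ring_of_integers" "a \<in> norm_ideal \<iota> I"
  shows "r * a \<in> norm_ideal \<iota> I"
proof (rule int_span_additive_image[of "\<lambda>a. r * a", OF _ assms(2)[unfolded norm_ideal_def] norm_ideal_subgroup])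
  fix s assume "s \<in> {r * nrd \<iota> x | r x. r \<in> ring_of_integers \<and> x \<in> I}"
  then obtain q x where s: "s = q * nrd \<iota> x" "q \<in> ring_of_integers" "x \<in> I" by blast
  have "r * s = (r * q) * nrd \<iota> x" "r * q \<in> ring_of_integers"
    using s(1) ring_of_integers_mult[OF assms(1) s(2)] by (auto simp: mult.assoc)
  then show "r * s \<in> norm_ideal \<iota> I" unfolding norm_ideal_def using s(3) by (intro int_span_base) blast
qed (simp add: right_diff_distrib)

lemma norm_ideal_polar: "x \<in> I \<Longrightarrow> y \<in> I \<Longrightarrow> nrd \<iota> (x + y) - nrd \<iota> x - nrd \<iota> y \<in> norm_ideal \<iota> I"
  by (intro add_subgroup_diff[OF norm_ideal_subgroup] norm_ideal_nrd add_subgroup_add[OF subgroup_I])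

definition norm_words :: "bool \<Rightarrow> nat \<Rightarrow> 'b set" where
  "norm_words b n = zspan {\<iota> a * word b ys | a ys. a \<in> norm_ideal \<iota> I \<and> length ys = n \<and> set ys \<subseteq> I}"

lemma norm_words_base:
  "a \<in> norm_ideal \<iota> I \<Longrightarrow> length ys = n \<Longrightarrow> set ys \<subseteq> I \<Longrightarrow> \<iota> a * word b ys \<in> norm_words b n"
  unfolding norm_words_def by (intro zspan_base) blast

text \<open>The first copy of \<open>x\<close> is moved towards the second by exchanges of
  neighbours; each costs a sign and a shorter word with coefficient in the norm ideal, and two
  adjacent copies contribute a reduced norm.\<close>

lemma word_repetition:
  assumes "set (us @ x # vs @ x # ws) \<subseteq> I"
  shows "word b (us @ x # vs @ x # ws) \<in> norm_words b (length us + length vs + length ws)"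
  using assms
proof (induction vs arbitrary: us)
  case Nil
  then have "\<iota> (nrd \<iota> x) * word b (us @ ws) \<in> norm_words b (length us + length ws)"
    by (intro norm_words_base norm_ideal_nrd) auto
  then show ?case using word_double[of b us x ws] by simp
next
  case (Cons y vs)
  have "word b ((us @ [y]) @ x # vs @ x # ws) \<in> norm_words b (length (us @ [y]) + length vs + length ws)"
    using Cons.prems by (intro Cons.IH) auto
  then have 1: "word b (us @ y # x # vs @ x # ws) \<in> norm_words b (length us + length (y # vs) + length ws)"
    by simp
  have 2: "\<iota> (nrd \<iota> (x + y) - nrd \<iota> x - nrd \<iota> y) * word b (us @ vs @ x # ws)
      \<in> norm_words b (length us + length (y # vs) + length ws)"
    using Cons.prems by (intro norm_words_base norm_ideal_polar) auto
  have "word b (us @ x # y # vs @ x # ws) =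
      \<iota> (nrd \<iota> (x + y) - nrd \<iota> x - nrd \<iota> y) * word b (us @ vs @ x # ws) - word b (us @ y # x # vs @ x # ws)"
    using word_swap[of b us x y "vs @ x # ws"] by (simp add: eq_diff_eq)
  also have "\<dots> \<in> norm_words b (length us + length (y # vs) + length ws)"
    using 1 2 unfolding norm_words_def by (intro zspan_diff)
  finally show ?case by simp
qed

text \<open>Words are additive in each letter and scalars from the ring of integers are central, so
  letters may be taken from the finite set \<open>S\<close>, where the pigeonhole principle
  applies.\<close>

lemma word_generators:
  assumes S: "I = int_span {\<iota> r * x | r x. r \<in> ring_of_integers \<and> x \<in> S}" and xs: "set xs \<subseteq> I"
  shows "word b xs \<in> zspan {\<iota> r * word b ys | r ys. r \<in> ring_of_integers \<and> length ys = length xs \<and> set ys \<subseteq> S}"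
  using xs
proof (induction xs arbitrary: b)
  case Nil
  then show ?case using ring_of_integers_1 by (intro zspan_base) (auto simp: \<iota>_simps intro!: exI[of _ 1])
next
  case (Cons x xs)
  define f where "f x = (if b then x else cj x)" for x
  let ?Z = "zspan {\<iota> r * word b ys | r ys. r \<in> ring_of_integers \<and> length ys = length (x # xs) \<and> set ys \<subseteq> S}"
  have f_diff: "f (x - y) = f x - f y" for x y by (simp add: f_def cj_diff)
  have f_scale: "f (\<iota> r * x) = \<iota> r * f x" for r x
    by (simp add: f_def cj_mult central)
  have IH: "word (\<not> b) xs \<in> zspan {\<iota> r * word (\<not> b) ys | r ys. r \<in> ring_of_integers \<and> length ys = length xs \<and> set ys \<subseteq> S}"
    using Cons by auto
  have 1: "f (\<iota> r * s) * word (\<not> b) xs \<in> ?Z" if r: "r \<in> ring_of_integers" "s \<in> S" for r s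
  proof (rule zspan_additive_image[of "\<lambda>w. f (\<iota> r * s) * w", OF _ IH])
    fix w assume "w \<in> {\<iota> r * word (\<not> b) ys | r ys. r \<in> ring_of_integers \<and> length ys = length xs \<and> set ys \<subseteq> S}"
    then obtain q ys where w: "w = \<iota> q * word (\<not> b) ys" "q \<in> ring_of_integers" "length ys = length xs" "set ys \<subseteq> S"
      by blast
    have "f (\<iota> r * s) * w = \<iota> r * (f s * (\<iota> q * word (\<not> b) ys))"
      unfolding w(1) f_scale by (simp only: mult.assoc)
    also have "\<dots> = \<iota> (r * q) * word b (s # ys)"
      unfolding central_left[of "f s"] by (simp add: f_def \<iota>_simps(3) mult.assoc)
    finally have "f (\<iota> r * s) * w = \<iota> (r * q) * word b (s # ys)" .
    then show "f (\<iota> r * s) * w \<in> ?Z"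
      using w r ring_of_integers_mult[OF r(1) w(2)]
      by (intro zspan_base CollectI exI[of _ "r * q"] exI[of _ "s # ys"]) auto
  qed (auto simp: right_diff_distrib)
  have "f x * word (\<not> b) xs \<in> ?Z"
  proof (rule int_span_additive_image[of "\<lambda>x. f x * word (\<not> b) xs"])
    show "x \<in> int_span {\<iota> r * x | r x. r \<in> ring_of_integers \<and> x \<in> S}" using Cons.prems S by auto
  qed (use 1 in \<open>auto simp: f_diff left_diff_distrib\<close>)
  then show ?case by (simp add: f_def)
qed

text \<open>A word in the generators longer than \<open>card S\<close> repeats a letter. The length
  drops by 2 because two letters are absorbed by the coefficient in the norm ideal.\<close>

lemma long_word:
  "\<exists>N. \<forall>xs b. set xs \<subseteq> I \<longrightarrow> length xs > N \<longrightarrow> word b xs \<in> norm_words b (length xs - 2)"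
proof -
  obtain S where S: "finite S" "I = int_span {\<iota> r * x | r x. r \<in> ring_of_integers \<and> x \<in> S}"
    using lattice_I unfolding lattice_in_def by blast
  have SI: "s \<in> I" if "s \<in> S" for s
  proof -
    have "\<iota> 1 * s \<in> I" unfolding S(2) using that ring_of_integers_1 by (intro int_span_base) blast
    then show ?thesis by (simp add: \<iota>_simps)
  qed
  have "word b xs \<in> norm_words b (length xs - 2)" if xs: "set xs \<subseteq> I" "length xs > card S" for xs b
  proof (rule subsetD[OF _ word_generators[OF S(2) xs(1)]], rule zspan_minimal)
    show "add_subgroup (norm_words b (length xs - 2))" by (simp add: norm_words_def)
    show "{\<iota> r * word b ys | r ys. r \<in> ring_of_integers \<and> length ys = length xs \<and> set ys \<subseteq> S}
        \<subseteq> norm_words b (length xs - 2)"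
    proof clarify
      fix r :: 'f and ys assume ys: "r \<in> ring_of_integers" "length ys = length xs" "set ys \<subseteq> S"
      have "\<not> distinct ys"
        using distinct_card[of ys] card_mono[OF S(1) ys(3)] ys(2) xs(2) by auto
      then obtain us x vs ws where d: "ys = us @ [x] @ vs @ [x] @ ws" using not_distinct_decomp by blast
      have "word b (us @ x # vs @ x # ws) \<in> norm_words b (length us + length vs + length ws)"
        by (rule word_repetition) (use ys(3) d SI in auto)
      moreover have "length us + length vs + length ws = length xs - 2" using ys(2) d by simp
      ultimately have w: "word b ys \<in> norm_words b (length xs - 2)" using d by simp
      show "\<iota> r * word b ys \<in> norm_words b (length xs - 2)"
      proof (rule zspan_additive_image[of "\<lambda>w. \<iota> r * w", OF _ w[unfolded norm_words_def]])
        fix s assume "s \<in> {\<iota> a * word b ys | a ys. a \<in> norm_ideal \<iota> I \<and> length ys = length xs - 2 \<and> set ys \<subseteq> I}"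
        then obtain a zs where s: "s = \<iota> a * word b zs" "a \<in> norm_ideal \<iota> I" "length zs = length xs - 2" "set zs \<subseteq> I"
          by blast
        have "\<iota> r * s = \<iota> (r * a) * word b zs" by (simp add: s(1) \<iota>_simps(3) mult.assoc)
        then show "\<iota> r * s \<in> norm_words b (length xs - 2)"
          using norm_words_base[OF norm_ideal_mult[OF ys(1) s(2)] s(3,4)] by simp
      qed (auto simp: right_diff_distrib norm_words_def)
    qed
  qed
  then show ?thesis by blast
qed

text \<open>\<open>word_module m\<close> is the \<open>m\<close>-th power of \<open>I I\<^sup>*\<close>, with \<open>\<O>\<close> for \<open>m = 0\<close>.\<close>

definition word_module :: "nat \<Rightarrow> 'b set" where
  "word_module m = zspan {r * word True xs | r xs. r \<in> \<O> \<and> length xs = 2 * m \<and> set xs \<subseteq> I}"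

definition norm_multiple :: "'b set \<Rightarrow> 'b set" where
  "norm_multiple X = zspan {\<iota> a * x | a x. a \<in> norm_ideal \<iota> I \<and> x \<in> X}"

lemma word_module_base:
  "r \<in> \<O> \<Longrightarrow> length xs = 2 * m \<Longrightarrow> set xs \<subseteq> I \<Longrightarrow> r * word True xs \<in> word_module m"
  unfolding word_module_def by (intro zspan_base) blast

lemma word_module_map:
  assumes "z \<in> word_module m" "add_subgroup T" "\<And>x y. f (x - y) = f x - f y"
    "\<And>r xs. r \<in> \<O> \<Longrightarrow> length xs = 2 * m \<Longrightarrow> set xs \<subseteq> I \<Longrightarrow> f (r * word True xs) \<in> T"
  shows "f z \<in> T"
  by (rule zspan_additive_image[OF assms(3) assms(1)[unfolded word_module_def] assms(2)]) (use assms(4) in blast)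

lemma norm_multiple_map:
  assumes "z \<in> norm_multiple X" "\<And>x. x \<in> X \<Longrightarrow> x * k \<in> Y"
  shows "z * k \<in> norm_multiple Y"
  unfolding norm_multiple_def
proof (rule zspan_additive_image[of "\<lambda>z. z * k", OF _ assms(1)[unfolded norm_multiple_def]])
  fix s assume "s \<in> {\<iota> a * x | a x. a \<in> norm_ideal \<iota> I \<and> x \<in> X}"
  then obtain a x where "s = \<iota> a * x" "a \<in> norm_ideal \<iota> I" "x \<in> X" by blast
  then have "s * k = \<iota> a * (x * k)" "a \<in> norm_ideal \<iota> I" "x * k \<in> Y" using assms(2) by (auto simp: mult.assoc)
  then show "s * k \<in> zspan {\<iota> a * x | a x. a \<in> norm_ideal \<iota> I \<and> x \<in> Y}" by (intro zspan_base) blast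
qed (auto simp: left_diff_distrib)

lemma word_module_step:
  assumes "z \<in> word_module m" "x \<in> I" "y \<in> I"
  shows "z * (x * cj y) \<in> word_module (Suc m)"
proof (rule word_module_map[OF assms(1), of _ "\<lambda>z. z * (x * cj y)"])
  fix r xs assume *: "r \<in> \<O>" "length xs = 2 * m" "set xs \<subseteq> I"
  have "r * word True xs * (x * cj y) = r * word True (xs @ [x, y])"
    using *(2) by (simp add: word_append mult.assoc)
  then show "r * word True xs * (x * cj y) \<in> word_module (Suc m)"
    using word_module_base[of r "xs @ [x, y]" "Suc m"] * assms by simp
qed (auto simp: left_diff_distrib word_module_def)

lemma even_list_snoc2:
  assumes "length xs = 2 * Suc m"
  obtains ys x y where "xs = ys @ [x, y]" "length ys = 2 * m"
proof -
  obtain zs y where "xs = zs @ [y]" using assms by (cases xs rule: rev_cases) auto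
  moreover from this obtain ys x where "zs = ys @ [x]" using assms by (cases zs rule: rev_cases) auto
  ultimately show thesis using assms that[of ys x y] by simp
qed

text \<open>The last letter of a word is conjugated, so a right factor \<open>q\<close> is absorbed
  by replacing \<open>y\<close> with \<open>cj q * y\<close>, which stays in the left ideal
  \<open>I\<close>.\<close>

lemma word_module_right:
  assumes "z \<in> word_module m" "q \<in> \<O>"
  shows "z * q \<in> word_module m"
proof (rule word_module_map[OF assms(1), of _ "\<lambda>z. z * q"])
  fix r xs assume *: "r \<in> \<O>" "length xs = 2 * m" "set xs \<subseteq> I"
  show "r * word True xs * q \<in> word_module m"
  proof (cases m)
    case 0
    then show ?thesis using * word_module_base[of "r * q" "[]" 0] \<O>_mult[OF *(1) assms(2)] by simp
  next
    case (Suc m')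
    have "length xs = 2 * Suc m'" using * Suc by simp
    then obtain ys x y where ys: "xs = ys @ [x, y]" "length ys = 2 * m'" by (rule even_list_snoc2)
    have "r * word True xs * q = r * word True (ys @ [x, cj q * y])"
      using ys by (simp add: word_append mult.assoc cj_mult)
    moreover have "cj q * y \<in> I" using * ys by (intro I_left cj_\<O> assms(2)) auto
    ultimately show ?thesis
      using word_module_base[of r "ys @ [x, cj q * y]" m] * ys Suc by simp
  qed
qed (auto simp: left_diff_distrib word_module_def)

text \<open>The elements \<open>cj c * a\<close> act as elements of the inverse of K: in
  \<open>x * cj y * cj c * a\<close> the product \<open>c * y\<close> lies in the right order of
  \<open>I\<close>, hence \<open>x * cj (c * y)\<close> is in \<open>I\<close>, and \<open>a\<close>
  carries it into \<O>.\<close>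

lemma word_module_cancel:
  assumes "z \<in> word_module (Suc m)" "c \<in> Iinv" "a \<in> Iinv"
  shows "z * (cj c * a) \<in> word_module m"
proof (rule word_module_map[OF assms(1), of _ "\<lambda>z. z * (cj c * a)"])
  fix r xs assume *: "r \<in> \<O>" "length xs = 2 * Suc m" "set xs \<subseteq> I"
  obtain ys x y where ys: "xs = ys @ [x, y]" "length ys = 2 * m" using even_list_snoc2[OF *(2)] by blast
  then have xy: "x \<in> I" "y \<in> I" "set ys \<subseteq> I" using * by auto
  have "x * cj (c * y) \<in> I"
  proof (rule cj_right_order[OF _ xy(1)])
    fix u assume "u \<in> I"
    then have "u * c \<in> \<O>" using assms(2) by (auto simp: Iinv_def)
    then show "u * (c * y) \<in> I" using I_left[OF _ xy(2)] by (simp add: mult.assoc[symmetric])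
  qed
  then have q: "x * cj (c * y) * a \<in> \<O>" using assms(3) by (auto simp: Iinv_def)
  have "r * word True xs * (cj c * a) = r * word True ys * (x * cj (c * y) * a)"
    using ys by (simp add: word_append mult.assoc cj_mult)
  then show "r * word True xs * (cj c * a) \<in> word_module m"
    using word_module_right[OF word_module_base[OF *(1) ys(2) xy(3)] q] by simp
qed (auto simp: left_diff_distrib word_module_def)

text \<open>Write 1 as a sum of \<open>x * a\<close> and insert the conjugated dual basis relation
  between the two factors. This gives 1 as a sum of \<open>x * cj g\<close> from K times
  \<open>cj c * a\<close> from its inverse, so one factor K can be cancelled.\<close>

lemma word_module_descend:
  assumes "word_module (Suc (Suc m)) \<subseteq> norm_multiple (word_module (Suc m))"
  shows "word_module (Suc m) \<subseteq> norm_multiple (word_module m)"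
proof
  fix z assume z: "z \<in> word_module (Suc m)"
  obtain T :: "'b set" and c g where T: "finite T" "\<And>t. t \<in> T \<Longrightarrow> c t \<in> Iinv" "\<And>t. t \<in> T \<Longrightarrow> g t \<in> I" "(\<Sum>t\<in>T. c t * g t) = 1"
    using I_dual_basis by blast
  have "z * 1 \<in> norm_multiple (word_module m)"
  proof (rule zspan_additive_image[of "\<lambda>w. z * w", OF _ unit_in_I_Iinv])
    fix s assume "s \<in> {x * a | x a. x \<in> I \<and> a \<in> Iinv}"
    then obtain x a where s: "s = x * a" "x \<in> I" "a \<in> Iinv" by blast
    have "z * s = z * (x * cj (\<Sum>t\<in>T. c t * g t) * a)" by (simp add: s T)
    also have "\<dots> = (\<Sum>t\<in>T. z * (x * cj (g t)) * (cj (c t) * a))"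
      by (simp add: cj_sum cj_mult sum_distrib_left sum_distrib_right mult.assoc)
    also have "\<dots> \<in> norm_multiple (word_module m)"
      unfolding norm_multiple_def
    proof (rule zspan_sum, fold norm_multiple_def)
      fix t assume t: "t \<in> T"
      have "z * (x * cj (g t)) \<in> norm_multiple (word_module (Suc m))"
        using word_module_step[OF z s(2) T(3)[OF t]] assms by blast
      then show "z * (x * cj (g t)) * (cj (c t) * a) \<in> norm_multiple (word_module m)"
        by (rule norm_multiple_map) (rule word_module_cancel[OF _ T(2)[OF t] s(3)])
    qed
    finally show "z * s \<in> norm_multiple (word_module m)" .
  qed (auto simp: right_diff_distrib norm_multiple_def)
  then show "z \<in> norm_multiple (word_module m)" by simp
qed

lemma word_module_stable: "\<exists>m. word_module (Suc m) \<subseteq> norm_multiple (word_module m)"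
proof -
  obtain N where N: "\<And>xs b. set xs \<subseteq> I \<Longrightarrow> length xs > N \<Longrightarrow> word b xs \<in> norm_words b (length xs - 2)"
    using long_word by blast
  have "z \<in> norm_multiple (word_module N)" if z: "z \<in> word_module (Suc N)" for z
  proof (rule word_module_map[OF z, of _ "\<lambda>z. z"])
    fix r xs assume *: "r \<in> \<O>" "length xs = 2 * Suc N" "set xs \<subseteq> I"
    have "word True xs \<in> norm_words True (2 * N)" using N[OF *(3), of True] *(2) by simp
    then show "r * word True xs \<in> norm_multiple (word_module N)"
      unfolding norm_words_def
    proof (rule zspan_additive_image[of "\<lambda>w. r * w", rotated])
      fix s assume "s \<in> {\<iota> a * word True ys | a ys. a \<in> norm_ideal \<iota> I \<and> length ys = 2 * N \<and> set ys \<subseteq> I}"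
      then obtain a ys where s: "s = \<iota> a * word True ys" "a \<in> norm_ideal \<iota> I" "length ys = 2 * N" "set ys \<subseteq> I" by blast
      have "r * s = \<iota> a * (r * word True ys)" unfolding s(1) by (rule central_left)
      then show "r * s \<in> norm_multiple (word_module N)"
        unfolding norm_multiple_def using s(2) word_module_base[OF *(1) s(3,4)] by (intro zspan_base) blast
    qed (auto simp: norm_multiple_def right_diff_distrib)
  qed (auto simp: norm_multiple_def)
  then show ?thesis by blast
qed

text \<open>Descending from the exponent at which words become long enough to exponent 0 leaves K
  inside the norm ideal times \<O>.\<close>

lemma mult_cj_in_norm:
  assumes "x \<in> I" "y \<in> I"
  shows "x * cj y \<in> norm_two_sided \<iota> \<O> I"
proof -
  obtain m where "word_module (Suc m) \<subseteq> norm_multiple (word_module m)" using word_module_stable by blast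
  then have "word_module (Suc 0) \<subseteq> norm_multiple (word_module 0)"
    by (induction m) (auto dest: word_module_descend)
  moreover have "1 * word True [x, y] \<in> word_module (Suc 0)"
    using assms by (intro word_module_base \<O>_1) auto
  ultimately have "x * cj y \<in> norm_multiple (word_module 0)" by auto
  moreover have "word_module 0 \<subseteq> \<O>"
    unfolding word_module_def by (rule zspan_minimal) (auto simp: subgroup_\<O>)
  then have "norm_multiple (word_module 0) \<subseteq> norm_two_sided \<iota> \<O> I"
    unfolding norm_multiple_def norm_two_sided_def int_span_eq_zspan by (intro zspan_mono) blast
  ultimately show ?thesis by blast
qed

theorem norm_two_sided_eq: "norm_two_sided \<iota> \<O> I = zspan {x * cj y | x y. x \<in> I \<and> y \<in> I}"
proof
  show "zspan {x * cj y | x y. x \<in> I \<and> y \<in> I} \<subseteq> norm_two_sided \<iota> \<O> I"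
    using mult_cj_in_norm by (intro zspan_minimal) (auto simp: norm_two_sided_def)
  have "\<iota> a * r \<in> zspan {x * cj y | x y. x \<in> I \<and> y \<in> I}" if a: "a \<in> norm_ideal \<iota> I" and r: "r \<in> \<O>" for a r
  proof (rule int_span_additive_image[of "\<lambda>a. \<iota> a * r", OF _ a[unfolded norm_ideal_def]])
    fix s assume "s \<in> {r * nrd \<iota> x | r x. r \<in> ring_of_integers \<and> x \<in> I}"
    then obtain q x where s: "s = q * nrd \<iota> x" "q \<in> ring_of_integers" "x \<in> I" by blast
    \<comment> \<open>The opposite inclusion: the reduced norm of \<open>x\<close> times
      \<open>r\<close> is \<open>x * cj (cj r * x)\<close>, a product of the required shape.\<close>
    have "\<iota> s * r = (\<iota> q * x) * cj (cj r * x)"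
      by (simp add: s(1) \<iota>_simps(3) \<iota>_nrd cj_mult mult.assoc)
    moreover have "\<iota> q * x \<in> I" "cj r * x \<in> I" using s r by (auto intro: I_left \<O>_integers cj_\<O>)
    ultimately show "\<iota> s * r \<in> zspan {x * cj y | x y. x \<in> I \<and> y \<in> I}" by (intro zspan_base) blast
  qed (auto simp: \<iota>_simps(6) left_diff_distrib)
  then show "norm_two_sided \<iota> \<O> I \<subseteq> zspan {x * cj y | x y. x \<in> I \<and> y \<in> I}"
    unfolding norm_two_sided_def by (intro int_span_minimal) auto
qed

end

section \<open>Tori with quaternionic multiplication\<close>

lemma (in quat_setup) quat_matrix_nth:
  "(quat_matrix \<phi> \<beta> *v v) $ (k, p) =
    of_real (\<phi> k \<beta> $ p $ 1) * v $ (k, 1) + of_real (\<phi> k \<beta> $ p $ 2) * v $ (k, 2)"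
proof -
  have "(quat_matrix \<phi> \<beta> *v v) $ (k, p) =
      (\<Sum>x\<in>UNIV \<times> UNIV. (if k = fst x then of_real (\<phi> k \<beta> $ p $ snd x) else 0) * v $ x)"
    by (simp add: matrix_vector_mult_def quat_matrix_def cong: if_cong)
  also have "\<dots> = (\<Sum>l\<in>UNIV. \<Sum>q\<in>UNIV. (if k = l then of_real (\<phi> k \<beta> $ p $ q) else 0) * v $ (l, q))"
    unfolding sum.cartesian_product by (intro sum.cong) auto
  also have "\<dots> = (\<Sum>l\<in>UNIV. if k = l then \<Sum>q\<in>UNIV. of_real (\<phi> k \<beta> $ p $ q) * v $ (l, q) else 0)"
    by (intro sum.cong) auto
  also have "\<dots> = (\<Sum>q\<in>UNIV. of_real (\<phi> k \<beta> $ p $ q) * v $ (k, q))"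
    by simp
  finally show ?thesis by (simp add: sum_2)
qed

lemma block_vector_eqI:
  fixes u v :: "complex^('n::finite \<times> 2)"
  assumes "\<And>k. u $ (k, 1) = v $ (k, 1)" "\<And>k. u $ (k, 2) = v $ (k, 2)"
  shows "u = v"
  unfolding vec_eq_iff using assms by (auto simp: forall_2)

lemma (in quat_setup) quat_matrix_mult_vector:
  "quat_matrix \<phi> (\<alpha> * \<beta>) *v v = quat_matrix \<phi> \<alpha> *v (quat_matrix \<phi> \<beta> *v v)"
  by (rule block_vector_eqI) (simp_all add: quat_matrix_nth \<phi>_mult algebra_simps)

lemma (in quat_setup) quat_matrix_diff_vector:
  "quat_matrix \<phi> (\<alpha> - \<beta>) *v v = quat_matrix \<phi> \<alpha> *v v - quat_matrix \<phi> \<beta> *v v"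
  by (rule block_vector_eqI) (simp_all add: quat_matrix_nth \<phi>_diff algebra_simps)

lemma (in quat_setup) quat_matrix_1: "quat_matrix \<phi> 1 *v v = v"
  by (rule block_vector_eqI) (simp_all add: quat_matrix_nth \<phi>_1)

section \<open>Real structure of V and the trace forms\<close>

locale quat_period = quat_setup \<iota> \<sigma> \<phi>
  for \<iota> :: "'f::field_char_0 \<Rightarrow> 'b::division_ring"
    and \<sigma> :: "'n::finite \<Rightarrow> 'f \<Rightarrow> real"
    and \<phi> :: "'n \<Rightarrow> 'b \<Rightarrow> real^2^2" +
  fixes \<tau> :: "'n \<Rightarrow> complex"
  assumes Im_\<tau>: "\<And>k. Im (\<tau> k) \<noteq> 0"
begin

definition emb :: "'b \<Rightarrow> complex^('n \<times> 2)" where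
  "emb \<beta> = quat_matrix \<phi> \<beta> *v base_vector \<tau>"

lemma emb_nth: "emb \<beta> $ (k, p) = of_real (\<phi> k \<beta> $ p $ 1) * \<tau> k + of_real (\<phi> k \<beta> $ p $ 2)"
  by (simp add: emb_def quat_matrix_nth base_vector_def)

lemma emb_diff: "emb (x - y) = emb x - emb y"
  by (simp add: emb_def quat_matrix_diff_vector)

lemma emb_0: "emb 0 = 0"
  using emb_diff[of 0 0] by simp

lemma emb_mult: "emb (\<alpha> * \<beta>) = quat_matrix \<phi> \<alpha> *v emb \<beta>"
  by (simp add: emb_def quat_matrix_mult_vector)

lemma emb_1: "emb 1 = base_vector \<tau>"
  by (simp add: emb_def quat_matrix_1)

lemma emb_eq_0: "emb \<beta> = 0 \<Longrightarrow> \<beta> = 0"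
proof -
  assume 0: "emb \<beta> = 0"
  fix k :: 'n
  have z: "of_real (\<phi> k \<beta> $ p $ 1) * \<tau> k + of_real (\<phi> k \<beta> $ p $ 2) = 0" for p
    unfolding emb_nth[symmetric] 0 by simp
  have 1: "\<phi> k \<beta> $ p $ 1 = 0" for p
    using arg_cong[OF z[of p], of Im] Im_\<tau>[of k] by simp
  then have 2: "\<phi> k \<beta> $ p $ 2 = 0" for p
    using arg_cong[OF z[of p], of Re] by simp
  have "\<phi> k \<beta> = 0" unfolding mat2_eq_iff by (simp add: 1 2)
  then show "\<beta> = 0" by (rule \<phi>_eq_0)
qed

lemma emb_inj: "emb x = emb y \<Longrightarrow> x = y"
  using emb_eq_0[of "x - y"] by (simp add: emb_diff)

lemma quat_matrix_inj: "quat_matrix \<phi> x = quat_matrix \<phi> y \<Longrightarrow> x = y"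
  by (rule emb_inj) (simp add: emb_def)

lemma emb_of_int: "emb (of_int m * \<beta>) = of_int m *\<^sub>R emb \<beta>"
proof -
  have "\<phi> k (of_int m * \<beta>) = mat (of_int m) ** \<phi> k \<beta>" for k
    using \<phi>_\<iota>[of k "of_int m"] by (simp add: \<phi>_mult \<iota>_of_int unital_ring_hom_of_int[OF hom_\<sigma>])
  then show ?thesis
    by (intro block_vector_eqI) (simp_all add: emb_nth scaleR_conv_of_real[where 'a = complex] algebra_simps)
qed

text \<open>A vector orthogonal to all embedded elements of F would be a linear relation between
  distinct embeddings.\<close>

lemma span_embeddings: "span (range (\<lambda>a. \<chi> k. \<sigma> k a)) = (UNIV :: (real^'n) set)"
proof (rule ccontr)
  assume "span (range (\<lambda>a. \<chi> k. \<sigma> k a)) \<noteq> (UNIV :: (real^'n) set)"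
  then obtain c :: "real^'n" where c: "c \<noteq> 0" "\<And>x. x \<in> span (range (\<lambda>a. \<chi> k. \<sigma> k a)) \<Longrightarrow> c \<bullet> x = 0"
    using span_not_UNIV_orthogonal by blast
  have "(\<Sum>k\<in>UNIV. c $ k * \<sigma> k a) = 0" for a
    using c(2)[OF span_base[OF rangeI[of "\<lambda>a. \<chi> k. \<sigma> k a" a]]] by (simp add: inner_vec_def)
  then have "\<forall>k\<in>UNIV. c $ k = 0"
    by (rule field_homs_independent[OF finite_class.finite_UNIV inj_family_\<sigma> hom_\<sigma>])
  then show False using c(1) by (simp add: vec_eq_iff)
qed

text \<open>Real combinations of F-multiples separate the blocks, a splitting fills each block with
  all real matrices, and \<open>\<tau> k\<close> and 1 form a real basis of the complex
  numbers.\<close>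

lemma span_emb: "span (range emb) = UNIV"
proof -
  define W where "W = span (range emb)"
  have W: "subspace W" by (simp add: W_def)
  \<comment> \<open>Scales the blocks of \<open>emb \<beta>\<close> by independent real numbers; for
    \<open>c\<close> coming from an element of F this is just multiplication in B.\<close>
  define L where "L \<beta> c = (\<chi> p. of_real (c $ fst p) * emb \<beta> $ p)" for \<beta> and c :: "real^'n"
  have L_W: "L \<beta> c \<in> W" for \<beta> c
  proof -
    have lin: "linear (L \<beta>)"
      by (rule linearI) (simp_all add: L_def vec_eq_iff scaleR_conv_of_real[where 'a = complex] algebra_simps)
    have "L \<beta> (\<chi> k. \<sigma> k a) = emb (\<iota> a * \<beta>)" for a
      by (rule block_vector_eqI) (simp_all add: L_def emb_nth \<phi>_mult \<phi>_\<iota> algebra_simps)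
    then have "L \<beta> (\<chi> k. \<sigma> k a) \<in> W" for a by (simp add: W_def span_base)
    then have "range (\<lambda>a. \<chi> k. \<sigma> k a) \<subseteq> L \<beta> -` W" by auto
    then have "span (range (\<lambda>a. \<chi> k. \<sigma> k a)) \<subseteq> L \<beta> -` W"
      by (rule span_minimal[OF _ linear_subspace_vimage[OF lin W]])
    then show ?thesis unfolding span_embeddings by auto
  qed
  \<comment> \<open>The vector M times (\<tau> k, 1) placed in block \<open>k\<close>.\<close>
  define w where "w k M = (\<chi> p. if fst p = k then of_real (M $ snd p $ 1) * \<tau> k + of_real (M $ snd p $ 2) else 0)"
    for k and M :: "real^2^2"
  have w_W: "w k M \<in> W" for k M
  proof -
    have lin: "linear (w k)"
      by (rule linearI) (simp_all add: w_def vec_eq_iff scaleR_conv_of_real[where 'a = complex] algebra_simps)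
    have "w k (\<phi> k \<beta>) = L \<beta> (axis k 1)" for \<beta>
      by (rule block_vector_eqI) (simp_all add: w_def L_def emb_nth axis_def)
    then have "range (\<phi> k) \<subseteq> w k -` W" using L_W by auto
    then have "span (range (\<phi> k)) \<subseteq> w k -` W"
      by (rule span_minimal[OF _ linear_subspace_vimage[OF lin W]])
    then show ?thesis unfolding span_\<phi> by auto
  qed
  have "v \<in> W" for v
  proof -
    define a where "a k p = Im (v $ (k, p)) / Im (\<tau> k)" for k p
    define M :: "'n \<Rightarrow> real^2^2"
      where "M k = (\<chi> p q. if q = 1 then a k p else Re (v $ (k, p)) - a k p * Re (\<tau> k))" for k
    have M: "of_real (M k $ p $ 1) * \<tau> k + of_real (M k $ p $ 2) = v $ (k, p)" for k p
      using Im_\<tau>[of k] by (simp add: complex_eq_iff M_def a_def)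
    have "v = (\<Sum>k\<in>UNIV. w k (M k))"
      by (rule block_vector_eqI) (simp_all add: w_def M if_distrib cong: if_cong)
    also have "\<dots> \<in> W" by (intro subspace_sum[OF W] w_W)
    finally show ?thesis .
  qed
  then show ?thesis by (auto simp: W_def)
qed

text \<open>The real bilinear extension of tr(\<mu> \<beta> \<open>cj \<gamma>\<close>). It rests on
  Im((a t + b) cnj(c t + d)) = (a d - b c) Im t, which produces the entries of \<beta>
  \<open>cj \<gamma>\<close>; written with Im(u cnj w), the invariance under multiplication by i is
  visible.\<close>

definition quat_form :: "'b \<Rightarrow> complex^('n \<times> 2) \<Rightarrow> complex^('n \<times> 2) \<Rightarrow> real" where
  "quat_form \<mu> u w = (\<Sum>k\<in>UNIV.
     (\<phi> k \<mu> $ 1 $ 1 * Im (u $ (k, 1) * cnj (w $ (k, 2))) + \<phi> k \<mu> $ 1 $ 2 * Im (u $ (k, 2) * cnj (w $ (k, 2)))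
      - \<phi> k \<mu> $ 2 $ 1 * Im (u $ (k, 1) * cnj (w $ (k, 1))) - \<phi> k \<mu> $ 2 $ 2 * Im (u $ (k, 2) * cnj (w $ (k, 1)))) / Im (\<tau> k))"

lemma bilinear_quat_form: "bilinear (quat_form \<mu>)"
  unfolding bilinear_def
  by (auto intro!: linearI simp: quat_form_def sum.distrib[symmetric] sum_distrib_left add_divide_distrib[symmetric]
      diff_divide_distrib[symmetric] intro!: sum.cong) (simp_all add: algebra_simps)

lemma quat_form_ii: "quat_form \<mu> (\<i> *s u) (\<i> *s w) = quat_form \<mu> u w"
proof -
  have "\<i> * x * cnj (\<i> * y) = x * cnj y" for x y by (simp add: algebra_simps)
  then show ?thesis unfolding quat_form_def vector_smult_component by simp
qed

lemma quat_form_emb: "quat_form \<mu> (emb \<beta>) (emb \<gamma>) = of_rat (tr_BQ \<iota> (\<mu> * \<beta> * cj \<gamma>))"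
proof -
  have Im_eq: "Im ((of_real a * t + of_real b) * cnj (of_real c * t + of_real d)) = (a * d - b * c) * Im t"
    for a b c d t by (simp add: algebra_simps)
  show ?thesis
    unfolding quat_form_def tr_BQ_eq emb_nth Im_eq
  proof (rule sum.cong[OF refl])
    fix k
    show "(\<phi> k \<mu> $ 1 $ 1 * ((\<phi> k \<beta> $ 1 $ 1 * \<phi> k \<gamma> $ 2 $ 2 - \<phi> k \<beta> $ 1 $ 2 * \<phi> k \<gamma> $ 2 $ 1) * Im (\<tau> k)) +
         \<phi> k \<mu> $ 1 $ 2 * ((\<phi> k \<beta> $ 2 $ 1 * \<phi> k \<gamma> $ 2 $ 2 - \<phi> k \<beta> $ 2 $ 2 * \<phi> k \<gamma> $ 2 $ 1) * Im (\<tau> k)) -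
         \<phi> k \<mu> $ 2 $ 1 * ((\<phi> k \<beta> $ 1 $ 1 * \<phi> k \<gamma> $ 1 $ 2 - \<phi> k \<beta> $ 1 $ 2 * \<phi> k \<gamma> $ 1 $ 1) * Im (\<tau> k)) -
         \<phi> k \<mu> $ 2 $ 2 * ((\<phi> k \<beta> $ 2 $ 1 * \<phi> k \<gamma> $ 1 $ 2 - \<phi> k \<beta> $ 2 $ 2 * \<phi> k \<gamma> $ 1 $ 1) * Im (\<tau> k))) / Im (\<tau> k) =
        trace (\<phi> k (\<mu> * \<beta> * cj \<gamma>))"
      using Im_\<tau>[of k] by (simp add: \<phi>_mult \<phi>_cj trace2 field_simps)
  qed
qed

text \<open>Testing against vectors with one nonzero coordinate shows that the matrix of \<mu> kills
  \<open>u\<close>, and \<mu> is invertible in B.\<close>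

lemma quat_form_nondegenerate:
  assumes "\<mu> \<noteq> 0" "\<And>w. quat_form \<mu> u w = 0"
  shows "u = 0"
proof -
  have c: "of_real (\<phi> k \<mu> $ p $ 1) * u $ (k, 1) + of_real (\<phi> k \<mu> $ p $ 2) * u $ (k, 2) = 0" for k p
  proof -
    let ?x = "of_real (\<phi> k \<mu> $ p $ 1) * u $ (k, 1) + of_real (\<phi> k \<mu> $ p $ 2) * u $ (k, 2)"
    have z: "Im (?x * cnj z) = 0" for z
    proof -
      \<comment> \<open>Row 1 of the product is paired with the second coordinate of
        \<open>w\<close> and row 2, with opposite sign, with the first: this is the adjugate at
        work.\<close>
      define w :: "complex^('n \<times> 2)" where "w = (\<chi> l. if l = (k, if p = 1 then 2 else 1) then z else 0)"
      have "quat_form \<mu> u w = (\<Sum>l\<in>UNIV. if l = k then (if p = 1 then 1 else -1) * Im (?x * cnj z) / Im (\<tau> k) else 0)"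
        unfolding quat_form_def
        by (rule sum.cong[OF refl]) (use exhaust_2[of p] in \<open>auto simp: w_def algebra_simps\<close>)
      then show ?thesis using assms(2)[of w] Im_\<tau>[of k] by (simp split: if_splits)
    qed
    from z[of 1] z[of \<i>] show ?thesis by (simp add: complex_eq_iff)
  qed
  define N where "N k = \<phi> k (inverse \<mu>)" for k
  have N: "N k ** \<phi> k \<mu> = mat 1" for k
    unfolding N_def \<phi>_mult[symmetric] using assms(1) by (simp add: \<phi>_1)
  have "quat_matrix \<phi> \<mu> *v u = 0"
    by (rule block_vector_eqI) (simp_all add: quat_matrix_nth c)
  then have "quat_matrix \<phi> (inverse \<mu> * \<mu>) *v u = 0"
    by (simp add: quat_matrix_mult_vector)
  then show ?thesis using assms(1) by (simp add: quat_matrix_1)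
qed

text \<open>Trace 0 makes the diagonal entries opposite, so their contributions cancel; the
  off-diagonal entries multiply Im(x cnj x) = 0.\<close>

lemma quat_form_alternating:
  assumes "trd \<iota> \<mu> = 0"
  shows "quat_form \<mu> u u = 0"
proof -
  have tr: "\<phi> k \<mu> $ 2 $ 2 = - \<phi> k \<mu> $ 1 $ 1" for k
    using \<sigma>_trd[of k \<mu>] assms by (simp add: trace2 \<sigma>_simps)
  have "Im (x * cnj x) = 0" for x by simp
  moreover have "Im (y * cnj x) = - Im (x * cnj y)" for x y by (simp add: algebra_simps)
  ultimately show ?thesis
    unfolding quat_form_def tr by (intro sum.neutral) (simp add: algebra_simps)
qed

lemma quat_form_add: "quat_form (\<mu> + \<nu>) u w = quat_form \<mu> u w + quat_form \<nu> u w"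
  by (simp add: quat_form_def \<phi>_add sum.distrib[symmetric] add_divide_distrib[symmetric])
     (auto intro!: sum.cong simp: algebra_simps)

lemma pure_quaternion_exists: "\<exists>\<nu>. \<nu> \<noteq> 0 \<and> trd \<iota> \<nu> = 0"
proof -
  obtain i j a b where ij: "a \<noteq> 0" "b \<noteq> 0" "i * i = \<iota> a" "j * j = \<iota> b" "j * i = - (i * j)"
    using quat_alg unfolding quaternion_algebra_def by blast
  have "\<iota> a \<noteq> 0" "\<iota> b \<noteq> 0" using ij(1,2) by (simp_all add: \<iota>_eq_0)
  then have nz: "i \<noteq> 0" "j \<noteq> 0" using ij(3,4) by auto
  fix k :: 'n
  have "\<sigma> k (trd \<iota> i) = \<sigma> k 0"
    unfolding \<sigma>_trd trace_\<phi>_anticommuting[OF nz(2) ij(5)] by (simp add: \<sigma>_simps)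
  then have "trd \<iota> i = 0" using unital_ring_hom_inj[OF hom_\<sigma>] by (rule injD[rotated])
  then show ?thesis using nz(1) by blast
qed

end

text \<open>Pairing with a real basis inside \<open>\<Lambda>\<close> puts \<open>\<Lambda>\<close> into the group generated by the dual
  basis, so it is generated by at most \<open>dim V\<close> elements.\<close>

lemma polarizable_lattice_basis:
  fixes \<Lambda> :: "(complex^'m::finite) set"
  assumes pol: "polarizable \<Lambda>" and sub: "add_subgroup \<Lambda>" and sp: "span \<Lambda> = UNIV"
  shows "\<exists>B. complex_lattice \<Lambda> B"
proof -
  obtain E :: "complex^'m \<Rightarrow> complex^'m \<Rightarrow> real" where
    E: "bilinear E" "\<And>v. E v v = 0" "\<And>l m. l \<in> \<Lambda> \<Longrightarrow> m \<in> \<Lambda> \<Longrightarrow> E l m \<in> \<int>" "\<And>v. v \<noteq> 0 \<Longrightarrow> E (\<i> *s v) v > 0"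
    using pol unfolding polarizable_def by blast
  obtain C where C: "C \<subseteq> \<Lambda>" "independent C" "\<Lambda> \<subseteq> span C" using maximal_independent_subset[of \<Lambda>] by blast
  have spC: "span C = UNIV" using sp span_minimal[OF C(3) subspace_span] by auto
  have finC: "finite C" using C(2) by (rule independent_imp_finite)
  have cardC: "card C = DIM(complex^'m)"
    using dim_eq_card[of C UNIV] C(2) spC by (simp add: dim_UNIV)
  have lin1: "linear (\<lambda>u. E u w)" and lin2: "linear (E u)" for u w
    using E(1) by (auto simp: bilinear_def)
  \<comment> \<open>Stores the pairings of \<open>v\<close> with the real basis \<open>C\<close> as
    coordinates in \<open>C\<close>, so that lattice vectors get integer coordinates.\<close>
  define \<Phi> where "\<Phi> v = (\<Sum>c\<in>C. E v c *\<^sub>R c)" for v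
  have lin: "linear \<Phi>"
    unfolding \<Phi>_def
    by (intro linear_compose_sum ballI linearI)
       (simp_all add: linear_add[OF lin1] linear_scale[OF lin1] scaleR_add_left)
  have zero: "v = 0" if v: "\<And>c. c \<in> C \<Longrightarrow> E v c = 0" for v
  proof (rule ccontr)
    assume nz: "v \<noteq> 0"
    have "E v w = 0" for w
      by (rule linear_eq_on[OF lin2 linear_zero, of w C]) (use spC v in auto)
    \<comment> \<open>A vector in the radical contradicts positivity of the polarization.\<close>
    then have "E (\<i> *s v) v = 0" using alternating_skew[OF E(1,2), of "\<i> *s v" v] by simp
    then show False using E(4)[OF nz] by simp
  qed
  have "inj \<Phi>"
    unfolding linear_injective_0[OF lin]
  proof (intro allI impI zero)
    fix v c assume "\<Phi> v = 0" "c \<in> C"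
    then show "E v c = 0"
      unfolding \<Phi>_def using independentD[OF C(2) finC order_refl, of "\<lambda>c. E v c" c] by blast
  qed
  then have "surj \<Phi>" by (rule linear_injective_imp_surjective[OF lin _ refl])
  then have "\<forall>c. \<exists>d. \<Phi> d = c" by (metis surjD)
  then obtain d where d: "\<And>c. \<Phi> (d c) = c" using choice[of "\<lambda>c d. \<Phi> d = c"] by blast
  have "\<Lambda> \<subseteq> zspan (d ` C)"
  proof
    fix l assume l: "l \<in> \<Lambda>"
    have "\<forall>c\<in>C. \<exists>k::int. E l c = of_int k" using E(3)[OF l] C(1) by (blast elim: Ints_cases)
    then obtain k :: "complex^'m \<Rightarrow> int" where k: "\<And>c. c \<in> C \<Longrightarrow> E l c = of_int (k c)"
      using bchoice[of C "\<lambda>c k. E l c = of_int k"] by blast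
    have "\<Phi> l = (\<Sum>c\<in>C. of_int (k c) *\<^sub>R \<Phi> (d c))" unfolding \<Phi>_def[of l] d using k by (intro sum.cong) auto
    also have "\<dots> = \<Phi> (\<Sum>c\<in>C. of_int (k c) *\<^sub>R d c)" by (simp add: linear_sum[OF lin] linear_scale[OF lin])
    finally have "l = (\<Sum>c\<in>C. zmul (k c) (d c))" using \<open>inj \<Phi>\<close> by (simp add: zmul_scaleR inj_eq)
    also have "\<dots> \<in> zspan (d ` C)" by (intro zspan_sum zmul_in add_subgroup_zspan zspan_base imageI)
    finally show "l \<in> zspan (d ` C)" .
  qed
  then obtain T where T: "finite T" "card T \<le> card (d ` C)" "zspan T = \<Lambda>"
    using zspan_subgroup_finitely_generated[OF finite_imageI[OF finC] sub] by blast
  have "\<Lambda> \<subseteq> span T"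
    unfolding T(3)[symmetric] by (rule zspan_minimal) (auto simp: add_subgroup_def span_base span_zero span_diff)
  then have spT: "span T = UNIV" using sp span_minimal[OF _ subspace_span, of \<Lambda> T] by auto
  \<comment> \<open>No more generators than the dimension, and they span V; hence they form a
    basis.\<close>
  have "card T \<le> DIM(complex^'m)"
    using T(2) card_image_le[OF finC, of d] cardC by linarith
  then have "independent T"
    using spT T(1) by (intro card_le_dim_spanning[of T UNIV]) (auto simp: dim_UNIV)
  then have "complex_lattice \<Lambda> T" by unfold_locales (use T spT in auto)
  then show ?thesis by blast
qed

section \<open>The torus and its Riemann forms\<close>

locale quat_torus = quat_period \<iota> \<sigma> \<phi> \<tau>
  for \<iota> :: "'f::field_char_0 \<Rightarrow> 'b::division_ring"
    and \<sigma> :: "'n::finite \<Rightarrow> 'f \<Rightarrow> real"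
    and \<phi> :: "'n \<Rightarrow> 'b \<Rightarrow> real^2^2"
    and \<tau> :: "'n \<Rightarrow> complex" +
  fixes \<O> I :: "'b set"
  assumes hereditary: "hereditary_order \<iota> \<O>"
    and left_ideal: "left_ideal \<iota> \<O> I"
    and polarizable: "polarizable (QM_lattice \<phi> \<tau> I)"
    and End_torus: "End_torus (QM_lattice \<phi> \<tau> I) = quat_matrix \<phi> ` \<O>"
begin

definition \<Lambda> :: "(complex^('n \<times> 2)) set" where "\<Lambda> = QM_lattice \<phi> \<tau> I"

lemma \<Lambda>_eq: "\<Lambda> = emb ` I"
  unfolding \<Lambda>_def QM_lattice_def emb_def by blast

lemma lattice_in_I: "lattice_in \<iota> I"
  using left_ideal by (simp add: left_ideal_def)

lemma subgroup_\<Lambda>: "add_subgroup \<Lambda>"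
  unfolding add_subgroup_def \<Lambda>_eq
proof (intro conjI ballI)
  note I = lattice_add_subgroup[OF lattice_in_I]
  show "0 \<in> emb ` I" by (rule image_eqI[OF _ add_subgroup_0[OF I]]) (simp add: emb_0)
  fix x y assume "x \<in> emb ` I" "y \<in> emb ` I"
  then obtain a b where "x = emb a" "y = emb b" "a \<in> I" "b \<in> I" by blast
  then show "x - y \<in> emb ` I"
    by (intro image_eqI[of _ _ "a - b"] add_subgroup_diff[OF I]) (simp_all add: emb_diff)
qed

lemma span_\<Lambda>: "span \<Lambda> = UNIV"
proof -
  have "emb \<beta> \<in> span \<Lambda>" for \<beta>
  proof -
    obtain m :: int where m: "m > 0" "of_int m * \<beta> \<in> I" using lattice_multiple[OF lattice_in_I] by blast
    then have "of_int m *\<^sub>R emb \<beta> \<in> span \<Lambda>" unfolding \<Lambda>_eq emb_of_int[symmetric] by (intro span_base imageI)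
    then have "(1 / of_int m) *\<^sub>R (of_int m *\<^sub>R emb \<beta>) \<in> span \<Lambda>" by (rule span_scale)
    then show ?thesis using m(1) by simp
  qed
  then have "span (range emb) \<subseteq> span \<Lambda>" by (intro span_minimal subspace_span) auto
  then show ?thesis unfolding span_emb by auto
qed

text \<open>Chosen once, so that the results on complex lattices become available through a
  sublocale.\<close>

definition lattice_basis :: "(complex^('n \<times> 2)) set" where
  "lattice_basis = (SOME B. complex_lattice \<Lambda> B)"

lemma complex_lattice: "complex_lattice \<Lambda> lattice_basis"
  unfolding lattice_basis_def
  using polarizable_lattice_basis[OF polarizable[folded \<Lambda>_def] subgroup_\<Lambda> span_\<Lambda>] by (rule someI_ex)

end

sublocale quat_torus \<subseteq> L: complex_lattice "\<Lambda>" lattice_basis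
  by (rule complex_lattice)

context quat_torus
begin

text \<open>The lattice basis is pulled back along the injective additive map
  \<open>emb\<close>.\<close>

lemma I_finitely_generated: "\<exists>S. finite S \<and> I = zspan S"
proof -
  define S where "S = {\<beta> \<in> I. emb \<beta> \<in> lattice_basis}"
  have inj: "inj emb" using emb_inj by (auto intro: injI)
  have img: "emb ` S = lattice_basis"
  proof
    show "lattice_basis \<subseteq> emb ` S"
    proof
      fix b assume b: "b \<in> lattice_basis"
      then have "b \<in> emb ` I" using L.B_subset unfolding \<Lambda>_eq by blast
      then show "b \<in> emb ` S" using b unfolding S_def by blast
    qed
  qed (auto simp: S_def)
  have "finite (emb ` S)" using L.finite_B by (simp add: img)
  then have "finite S" using inj by (meson finite_imageD inj_on_subset subset_UNIV)
  have "emb ` zspan S = emb ` I"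
    using additive_image_zspan[of emb S, OF emb_diff] L.lattice unfolding img \<Lambda>_eq by simp
  then have "zspan S = I" using inj by (simp add: inj_image_eq_iff)
  then show ?thesis using \<open>finite S\<close> by blast
qed

lemma left_order_I:
  assumes "\<And>x. x \<in> I \<Longrightarrow> d * x \<in> I"
  shows "d \<in> \<O>"
proof -
  have "quat_matrix \<phi> d \<in> End_torus (QM_lattice \<phi> \<tau> I)"
    unfolding End_torus_def \<Lambda>_def[symmetric] \<Lambda>_eq using assms by (auto simp: emb_mult[symmetric])
  then obtain r where "r \<in> \<O>" "quat_matrix \<phi> d = quat_matrix \<phi> r" unfolding End_torus by blast
  then show ?thesis using quat_matrix_inj by metis
qed

end

sublocale quat_torus \<subseteq> quat_ideal \<iota> \<sigma> \<phi> \<O> I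
  by unfold_locales (fact hereditary left_ideal left_order_I I_finitely_generated)+

context quat_torus
begin

lemma basis_emb: "b \<in> lattice_basis \<Longrightarrow> \<exists>\<beta>\<in>I. b = emb \<beta>"
  using L.B_subset unfolding \<Lambda>_eq by blast

lemma bilinear_eqI:
  assumes "bilinear E" "bilinear F" "\<And>\<beta> \<gamma>. E (emb \<beta>) (emb \<gamma>) = F (emb \<beta>) (emb \<gamma>)"
  shows "E = F"
proof (rule L.bilinear_ext[OF assms(1,2)])
  fix a b assume "a \<in> lattice_basis" "b \<in> lattice_basis"
  then show "E a b = F a b" using basis_emb assms(3) by blast
qed

text \<open>\<open>E\<close> is rational on the image of B, since integer multiples of elements of B
  lie in \<open>I\<close>. The resulting functional is a trace pairing, rewritten with
  \<open>cj \<gamma>\<close> by invariance of the trace to match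
  \<open>quat_form_emb\<close>.\<close>

lemma tr_functional:
  assumes E: "E \<in> riemann_forms \<Lambda>"
  shows "\<exists>\<delta>. \<forall>\<gamma>. E (emb \<beta>) (emb \<gamma>) = of_rat (tr_BQ \<iota> (\<delta> * cj \<gamma>))"
proof -
  note bil = riemann_formsD(1)[OF E]
  have ex: "\<exists>q. E (emb \<beta>) (emb \<gamma>) = of_rat q" for \<gamma>
  proof -
    obtain m n :: int where mn: "m > 0" "n > 0" "of_int m * \<beta> \<in> I" "of_int n * \<gamma> \<in> I"
      using lattice_multiple[OF lattice_I, of \<beta>] lattice_multiple[OF lattice_I, of \<gamma>] by blast
    have "E (emb (of_int m * \<beta>)) (emb (of_int n * \<gamma>)) \<in> \<int>"
      using mn by (intro riemann_formsD(3)[OF E]) (auto simp: \<Lambda>_eq)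
    then obtain k :: int where "E (emb (of_int m * \<beta>)) (emb (of_int n * \<gamma>)) = of_int k" by (rule Ints_cases)
    then have "of_int m * (of_int n * E (emb \<beta>) (emb \<gamma>)) = of_int k"
      by (simp add: emb_of_int bilinear_lmul[OF bil] bilinear_rmul[OF bil] mult.left_commute)
    then have "E (emb \<beta>) (emb \<gamma>) = of_rat (of_int k / (of_int m * of_int n))"
      using mn(1,2) by (simp add: of_rat_divide of_rat_mult field_simps)
    then show ?thesis by blast
  qed
  then obtain f where f: "\<And>\<gamma>. E (emb \<beta>) (emb \<gamma>) = of_rat (f \<gamma>)"
    using choice[of "\<lambda>\<gamma> q. E (emb \<beta>) (emb \<gamma>) = of_rat q"] by blast
  have "real_of_rat (f (x + y)) = of_rat (f x + f y)" for x y
  proof -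
    have "emb (x + y) = emb x + emb y" using emb_diff[of "x + y" y] by simp
    then show ?thesis by (simp add: of_rat_add f[symmetric] bilinear_radd[OF bil])
  qed
  then have f_add: "f (x + y) = f x + f y" for x y by (simp only: of_rat_eq_iff)
  have "real_of_rat (f (qscale q x)) = of_rat (q * f x)" for q x
  proof -
    have "emb (qscale q x) = of_rat q *\<^sub>R emb x"
      by (rule block_vector_eqI)
         (simp_all add: emb_nth \<phi>_mult \<phi>_\<iota> unital_ring_hom_of_rat[OF hom_\<sigma>] scaleR_conv_of_real[where 'a = complex] algebra_simps)
    then show ?thesis by (simp add: of_rat_mult f[symmetric] bilinear_rmul[OF bil])
  qed
  then have f_scale: "f (qscale q x) = q * f x" for q x by (simp only: of_rat_eq_iff)
  obtain \<delta> where \<delta>: "\<And>x. f x = tr_BQ \<iota> (\<delta> * x)" using functional_representation[OF f_add f_scale] by blast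
  have "f \<gamma> = tr_BQ \<iota> (cj \<delta> * cj \<gamma>)" for \<gamma>
  proof -
    have "f \<gamma> = tr_BQ \<iota> (cj \<gamma> * cj \<delta>)" unfolding \<delta> cj_mult[symmetric] tr_cj ..
    then show ?thesis by (simp only: tr_commute)
  qed
  then show ?thesis unfolding f by (intro exI[of _ "cj \<delta>"]) simp
qed

text \<open>The form \<open>quat_form \<nu>\<close> of a pure quaternion \<open>\<nu>\<close> is nondegenerate and of type (1,1), so
  every Riemann form is \<open>quat_form \<nu> (M u) w\<close> for a complex linear \<open>M\<close>, and a multiple of \<open>M\<close> is an
  endomorphism of the torus, hence lies in \<open>\<O>\<close>.\<close>

lemma riemann_form_quat_form:
  assumes E: "E \<in> riemann_forms \<Lambda>"
  shows "\<exists>\<mu>. trd \<iota> \<mu> = 0 \<and> E = quat_form \<mu>"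
proof -
  note bil = riemann_formsD(1)[OF E] and alt = riemann_formsD(2)[OF E] and ii = riemann_formsD(4)[OF E]
  obtain \<nu> where \<nu>: "\<nu> \<noteq> 0" "trd \<iota> \<nu> = 0" using pure_quaternion_exists by blast
  have ex: "\<exists>\<beta>'. \<forall>\<gamma>. E (emb \<beta>) (emb \<gamma>) = quat_form \<nu> (emb \<beta>') (emb \<gamma>)" for \<beta>
  proof -
    obtain \<delta> where \<delta>: "\<And>\<gamma>. E (emb \<beta>) (emb \<gamma>) = of_rat (tr_BQ \<iota> (\<delta> * cj \<gamma>))"
      using tr_functional[OF E] by blast
    have "\<nu> * (inverse \<nu> * \<delta>) = \<delta>" using \<nu>(1) by (simp add: mult.assoc[symmetric])
    then show ?thesis by (intro exI[of _ "inverse \<nu> * \<delta>"]) (simp add: quat_form_emb \<delta>)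
  qed
  obtain a where a: "\<And>\<beta> \<gamma>. E (emb \<beta>) (emb \<gamma>) = quat_form \<nu> (emb (a \<beta>)) (emb \<gamma>)"
    using choice[of "\<lambda>\<beta> \<beta>'. \<forall>\<gamma>. E (emb \<beta>) (emb \<gamma>) = quat_form \<nu> (emb \<beta>') (emb \<gamma>)"] ex by blast
  \<comment> \<open>The values of \<open>a\<close> were chosen one by one, so \<open>M\<close> is
    built as the linear map with these values on the lattice basis.\<close>
  define A where "A b = a (inv_into UNIV emb b)" for b
  obtain M where M: "linear M" "\<And>b. b \<in> lattice_basis \<Longrightarrow> M b = emb (A b)"
    using linear_independent_extend[OF L.independent_B, of "\<lambda>b. emb (A b)"] by blast
  have inv_emb: "inv_into UNIV emb (emb \<beta>) = \<beta>" for \<beta> by (rule inv_f_f) (auto intro: injI emb_inj)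
  have bilM: "bilinear (\<lambda>u w. quat_form \<nu> (M u) w)"
    using bilinear_quat_form[of \<nu>] linear_compose[OF M(1), unfolded comp_def] unfolding bilinear_def by blast
  have EM: "E = (\<lambda>u w. quat_form \<nu> (M u) w)"
  proof (rule L.bilinear_ext[OF bil bilM])
    fix b c assume bc: "b \<in> lattice_basis" "c \<in> lattice_basis"
    obtain \<beta> where "b = emb \<beta>" using basis_emb[OF bc(1)] by blast
    moreover obtain \<gamma> where "c = emb \<gamma>" using basis_emb[OF bc(2)] by blast
    ultimately show "E b c = quat_form \<nu> (M b) c" using a[of \<beta> \<gamma>] M(2)[OF bc(1)] by (simp add: A_def inv_emb)
  qed
  then have EM': "E u w = quat_form \<nu> (M u) w" for u w by (rule fun_cong[THEN fun_cong])
  have neg: "\<i> *s (\<i> *s u) = - u" for u :: "complex^('n \<times> 2)" by (simp add: vec_eq_iff)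
  \<comment> \<open>\<open>E\<close> and the form of \<nu> are both invariant under multiplication
    by i, and the latter is nondegenerate.\<close>
  have Mii: "M (\<i> *s u) = \<i> *s M u" for u
  proof -
    have "quat_form \<nu> (M (\<i> *s u) - \<i> *s M u) w = 0" for w
    proof -
      have "quat_form \<nu> (M (\<i> *s u)) w = E (\<i> *s (\<i> *s u)) (\<i> *s w)" using ii[of "\<i> *s u" w] by (simp only: EM')
      also have "\<dots> = - E u (\<i> *s w)" unfolding neg bilinear_lneg[OF bil] ..
      also have "\<dots> = - quat_form \<nu> (M u) (\<i> *s w)" unfolding EM' ..
      also have "\<dots> = quat_form \<nu> (\<i> *s (\<i> *s M u)) (\<i> *s w)"
        unfolding neg bilinear_lneg[OF bilinear_quat_form] ..
      also have "\<dots> = quat_form \<nu> (\<i> *s M u) w" by (rule quat_form_ii)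
      finally show ?thesis by (simp add: bilinear_lsub[OF bilinear_quat_form])
    qed
    then have "M (\<i> *s u) - \<i> *s M u = 0" by (rule quat_form_nondegenerate[OF \<nu>(1)])
    then show ?thesis by simp
  qed
  \<comment> \<open>A common denominator for the images of the basis, so that \<open>m\<close> times
    \<open>M\<close> preserves the lattice.\<close>
  obtain m :: int where m: "m > 0" "\<And>b. b \<in> lattice_basis \<Longrightarrow> of_int m * A b \<in> I"
    using lattice_common_multiple[OF lattice_I finite_imageI[OF L.finite_B, of A]] by blast
  define M' where "M' u = of_int m *\<^sub>R M u" for u
  have M'c: "M' (c *s u) = c *s M' u" for c u
  proof -
    have "c *s u = Re c *\<^sub>R u + Im c *\<^sub>R (\<i> *s u)" by (simp add: vec_eq_iff complex_eq_iff)
    then have "M' (c *s u) = of_int m *\<^sub>R (Re c *\<^sub>R M u + Im c *\<^sub>R (\<i> *s M u))"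
      by (simp only: M'_def linear_add[OF M(1)] linear_scale[OF M(1)] Mii)
    also have "\<dots> = c *s M' u" by (simp add: M'_def vec_eq_iff complex_eq_iff algebra_simps)
    finally show ?thesis .
  qed
  have M'add: "M' (u + w) = M' u + M' w" for u w
    by (simp add: M'_def linear_add[OF M(1)] scaleR_add_right)
  have "Vector_Spaces.linear (*s) (*s) M'"
    unfolding Vector_Spaces.linear_iff using M'c M'add by (auto intro: vec.vector_space_axioms)
  then have mat: "matrix M' *v u = M' u" for u by (rule matrix_works)
  have "matrix M' \<in> End_torus (QM_lattice \<phi> \<tau> I)"
    unfolding End_torus_def \<Lambda>_def[symmetric]
  proof (intro CollectI ballI, unfold mat)
    fix l assume "l \<in> \<Lambda>"
    then have l: "l \<in> zspan lattice_basis" by (simp only: L.lattice)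
    show "M' l \<in> \<Lambda>"
    proof (rule zspan_additive_image[OF _ l subgroup_\<Lambda>])
      show "M' (x - y) = M' x - M' y" for x y using M'add[of "x - y" y] by simp
      fix b assume b: "b \<in> lattice_basis"
      have "M' b = emb (of_int m * A b)" by (simp add: M'_def M(2)[OF b] emb_of_int)
      then show "M' b \<in> \<Lambda>" unfolding \<Lambda>_eq using m(2)[OF b] by blast
    qed
  qed
  then obtain r where r: "r \<in> \<O>" "matrix M' = quat_matrix \<phi> r" unfolding End_torus by blast
  define \<mu> where "\<mu> = qscale (1 / of_int m) (\<nu> * r)"
  have "E (emb \<beta>) (emb \<gamma>) = quat_form \<mu> (emb \<beta>) (emb \<gamma>)" for \<beta> \<gamma>
  proof -
    have "of_int m * E (emb \<beta>) (emb \<gamma>) = quat_form \<nu> (M' (emb \<beta>)) (emb \<gamma>)"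
      by (simp add: EM' M'_def bilinear_lmul[OF bilinear_quat_form])
    also have "\<dots> = of_rat (tr_BQ \<iota> (\<nu> * r * \<beta> * cj \<gamma>))"
      unfolding mat[symmetric] r(2) emb_mult[symmetric] quat_form_emb by (simp only: mult.assoc)
    finally have 1: "of_int m * E (emb \<beta>) (emb \<gamma>) = of_rat (tr_BQ \<iota> (\<nu> * r * \<beta> * cj \<gamma>))" .
    have "tr_BQ \<iota> (\<mu> * \<beta> * cj \<gamma>) = 1 / of_int m * tr_BQ \<iota> (\<nu> * r * \<beta> * cj \<gamma>)"
      unfolding \<mu>_def mult.assoc tr_qscale ..
    then have 2: "real_of_rat (tr_BQ \<iota> (\<mu> * \<beta> * cj \<gamma>)) = 1 / of_int m * of_rat (tr_BQ \<iota> (\<nu> * r * \<beta> * cj \<gamma>))"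
      by (simp only: of_rat_mult of_rat_divide of_rat_of_int_eq of_rat_1)
    show ?thesis unfolding quat_form_emb 2 1[symmetric] using m(1) by simp
  qed
  then have E\<mu>: "E = quat_form \<mu>" by (rule bilinear_eqI[OF bil bilinear_quat_form])
  \<comment> \<open>Skew symmetry against the base vector says that \<mu> + \<open>cj \<mu>\<close>
    is orthogonal to B under the trace form.\<close>
  have "tr_BQ \<iota> ((\<mu> + cj \<mu>) * \<beta>) = 0" for \<beta>
  proof -
    have "quat_form \<mu> (emb \<beta>) (emb 1) = - quat_form \<mu> (emb 1) (emb \<beta>)"
      using alternating_skew[OF bil alt, of "emb \<beta>" "emb 1"] unfolding E\<mu> .
    then have "real_of_rat (tr_BQ \<iota> (\<mu> * \<beta>)) = of_rat (- tr_BQ \<iota> (\<mu> * cj \<beta>))"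
      by (simp add: quat_form_emb of_rat_minus)
    then have "tr_BQ \<iota> (\<mu> * \<beta>) = - tr_BQ \<iota> (\<mu> * cj \<beta>)" by (simp only: of_rat_eq_iff)
    also have "tr_BQ \<iota> (\<mu> * cj \<beta>) = tr_BQ \<iota> (cj (\<mu> * cj \<beta>))" by (rule tr_cj[symmetric])
    also have "\<dots> = tr_BQ \<iota> (cj \<mu> * \<beta>)" unfolding cj_mult cj_cj by (rule tr_commute)
    finally show ?thesis by (simp add: distrib_right tr_add)
  qed
  then have "\<mu> + cj \<mu> = 0" by (rule tr_nondegenerate)
  then have "trd \<iota> \<mu> = 0" by (simp add: trd_eq_0 eq_neg_iff_add_eq_0 add.commute)
  then show ?thesis using E\<mu> by blast
qed

text \<open>Cyclicity of the trace turns integrality on the lattice into integrality of tr(\<beta>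
  \<open>cj \<gamma>\<close> \<mu>) for \<beta>, \<gamma> in \<open>I\<close>, and these products
  generate the norm ideal of \<O>.\<close>

lemma quat_form_riemann_iff:
  assumes "trd \<iota> \<mu> = 0"
  shows "quat_form \<mu> \<in> riemann_forms \<Lambda> \<longleftrightarrow> \<mu> \<in> dual_ideal \<iota> (norm_two_sided \<iota> \<O> I)"
proof -
  have int: "of_rat q \<in> (\<int> :: real set) \<longleftrightarrow> q \<in> \<int>" for q
    by (metis Ints_cases Ints_of_int of_rat_eq_iff of_rat_of_int_eq)
  have eq: "quat_form \<mu> (emb \<beta>) (emb \<gamma>) = of_rat (tr_BQ \<iota> (\<beta> * cj \<gamma> * \<mu>))" for \<beta> \<gamma>
    unfolding quat_form_emb tr_commute[of "\<beta> * cj \<gamma>"] by (simp only: mult.assoc)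
  show ?thesis
  proof
    assume "quat_form \<mu> \<in> riemann_forms \<Lambda>"
    then have *: "tr_BQ \<iota> (\<beta> * cj \<gamma> * \<mu>) \<in> \<int>" if "\<beta> \<in> I" "\<gamma> \<in> I" for \<beta> \<gamma>
      using riemann_formsD(3)[of "quat_form \<mu>" \<Lambda> "emb \<beta>" "emb \<gamma>"] that by (auto simp: \<Lambda>_eq eq int)
    have "tr_BQ \<iota> (x * \<mu>) \<in> \<int>" if "x \<in> norm_two_sided \<iota> \<O> I" for x
      by (rule zspan_additive_image[of "\<lambda>x. tr_BQ \<iota> (x * \<mu>)", OF _ that[unfolded norm_two_sided_eq]])
         (use * in \<open>auto simp: left_diff_distrib tr_diff add_subgroup_def\<close>)
    then show "\<mu> \<in> dual_ideal \<iota> (norm_two_sided \<iota> \<O> I)" by (simp add: dual_ideal_def)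
  next
    assume \<mu>: "\<mu> \<in> dual_ideal \<iota> (norm_two_sided \<iota> \<O> I)"
    show "quat_form \<mu> \<in> riemann_forms \<Lambda>"
    proof (rule riemann_formsI[OF bilinear_quat_form quat_form_alternating[OF assms] _ quat_form_ii])
      fix l m assume "l \<in> \<Lambda>" "m \<in> \<Lambda>"
      then obtain \<beta> \<gamma> where lm: "l = emb \<beta>" "m = emb \<gamma>" "\<beta> \<in> I" "\<gamma> \<in> I" unfolding \<Lambda>_eq by blast
      have "tr_BQ \<iota> (\<beta> * cj \<gamma> * \<mu>) \<in> \<int>"
        using \<mu> mult_cj_in_norm[OF lm(3,4)] unfolding dual_ideal_def by blast
      then show "quat_form \<mu> l m \<in> \<int>" by (simp add: lm(1,2) eq int)
    qed
  qed
qed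

text \<open>The base vector is \<open>emb 1\<close> and \<open>cj 1 = 1\<close>; nondegeneracy of
  the trace form gives uniqueness.\<close>

lemma represents_quat_form: "represents \<iota> \<phi> \<tau> (quat_form \<mu>) \<nu> \<longleftrightarrow> \<nu> = \<mu>"
proof -
  have "represents \<iota> \<phi> \<tau> (quat_form \<mu>) \<nu> \<longleftrightarrow> (\<forall>\<beta>. tr_BQ \<iota> (\<mu> * \<beta>) = tr_BQ \<iota> (\<nu> * \<beta>))"
    unfolding represents_def emb_def[symmetric] unfolding emb_1[symmetric] unfolding quat_form_emb by simp
  also have "\<dots> \<longleftrightarrow> \<nu> = \<mu>" using tr_cancel[of \<mu> \<nu>] by auto
  finally show ?thesis .
qed

lemma c1_NS_quat_form:
  assumes "L \<in> carrier (NS \<Lambda>)"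
  shows "c1_NS \<Lambda> L = quat_form (mu \<iota> \<phi> \<tau> I L)"
    and "mu \<iota> \<phi> \<tau> I L \<in> pure_dual_ideal \<iota> (norm_two_sided \<iota> \<O> I)"
proof -
  have E: "c1_NS \<Lambda> L \<in> riemann_forms \<Lambda>"
    using L.c1_NS_iso assms by (auto simp: iso_def hom_def form_group_def)
  then obtain \<mu> where \<mu>: "trd \<iota> \<mu> = 0" "c1_NS \<Lambda> L = quat_form \<mu>" using riemann_form_quat_form by blast
  have "mu \<iota> \<phi> \<tau> I L = \<mu>"
    unfolding mu_def \<Lambda>_def[symmetric] \<mu>(2) represents_quat_form by simp
  then show "c1_NS \<Lambda> L = quat_form (mu \<iota> \<phi> \<tau> I L)"
    "mu \<iota> \<phi> \<tau> I L \<in> pure_dual_ideal \<iota> (norm_two_sided \<iota> \<O> I)"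
    using \<mu> E quat_form_riemann_iff[OF \<mu>(1)] by (simp_all add: pure_dual_ideal_def pure_quaternions_def)
qed

lemma mu_eqI:
  assumes "c1_NS \<Lambda> L = quat_form \<mu>"
  shows "mu \<iota> \<phi> \<tau> I L = \<mu>"
  unfolding mu_def \<Lambda>_def[symmetric] assms represents_quat_form by simp

lemma mu_inj:
  assumes "L1 \<in> carrier (NS \<Lambda>)" "L2 \<in> carrier (NS \<Lambda>)" "mu \<iota> \<phi> \<tau> I L1 = mu \<iota> \<phi> \<tau> I L2"
  shows "L1 = L2"
proof -
  have inj: "inj_on (c1_NS \<Lambda>) (carrier (NS \<Lambda>))" using L.c1_NS_iso by (auto simp: iso_def bij_betw_def)
  have "c1_NS \<Lambda> L1 = c1_NS \<Lambda> L2" by (simp only: c1_NS_quat_form(1) assms)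
  then show ?thesis by (rule inj_onD[OF inj _ assms(1,2)])
qed

text \<open>The composite of \<open>c1_NS\<close> with the inverse of the additive map \<mu> to
  \<open>quat_form \<mu>\<close>.\<close>

lemma mu_iso: "mu \<iota> \<phi> \<tau> I \<in> iso (NS \<Lambda>) (additive_group (pure_dual_ideal \<iota> (norm_two_sided \<iota> \<O> I)))"
proof -
  let ?D = "pure_dual_ideal \<iota> (norm_two_sided \<iota> \<O> I)"
  have hom: "c1_NS \<Lambda> \<in> hom (NS \<Lambda>) (form_group \<Lambda>)" and surj: "c1_NS \<Lambda> ` carrier (NS \<Lambda>) = riemann_forms \<Lambda>"
    using L.c1_NS_iso by (auto simp: iso_def bij_betw_def form_group_def)
  have "mu \<iota> \<phi> \<tau> I \<in> hom (NS \<Lambda>) (additive_group ?D)"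
  proof (rule homI)
    fix L1 assume "L1 \<in> carrier (NS \<Lambda>)"
    then show "mu \<iota> \<phi> \<tau> I L1 \<in> carrier (additive_group ?D)" by (simp add: additive_group_def c1_NS_quat_form)
  next
    fix L1 L2 assume L: "L1 \<in> carrier (NS \<Lambda>)" "L2 \<in> carrier (NS \<Lambda>)"
    have "c1_NS \<Lambda> (L1 \<otimes>\<^bsub>NS \<Lambda>\<^esub> L2) = quat_form (mu \<iota> \<phi> \<tau> I L1 + mu \<iota> \<phi> \<tau> I L2)"
      using hom_mult[OF hom L] by (simp add: form_group_def c1_NS_quat_form L quat_form_add[abs_def])
    then show "mu \<iota> \<phi> \<tau> I (L1 \<otimes>\<^bsub>NS \<Lambda>\<^esub> L2) = mu \<iota> \<phi> \<tau> I L1 \<otimes>\<^bsub>additive_group ?D\<^esub> mu \<iota> \<phi> \<tau> I L2"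
      by (simp add: additive_group_def mu_eqI)
  qed
  moreover have "bij_betw (mu \<iota> \<phi> \<tau> I) (carrier (NS \<Lambda>)) ?D"
    unfolding bij_betw_def
  proof
    show "inj_on (mu \<iota> \<phi> \<tau> I) (carrier (NS \<Lambda>))" by (rule inj_onI) (rule mu_inj)
    show "mu \<iota> \<phi> \<tau> I ` carrier (NS \<Lambda>) = ?D"
    proof
      show "mu \<iota> \<phi> \<tau> I ` carrier (NS \<Lambda>) \<subseteq> ?D" using c1_NS_quat_form(2) by blast
      show "?D \<subseteq> mu \<iota> \<phi> \<tau> I ` carrier (NS \<Lambda>)"
      proof
        fix \<mu> assume "\<mu> \<in> ?D"
        then have "quat_form \<mu> \<in> riemann_forms \<Lambda>"
          using quat_form_riemann_iff[of \<mu>] by (simp add: pure_dual_ideal_def pure_quaternions_def)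
        then obtain L where L: "L \<in> carrier (NS \<Lambda>)" "c1_NS \<Lambda> L = quat_form \<mu>" unfolding surj[symmetric] by auto
        then have "\<mu> = mu \<iota> \<phi> \<tau> I L" by (simp add: mu_eqI)
        then show "\<mu> \<in> mu \<iota> \<phi> \<tau> I ` carrier (NS \<Lambda>)" using L(1) by (rule image_eqI)
      qed
    qed
  qed
  ultimately show ?thesis by (simp add: iso_def additive_group_def)
qed

section \<open>Automorphisms and isomorphism classes\<close>

lemma quat_matrix_mult: "quat_matrix \<phi> (\<alpha> * \<beta>) = quat_matrix \<phi> \<alpha> ** quat_matrix \<phi> \<beta>"
  unfolding matrix_eq by (simp add: quat_matrix_mult_vector matrix_vector_mul_assoc[symmetric])

lemma quat_matrix_1_eq: "quat_matrix \<phi> 1 = mat 1"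
  unfolding matrix_eq by (simp add: quat_matrix_1)

lemma Aut_torus_eq: "Aut_torus \<Lambda> = quat_matrix \<phi> ` order_units \<O>"
proof -
  have "End_torus \<Lambda> = quat_matrix \<phi> ` \<O>" using End_torus by (simp add: \<Lambda>_def)
  moreover have "quat_matrix \<phi> \<alpha> ** quat_matrix \<phi> \<beta> = mat 1 \<longleftrightarrow> \<alpha> * \<beta> = 1" for \<alpha> \<beta>
    unfolding quat_matrix_mult[symmetric] quat_matrix_1_eq[symmetric] by (auto dest: quat_matrix_inj)
  ultimately show ?thesis unfolding Aut_torus_def order_units_def by (auto intro!: imageI)
qed

text \<open>\<open>cj (\<alpha> * \<gamma>)\<close> ends in \<open>cj \<alpha>\<close>, which the
  cyclic trace moves to the front.\<close>

lemma quat_form_pullback: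
  "(\<lambda>u w. quat_form \<mu> (quat_matrix \<phi> \<alpha> *v u) (quat_matrix \<phi> \<alpha> *v w)) = quat_form (cj \<alpha> * \<mu> * \<alpha>)"
proof (rule bilinear_eqI[OF _ bilinear_quat_form])
  have lin: "linear (\<lambda>v. quat_matrix \<phi> \<alpha> *v v)"
    by (intro linearI) (simp_all add: matrix_vector_right_distrib flip: of_real_scalar_mult add: vector_scalar_commute)
  show "bilinear (\<lambda>u w. quat_form \<mu> (quat_matrix \<phi> \<alpha> *v u) (quat_matrix \<phi> \<alpha> *v w))"
    using bilinear_quat_form[of \<mu>] linear_compose[OF lin, unfolded comp_def] unfolding bilinear_def by blast
  fix \<beta> \<gamma>
  have "tr_BQ \<iota> (\<mu> * (\<alpha> * \<beta>) * cj (\<alpha> * \<gamma>)) = tr_BQ \<iota> ((\<mu> * (\<alpha> * \<beta>) * cj \<gamma>) * cj \<alpha>)"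
    by (simp only: cj_mult mult.assoc)
  also have "\<dots> = tr_BQ \<iota> (cj \<alpha> * (\<mu> * (\<alpha> * \<beta>) * cj \<gamma>))" by (rule tr_commute)
  finally show "quat_form \<mu> (quat_matrix \<phi> \<alpha> *v emb \<beta>) (quat_matrix \<phi> \<alpha> *v emb \<gamma>) =
      quat_form (cj \<alpha> * \<mu> * \<alpha>) (emb \<beta>) (emb \<gamma>)"
    unfolding emb_mult[symmetric] quat_form_emb by (simp only: mult.assoc)
qed

lemma mu_pullback:
  assumes "\<alpha> \<in> order_units \<O>" "L \<in> carrier (NS \<Lambda>)"
  shows "pullback_NS (quat_matrix \<phi> \<alpha>) L \<in> carrier (NS \<Lambda>)"
    "mu \<iota> \<phi> \<tau> I (pullback_NS (quat_matrix \<phi> \<alpha>) L) = cj \<alpha> * mu \<iota> \<phi> \<tau> I L * \<alpha>"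
proof -
  have M: "quat_matrix \<phi> \<alpha> \<in> Aut_torus \<Lambda>" using assms(1) by (simp add: Aut_torus_eq)
  show "pullback_NS (quat_matrix \<phi> \<alpha>) L \<in> carrier (NS \<Lambda>)" by (rule L.pullback_NS(1)[OF M assms(2)])
  show "mu \<iota> \<phi> \<tau> I (pullback_NS (quat_matrix \<phi> \<alpha>) L) = cj \<alpha> * mu \<iota> \<phi> \<tau> I L * \<alpha>"
    by (rule mu_eqI)
       (simp only: L.pullback_NS(2)[OF M assms(2)] c1_NS_quat_form(1)[OF assms(2)] quat_form_pullback)
qed

lemma NS_isomorphic_iff:
  assumes L: "L1 \<in> carrier (NS \<Lambda>)" "L2 \<in> carrier (NS \<Lambda>)"
  shows "NS_isomorphic \<Lambda> L1 L2 \<longleftrightarrow> (\<exists>\<alpha>\<in>order_units \<O>. mu \<iota> \<phi> \<tau> I L1 = cj \<alpha> * mu \<iota> \<phi> \<tau> I L2 * \<alpha>)"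
proof
  assume "NS_isomorphic \<Lambda> L1 L2"
  then obtain \<alpha> where "\<alpha> \<in> order_units \<O>" "L1 = pullback_NS (quat_matrix \<phi> \<alpha>) L2"
    unfolding NS_isomorphic_def Aut_torus_eq by blast
  then show "\<exists>\<alpha>\<in>order_units \<O>. mu \<iota> \<phi> \<tau> I L1 = cj \<alpha> * mu \<iota> \<phi> \<tau> I L2 * \<alpha>"
    using mu_pullback(2)[OF _ L(2)] by blast
next
  assume "\<exists>\<alpha>\<in>order_units \<O>. mu \<iota> \<phi> \<tau> I L1 = cj \<alpha> * mu \<iota> \<phi> \<tau> I L2 * \<alpha>"
  then obtain \<alpha> where \<alpha>: "\<alpha> \<in> order_units \<O>" "mu \<iota> \<phi> \<tau> I L1 = cj \<alpha> * mu \<iota> \<phi> \<tau> I L2 * \<alpha>" by blast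
  have "L1 = pullback_NS (quat_matrix \<phi> \<alpha>) L2"
    by (rule mu_inj[OF L(1) mu_pullback(1)[OF \<alpha>(1) L(2)]]) (simp only: \<alpha>(2) mu_pullback(2)[OF \<alpha>(1) L(2)])
  then show "NS_isomorphic \<Lambda> L1 L2" unfolding NS_isomorphic_def Aut_torus_eq using \<alpha>(1) by blast
qed

end

theorem theorem2p2:
  fixes \<iota> :: "'f::field_char_0 \<Rightarrow> 'b::division_ring"
    and \<sigma> :: "'n::finite \<Rightarrow> 'f \<Rightarrow> real"
    and \<phi> :: "'n \<Rightarrow> 'b \<Rightarrow> real^2^2"
    and \<tau> :: "'n \<Rightarrow> complex"
    and \<O> I :: "'b set"
  assumes "number_field TYPE('f)" and "totally_real TYPE('f)"
    and "field_degree TYPE('f) = CARD('n)"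
    and "bij_betw \<sigma> UNIV real_embeddings"
    and "quaternion_algebra \<iota>"
    and "\<And>k. splitting \<iota> (\<sigma> k) (\<phi> k)"
    and "hereditary_order \<iota> \<O>"
    and "left_ideal \<iota> \<O> I"
    and "\<And>k. Im (\<tau> k) \<noteq> 0"
    and "polarizable (QM_lattice \<phi> \<tau> I)"
    and "End_torus (QM_lattice \<phi> \<tau> I) = quat_matrix \<phi> ` \<O>"
  shows "(\<forall>L\<in>carrier (NS (QM_lattice \<phi> \<tau> I)).
           \<exists>!\<mu>. represents \<iota> \<phi> \<tau> (c1_NS (QM_lattice \<phi> \<tau> I) L) \<mu>) \<and>
         mu \<iota> \<phi> \<tau> I \<in> iso (NS (QM_lattice \<phi> \<tau> I))
           (additive_group (pure_dual_ideal \<iota> (norm_two_sided \<iota> \<O> I))) \<and>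
         (\<forall>L1\<in>carrier (NS (QM_lattice \<phi> \<tau> I)). \<forall>L2\<in>carrier (NS (QM_lattice \<phi> \<tau> I)).
           NS_isomorphic (QM_lattice \<phi> \<tau> I) L1 L2 \<longleftrightarrow>
           (\<exists>\<alpha>\<in>order_units \<O>.
              mu \<iota> \<phi> \<tau> I L1 = quat_conj \<iota> \<alpha> * mu \<iota> \<phi> \<tau> I L2 * \<alpha>))"
proof -
  interpret quat_torus \<iota> \<sigma> \<phi> \<tau> \<O> I
    by unfold_locales (fact assms)+
  have "\<exists>!\<mu>. represents \<iota> \<phi> \<tau> (c1_NS \<Lambda> L) \<mu>" if "L \<in> carrier (NS \<Lambda>)" for L
    unfolding c1_NS_quat_form(1)[OF that] represents_quat_form by simp
  then show ?thesis
    unfolding \<Lambda>_def[symmetric] using mu_iso NS_isomorphic_iff by blast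
qed

end
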